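(* Let $G$ be a compact Lie group and let $\mathcal{C}$ be a set of closed subgroups of $G$ which is closed under conjugacy. If $i: A \to B$ is a map of $G$-spaces and there is a $G$-numerable open cover $\mathcal{U}$ of $B$ such that for every $U \in \mathcal{U}$ the restriction $i|_{A\cap U}: A \cap U \to U$ is a $\mathcal{C}$-cofibration, where $A\cap U := i^{-1}(U)$, then $i$ is a $\mathcal{C}$-cofibration.
   Context: All spaces are compactly generated weak Hausdorff, and all maps of $G$-spaces are $G$-equivariant. $I=[0,1]$ has trivial action. A $G$-numerable open cover $\{U_j\}_{j\in J}$ of a $G$-space $B$ is a locally finite open cover of $B$ such that for every $j\in J$ there exists an equivariant map $\lambda_j:B\to I$ with $U_j=\lambda_j^{-1}((0,1])$. The $\mathcal{C}$-model structure on $G$-spaces is the topological model structure cofibrantly generated by the generating cofibrations $G/H\times S^{n-1}\to G/H\times D^n$ ($n\ge 0$, $H\in\mathcal{C}$) and the generating acyclic cofibrations $G/H\times D^n\to G/H\times D^n\times I$ (inclusion at $0$; $n\ge 0$, $H\in\mathcal{C}$). Its fibrations (resp. weak equivalences) are the $G$-maps $p$ such that $p^H$ is a Serre fibration (resp. weak homotopy equivalence) for every $H\in\mathcal{C}$. Its cofibrations are called $\mathcal{C}$-cofibrations. *)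

theory Defs
  imports "HOL-Analysis.Analysis" "HOL-Algebra.Group_Action"
begin

section \<open>Compactly generated weak Hausdorff spaces\<close>

text \<open>
  Both notions below test a space on continuous maps from compact Hausdorff spaces \<open>K\<close>. Here \<open>K\<close>
  ranges over spaces with points in \<open>'a set set\<close>, which is no restriction: if \<open>u\<close> maps an arbitrary
  compact Hausdorff \<open>K\<close> to \<open>X\<close>, choose one point in each fibre over the image; the closure of these
  points is a compact Hausdorff subspace of \<open>K\<close> with the same image and, being the Hausdorff closure
  of a set no larger than \<open>X\<close>, has at most as many points as \<open>'a set set\<close>. This settles the weak
  Hausdorff property; in a weak Hausdorff space all images \<open>u K\<close> are compact Hausdorff and
  \<open>K \<rightarrow> u K\<close> is a quotient map, so for compact generation the compact Hausdorff subspaces of \<open>X\<close>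
  suffice. The library's \<open>k_space\<close> is not used because it tests on all compact subsets,
  Hausdorff or not.
\<close>

definition weak_Hausdorff :: "'a topology \<Rightarrow> bool" where
  "weak_Hausdorff X \<longleftrightarrow>
     (\<forall>(K :: 'a set set topology) u.
        compact_space K \<and> Hausdorff_space K \<and> continuous_map K X u
        \<longrightarrow> closedin X (u ` topspace K))"

definition compactly_generated :: "'a topology \<Rightarrow> bool" where
  "compactly_generated X \<longleftrightarrow>
     (\<forall>S \<subseteq> topspace X.
        (\<forall>(K :: 'a set set topology) u.
           compact_space K \<and> Hausdorff_space K \<and> continuous_map K X u
           \<longrightarrow> closedin K {k \<in> topspace K. u k \<in> S})
        \<longrightarrow> closedin X S)"

definition CGWH :: "'a topology \<Rightarrow> bool" where
  "CGWH X \<longleftrightarrow> compactly_generated X \<and> weak_Hausdorff X"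


section \<open>Compact Lie groups\<close>

text \<open>
  Charts take values in \<^const>\<open>Euclidean_space\<close> \<open>n\<close> (real sequences vanishing from index \<open>n\<close> on)
  rather than in a type of class \<open>euclidean_space\<close>, because the latter excludes dimension 0 and
  hence finite groups.

  \<open>Ck_on n k S f\<close>: on the open subset \<open>S\<close> of \<^const>\<open>Euclidean_space\<close> \<open>n\<close>, all iterated
  partial derivatives of \<open>f\<close> up to order \<open>k\<close> exist, and those of order \<open>k\<close> are continuous.
\<close>

primrec Ck_on :: "nat \<Rightarrow> nat \<Rightarrow> (nat \<Rightarrow> real) set \<Rightarrow> ((nat \<Rightarrow> real) \<Rightarrow> real) \<Rightarrow> bool" where
  "Ck_on n 0 S f \<longleftrightarrow> continuous_map (subtopology (Euclidean_space n) S) euclideanreal f"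
| "Ck_on n (Suc k) S f \<longleftrightarrow>
     continuous_map (subtopology (Euclidean_space n) S) euclideanreal f \<and>
     (\<forall>i<n. (\<forall>x\<in>S. (\<lambda>t. f (x(i := t))) field_differentiable at (x i)) \<and>
            Ck_on n k S (\<lambda>x. deriv (\<lambda>t. f (x(i := t))) (x i)))"

definition smooth_on :: "nat \<Rightarrow> nat \<Rightarrow> (nat \<Rightarrow> real) set \<Rightarrow> ((nat \<Rightarrow> real) \<Rightarrow> (nat \<Rightarrow> real)) \<Rightarrow> bool" where
  "smooth_on n m S f \<longleftrightarrow> (\<forall>j<m. \<forall>k. Ck_on n k S (\<lambda>x. f x j))"

definition smooth_atlas :: "nat \<Rightarrow> 'g topology \<Rightarrow> ('g set \<times> ('g \<Rightarrow> nat \<Rightarrow> real)) set \<Rightarrow> bool" where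
  "smooth_atlas n T \<A> \<longleftrightarrow>
     (\<Union>(U, \<phi>)\<in>\<A>. U) = topspace T \<and>
     (\<forall>(U, \<phi>)\<in>\<A>. openin T U \<and> openin (Euclidean_space n) (\<phi> ` U) \<and>
        homeomorphic_map (subtopology T U) (subtopology (Euclidean_space n) (\<phi> ` U)) \<phi>) \<and>
     (\<forall>(U, \<phi>)\<in>\<A>. \<forall>(V, \<psi>)\<in>\<A>. smooth_on n n (\<phi> ` (U \<inter> V)) (\<lambda>z. \<psi> (inv_into U \<phi> z)))"

definition topological_group :: "('g, 'm) monoid_scheme \<Rightarrow> 'g topology \<Rightarrow> bool" where
  "topological_group G T \<longleftrightarrow>
     group G \<and> topspace T = carrier G \<and>
     continuous_map (prod_topology T T) T (\<lambda>(x, y). x \<otimes>\<^bsub>G\<^esub> y) \<and>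
     continuous_map T T (\<lambda>x. inv\<^bsub>G\<^esub> x)"

text \<open>The two factors of a point of \<open>\<real>\<^sup>n\<^sup>+\<^sup>n = \<real>\<^sup>n \<times> \<real>\<^sup>n\<close>.\<close>

definition left_part :: "nat \<Rightarrow> (nat \<Rightarrow> real) \<Rightarrow> (nat \<Rightarrow> real)" where
  "left_part n z = (\<lambda>i. if i < n then z i else 0)"

definition right_part :: "nat \<Rightarrow> (nat \<Rightarrow> real) \<Rightarrow> (nat \<Rightarrow> real)" where
  "right_part n z = (\<lambda>i. z (n + i))"

definition Lie_group :: "('g, 'm) monoid_scheme \<Rightarrow> 'g topology \<Rightarrow> bool" where
  "Lie_group G T \<longleftrightarrow>
     topological_group G T \<and> Hausdorff_space T \<and> second_countable T \<and>
     (\<exists>n \<A>. smooth_atlas n T \<A> \<and>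
        (\<forall>(U, \<phi>)\<in>\<A>. \<forall>(V, \<psi>)\<in>\<A>. \<forall>(W, \<omega>)\<in>\<A>.
           smooth_on (n + n) n
             {z \<in> topspace (Euclidean_space (n + n)).
                left_part n z \<in> \<phi> ` U \<and> right_part n z \<in> \<psi> ` V \<and>
                inv_into U \<phi> (left_part n z) \<otimes>\<^bsub>G\<^esub> inv_into V \<psi> (right_part n z) \<in> W}
             (\<lambda>z. \<omega> (inv_into U \<phi> (left_part n z) \<otimes>\<^bsub>G\<^esub> inv_into V \<psi> (right_part n z)))) \<and>
        (\<forall>(U, \<phi>)\<in>\<A>. \<forall>(V, \<psi>)\<in>\<A>.
           smooth_on n n (\<phi> ` {x \<in> U. inv\<^bsub>G\<^esub> x \<in> V}) (\<lambda>z. \<psi> (inv\<^bsub>G\<^esub> (inv_into U \<phi> z)))))"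

definition compact_Lie_group :: "('g, 'm) monoid_scheme \<Rightarrow> 'g topology \<Rightarrow> bool" where
  "compact_Lie_group G T \<longleftrightarrow> Lie_group G T \<and> compact_space T"


section \<open>$G$-spaces\<close>

record ('g, 'a) gspace =
  space_of :: "'a topology"
  act :: "'g \<Rightarrow> 'a \<Rightarrow> 'a"

abbreviation points :: "('g, 'a) gspace \<Rightarrow> 'a set" where
  "points X \<equiv> topspace (space_of X)"

text \<open>
  The library's \<^const>\<open>group_action\<close> wants each element of the group to act by a function that is
  undefined off the set acted upon, hence the \<^const>\<open>restrict\<close>. Since the group will be compact
  Hausdorff, the ordinary product topology on \<open>G \<times> X\<close> is already the compactly generated one.
\<close>

definition G_space :: "('g, 'm) monoid_scheme \<Rightarrow> 'g topology \<Rightarrow> ('g, 'a) gspace \<Rightarrow> bool" where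
  "G_space G T X \<longleftrightarrow>
     CGWH (space_of X) \<and>
     group_action G (points X) (\<lambda>g. restrict (act X g) (points X)) \<and>
     continuous_map (prod_topology T (space_of X)) (space_of X) (\<lambda>(g, x). act X g x)"

definition G_map ::
  "('g, 'm) monoid_scheme \<Rightarrow> ('g, 'a) gspace \<Rightarrow> ('g, 'b) gspace \<Rightarrow> ('a \<Rightarrow> 'b) \<Rightarrow> bool" where
  "G_map G X Y f \<longleftrightarrow>
     continuous_map (space_of X) (space_of Y) f \<and>
     (\<forall>g\<in>carrier G. \<forall>x\<in>points X. f (act X g x) = act Y g (f x))"

definition restrict_gspace :: "('g, 'a) gspace \<Rightarrow> 'a set \<Rightarrow> ('g, 'a) gspace" where
  "restrict_gspace X S = X\<lparr>space_of := subtopology (space_of X) S\<rparr>"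

definition fixed_points :: "'g set \<Rightarrow> ('g, 'a) gspace \<Rightarrow> 'a topology" where
  "fixed_points H X = subtopology (space_of X) {x \<in> points X. \<forall>h\<in>H. act X h x = x}"

definition unit_interval :: "real topology" where
  "unit_interval = top_of_set {0..1}"

definition trivial_interval :: "('g, real) gspace" where
  "trivial_interval = \<lparr>space_of = unit_interval, act = (\<lambda>g t. t)\<rparr>"

definition G_numerable_open_cover ::
  "('g, 'm) monoid_scheme \<Rightarrow> ('g, 'b) gspace \<Rightarrow> 'j set \<Rightarrow> ('j \<Rightarrow> 'b set) \<Rightarrow> bool" where
  "G_numerable_open_cover G B J U \<longleftrightarrow>
     (\<forall>j\<in>J. openin (space_of B) (U j)) \<and>
     (\<Union>j\<in>J. U j) = points B \<and>
     (\<forall>b\<in>points B. \<exists>N. openin (space_of B) N \<and> b \<in> N \<and> finite {j \<in> J. U j \<inter> N \<noteq> {}}) \<and>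
     (\<forall>j\<in>J. \<exists>l. G_map G B trivial_interval l \<and> U j = {b \<in> points B. l b \<in> {0<..1}})"


section \<open>Serre fibrations and weak homotopy equivalences\<close>

definition disc :: "nat \<Rightarrow> (nat \<Rightarrow> real) topology" where
  "disc n = subtopology (Euclidean_space n) {x. (\<Sum>i<n. (x i)\<^sup>2) \<le> 1}"

text \<open>For \<open>n = 0\<close> the boundary is empty.\<close>

definition disc_boundary :: "nat \<Rightarrow> (nat \<Rightarrow> real) set" where
  "disc_boundary n = {x \<in> topspace (disc n). (\<Sum>i<n. (x i)\<^sup>2) = 1}"

definition Serre_fibration :: "'e topology \<Rightarrow> 'b topology \<Rightarrow> ('e \<Rightarrow> 'b) \<Rightarrow> bool" where
  "Serre_fibration E B p \<longleftrightarrow>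
     continuous_map E B p \<and>
     (\<forall>n f h.
        continuous_map (disc n) E f \<and>
        continuous_map (prod_topology (disc n) unit_interval) B h \<and>
        (\<forall>x\<in>topspace (disc n). h (x, 0) = p (f x))
        \<longrightarrow> (\<exists>k. continuous_map (prod_topology (disc n) unit_interval) E k \<and>
                 (\<forall>x\<in>topspace (disc n). k (x, 0) = f x) \<and>
                 (\<forall>z\<in>topspace (prod_topology (disc n) unit_interval). p (k z) = h z)))"

text \<open>
  The elements of \<open>\<pi>\<^sub>n(X, x)\<close> are the classes of maps \<open>(D\<^sup>n, S\<^sup>n\<^sup>-\<^sup>1) \<rightarrow> (X, x)\<close> under
  homotopy relative to the boundary.
\<close>

definition spheroid :: "nat \<Rightarrow> 'a topology \<Rightarrow> 'a \<Rightarrow> ((nat \<Rightarrow> real) \<Rightarrow> 'a) \<Rightarrow> bool" where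
  "spheroid n X x f \<longleftrightarrow> continuous_map (disc n) X f \<and> (\<forall>s\<in>disc_boundary n. f s = x)"

definition spheroid_homotopic ::
  "nat \<Rightarrow> 'a topology \<Rightarrow> 'a \<Rightarrow> ((nat \<Rightarrow> real) \<Rightarrow> 'a) \<Rightarrow> ((nat \<Rightarrow> real) \<Rightarrow> 'a) \<Rightarrow> bool" where
  "spheroid_homotopic n X x f g \<longleftrightarrow>
     homotopic_with (\<lambda>h. \<forall>s\<in>disc_boundary n. h s = x) (disc n) X f g"

text \<open>
  Bijectivity on path components, and on \<open>\<pi>\<^sub>n\<close> for all \<open>n \<ge> 1\<close> and all base points; in each case
  injectivity and surjectivity of the induced map are spelled out on representatives.
\<close>

definition weak_homotopy_equivalence :: "'a topology \<Rightarrow> 'b topology \<Rightarrow> ('a \<Rightarrow> 'b) \<Rightarrow> bool" where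
  "weak_homotopy_equivalence X Y p \<longleftrightarrow>
     continuous_map X Y p \<and>
     (\<forall>x\<in>topspace X. \<forall>x'\<in>topspace X.
        path_component_of Y (p x) (p x') \<longrightarrow> path_component_of X x x') \<and>
     (\<forall>y\<in>topspace Y. \<exists>x\<in>topspace X. path_component_of Y (p x) y) \<and>
     (\<forall>n\<ge>1. \<forall>x\<in>topspace X.
        (\<forall>f g. spheroid n X x f \<and> spheroid n X x g \<and>
               spheroid_homotopic n Y (p x) (p \<circ> f) (p \<circ> g)
               \<longrightarrow> spheroid_homotopic n X x f g) \<and>
        (\<forall>g. spheroid n Y (p x) g
             \<longrightarrow> (\<exists>f. spheroid n X x f \<and> spheroid_homotopic n Y (p x) (p \<circ> f) g)))"


section \<open>The \<open>\<C>\<close>-model structure\<close>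

definition C_fibration ::
  "('g, 'm) monoid_scheme \<Rightarrow> 'g set set \<Rightarrow> ('g, 'a) gspace \<Rightarrow> ('g, 'b) gspace \<Rightarrow> ('a \<Rightarrow> 'b) \<Rightarrow> bool" where
  "C_fibration G \<C> X Y p \<longleftrightarrow>
     G_map G X Y p \<and> (\<forall>H\<in>\<C>. Serre_fibration (fixed_points H X) (fixed_points H Y) p)"

definition C_weak_equivalence ::
  "('g, 'm) monoid_scheme \<Rightarrow> 'g set set \<Rightarrow> ('g, 'a) gspace \<Rightarrow> ('g, 'b) gspace \<Rightarrow> ('a \<Rightarrow> 'b) \<Rightarrow> bool" where
  "C_weak_equivalence G \<C> X Y p \<longleftrightarrow>
     G_map G X Y p \<and> (\<forall>H\<in>\<C>. weak_homotopy_equivalence (fixed_points H X) (fixed_points H Y) p)"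

definition has_lifting_property ::
  "('g, 'm) monoid_scheme \<Rightarrow> ('g, 'a) gspace \<Rightarrow> ('g, 'b) gspace \<Rightarrow> ('a \<Rightarrow> 'b)
    \<Rightarrow> ('g, 'x) gspace \<Rightarrow> ('g, 'y) gspace \<Rightarrow> ('x \<Rightarrow> 'y) \<Rightarrow> bool" where
  "has_lifting_property G A B i X Y p \<longleftrightarrow>
     (\<forall>u v. G_map G A X u \<and> G_map G B Y v \<and> (\<forall>a\<in>points A. p (u a) = v (i a))
        \<longrightarrow> (\<exists>l. G_map G B X l \<and> (\<forall>a\<in>points A. l (i a) = u a) \<and> (\<forall>b\<in>points B. p (l b) = v b)))"

text \<open>
  The cofibrations of a model structure are the maps with the left lifting property against all
  maps that are both fibrations and weak equivalences. HOL cannot quantify over the types that carry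
  the test maps \<open>X \<rightarrow> Y\<close>, so the carrier type \<open>'u\<close> is a parameter; being a cofibration means
  \<open>C_cofibration TYPE('u)\<close> for every type \<open>'u\<close>.
\<close>

definition C_cofibration ::
  "'u itself \<Rightarrow> ('g, 'm) monoid_scheme \<Rightarrow> 'g topology \<Rightarrow> 'g set set
    \<Rightarrow> ('g, 'a) gspace \<Rightarrow> ('g, 'b) gspace \<Rightarrow> ('a \<Rightarrow> 'b) \<Rightarrow> bool" where
  "C_cofibration (_ :: 'u itself) G T \<C> A B i \<longleftrightarrow>
     G_space G T A \<and> G_space G T B \<and> G_map G A B i \<and>
     (\<forall>(X :: ('g, 'u) gspace) (Y :: ('g, 'u) gspace) p.
        G_space G T X \<and> G_space G T Y \<and> C_fibration G \<C> X Y p \<and> C_weak_equivalence G \<C> X Y p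
        \<longrightarrow> has_lifting_property G A B i X Y p)"

text \<open>
  For maps between spaces carried by \<open>'a\<close> and \<open>'b\<close>, one type \<open>'u\<close> decides the matter as soon as
  \<open>'u\<close> is large: by the small object argument (countably many stages of attaching cells
  \<open>G/H \<times> D\<^sup>n\<close>, where \<open>G\<close> has at most continuum many points) \<open>i : A \<rightarrow> B\<close> factors
  as a relative cell complex \<open>A \<rightarrow> X\<close> followed by a fibration and weak equivalence \<open>X \<rightarrow> B\<close>,
  where \<open>X\<close> has at most as many points as the type below, and a lift in this one square exhibits
  \<open>i\<close> as a retract of \<open>A \<rightarrow> X\<close>. The additional summand \<open>'u\<close> lets the type also contain a copy
  of each space carried by \<open>'u\<close>. A cofibration hypothesis tested on this single type is thus
  equivalent to the full one, while a conclusion for an arbitrary type \<open>'u\<close> is the full one.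
\<close>

type_synonym ('g, 'a, 'b, 'u) test_universe = "('g + 'a + 'b + 'u + real) set"

definition conjugation_closed_subgroups ::
  "('g, 'm) monoid_scheme \<Rightarrow> 'g topology \<Rightarrow> 'g set set \<Rightarrow> bool" where
  "conjugation_closed_subgroups G T \<C> \<longleftrightarrow>
     (\<forall>H\<in>\<C>. subgroup H G \<and> closedin T H) \<and>
     (\<forall>H\<in>\<C>. \<forall>g\<in>carrier G. g <#\<^bsub>G\<^esub> H #>\<^bsub>G\<^esub> inv\<^bsub>G\<^esub> g \<in> \<C>)"

end

theory Submission
  imports Defs
begin

text \<open>
Let \<open>p : X \<rightarrow> Y\<close> be a fibration and weak equivalence and let \<open>(u, v)\<close> be a lifting problem for \<open>i\<close>
against \<open>p\<close>. Over each member of the cover a lift exists, but two lifts need not agree on the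
overlap. They would be spliced by a homotopy between them over \<open>Y\<close> and under \<open>A\<close>, whose time
parameter is driven by a partition function. The point of the proof is that a lift together with such
a homotopy is again a lift, for one other acyclic fibration.

Suppose that \<open>U\<close> is a member of the cover, that \<open>\<tau> : U \<rightarrow> I\<close> is an invariant function and that a lift
\<open>s\<close> is already given on \<open>{\<tau> > 0}\<close>. Consider the map
\<open>\<Theta> : {(t, x, \<gamma>)} \<rightarrow> {(t, y, x')}\<close>, \<open>(t, x, \<gamma>) \<mapsto> (t, p x, \<gamma> 1)\<close>,
where \<open>\<gamma>\<close> is a path in a fibre of \<open>p\<close> that starts at \<open>x\<close>, where \<open>p x' = y\<close>, and where \<open>\<gamma>\<close> and \<open>x'\<close>
are present only when \<open>t > 0\<close>; source and target are mapping cylinders. The data \<open>(\<tau>, v, s)\<close> is a map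
from \<open>U\<close> to the target, the data \<open>(\<tau> i, u, constant path)\<close> is a map from \<open>A \<inter> U\<close> to the source, and a
diagonal consists of a lift \<open>z\<close> on all of \<open>U\<close> and paths from \<open>z\<close> to \<open>s\<close> on \<open>{\<tau> > 0}\<close>. Running along
these paths while \<open>\<tau>\<close> grows from \<open>1/3\<close> to \<open>2/3\<close> gives a lift on \<open>U\<close> that is equal to \<open>s\<close> where
\<open>\<tau> \<ge> 2/3\<close>; this is \<open>extend_partial_lift\<close>.

Let now \<open>s\<close> be a lift over the union \<open>W\<close> of some members of the cover, let \<open>\<sigma>\<close> be the sum of the functions that define
these members and \<open>\<mu>\<close> the function that defines \<open>U\<close>, and take \<open>\<tau> = \<sigma> / (\<sigma> + \<mu>)\<close>. The set where
\<open>\<sigma> > 2 \<mu>\<close> and on which \<open>s\<close> is kept is open, and together with \<open>U\<close> it covers \<open>W \<union> U\<close>. So \<open>s\<close> can be altered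
inside \<open>U\<close> and then extended over \<open>U\<close>. Local finiteness makes repeated alterations stationary near
each point, so that Zorn's lemma finishes the proof.

The diagonal exists as soon as \<open>\<Theta>\<close> is a fibration and weak equivalence on all fixed point spaces. A map
is an acyclic Serre fibration exactly when it lifts against the boundary inclusions of cubes
(\<open>acyclic_fibration_lifts_cube\<close>, \<open>lifts_cube_imp_Serre_fibration\<close>, \<open>lifts_cube_imp_weak_homotopy_equivalence\<close>), and a lifting problem of a
cube \<open>Q\<close> against \<open>\<Theta>\<close> is solved in two steps: lift the middle coordinate over \<open>Q\<close>, and then extend the paths
over \<open>{t > 0} \<times> I\<close> relative to the boundary. For the second step one has to lift over an open subset of
a cube, which is done by induction over the dyadic cells contained in that subset
(\<open>lifts_open_subset_cube\<close>).

Two adjustments turn \<open>\<Theta>\<close> into a test map for cofibrations. Its source and target carry the coarsest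
topology that makes the evident coordinates continuous; it need not be compactly generated. Passing
to the compactly generated topology changes neither the maps out of compactly generated spaces nor
the lifting problems of cubes, provided that maps from compact Hausdorff spaces into the coarse space
have closed coincidence sets (\<open>separated_by_weak_Hausdorff\<close>). And the test spaces have to be
carried by the prescribed type, into which the points \<open>(t, x, \<gamma>)\<close> are embedded
(\<open>ex_inj_into_test_universe\<close>).
\<close>

section \<open>Lifting problems for pairs of subspaces\<close>

definition lifts ::
  "'k::topological_space set \<Rightarrow> 'k set \<Rightarrow> 'e topology \<Rightarrow> 'b topology \<Rightarrow> ('e \<Rightarrow> 'b) \<Rightarrow> bool" where
  "lifts K S E B p \<longleftrightarrow>
     (\<forall>u v. continuous_map (top_of_set S) E u \<and> continuous_map (top_of_set K) B v \<and>
            (\<forall>x\<in>S. p (u x) = v x)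
        \<longrightarrow> (\<exists>l. continuous_map (top_of_set K) E l \<and> (\<forall>x\<in>S. l x = u x) \<and> (\<forall>x\<in>K. p (l x) = v x)))"

lemma liftsD:
  assumes "lifts K S E B p" "continuous_map (top_of_set S) E u" "continuous_map (top_of_set K) B v"
    "\<And>x. x \<in> S \<Longrightarrow> p (u x) = v x"
  obtains l where "continuous_map (top_of_set K) E l" "\<And>x. x \<in> S \<Longrightarrow> l x = u x" "\<And>x. x \<in> K \<Longrightarrow> p (l x) = v x"
  using assms unfolding lifts_def by metis

lemma continuous_map_top_of_set_compose:
  assumes "continuous_map (top_of_set K) E l" "continuous_on K' s" "s ` K' \<subseteq> K"
  shows "continuous_map (top_of_set K') E (\<lambda>x. l (s x))"
proof -
  have "continuous_map (top_of_set K') (top_of_set K) s"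
    using assms by (auto simp: continuous_map_in_subtopology)
  from continuous_map_compose[OF this assms(1)] show ?thesis by (simp add: o_def)
qed

text \<open>
Retracts inherit lifting properties: pull the problem back along the retraction \<open>r\<close>, solve it, and restrict the
solution along \<open>s\<close>.
\<close>

lemma lifts_retract:
  assumes L: "lifts K' S' E B p"
    and s: "continuous_on K s" "s ` K \<subseteq> K'" "s ` S \<subseteq> S'"
    and r: "continuous_on K' r" "r ` K' \<subseteq> K" "r ` S' \<subseteq> S"
    and rs: "\<And>x. x \<in> K \<Longrightarrow> r (s x) = x"
    and sub: "S \<subseteq> K" "S' \<subseteq> K'"
  shows "lifts K S E B p"
  unfolding lifts_def
proof (intro allI impI, elim conjE)
  fix u v assume u: "continuous_map (top_of_set S) E u" and v: "continuous_map (top_of_set K) B v"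
    and uv: "\<forall>x\<in>S. p (u x) = v x"
  have ur: "continuous_map (top_of_set S') E (\<lambda>x. u (r x))"
    by (rule continuous_map_top_of_set_compose[OF u continuous_on_subset[OF r(1) sub(2)] r(3)])
  have vr: "continuous_map (top_of_set K') B (\<lambda>x. v (r x))"
    by (rule continuous_map_top_of_set_compose[OF v r(1,2)])
  have uvr: "p (u (r x)) = v (r x)" if "x \<in> S'" for x using that uv r(3) by auto
  obtain l where l: "continuous_map (top_of_set K') E l" "\<And>x. x \<in> S' \<Longrightarrow> l x = u (r x)"
      "\<And>x. x \<in> K' \<Longrightarrow> p (l x) = v (r x)"
    using liftsD[OF L ur vr uvr] by blast
  have "continuous_map (top_of_set K) E (\<lambda>x. l (s x))"
    by (rule continuous_map_top_of_set_compose[OF l(1) s(1,2)])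
  then show "\<exists>l. continuous_map (top_of_set K) E l \<and> (\<forall>x\<in>S. l x = u x) \<and> (\<forall>x\<in>K. p (l x) = v x)"
  proof (intro exI[of _ "\<lambda>x. l (s x)"] conjI ballI)
    show "l (s x) = u x" if "x \<in> S" for x
    proof -
      have "s x \<in> S'" "r (s x) = x" using that s(3) rs sub(1) by auto
      then show ?thesis using l(2)[of "s x"] by simp
    qed
    show "p (l (s x)) = v x" if "x \<in> K" for x
    proof -
      have "s x \<in> K'" "r (s x) = x" using that s(2) rs by auto
      then show ?thesis using l(3)[of "s x"] by simp
    qed
  qed
qed

lemma continuous_on_funI:
  fixes f :: "'a::topological_space \<Rightarrow> 'i \<Rightarrow> 'b::topological_space"
  assumes "\<And>i. continuous_on S (\<lambda>x. f x i)"
  shows "continuous_on S f"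
  using assms by (rule continuous_on_coordinatewise_then_product)

lemma continuous_on_app:
  fixes f :: "'a::topological_space \<Rightarrow> 'i \<Rightarrow> 'b::topological_space"
  assumes "continuous_on S f"
  shows "continuous_on S (\<lambda>x. f x i)"
  by (rule continuous_on_product_then_coordinatewise[OF assms])

lemma continuous_on_coordinate [continuous_intros]:
  "continuous_on S (\<lambda>x :: 'i \<Rightarrow> 'b::topological_space. x i)"
  by (rule continuous_on_app[OF continuous_on_id])

text \<open>
The cube \<open>[-1, 1]\<^sup>n\<close> as a set of sequences, so that cubes of all dimensions share one type.
\<close>

definition cube :: "nat \<Rightarrow> (nat \<Rightarrow> real) set" where
  "cube n = {x. (\<forall>i<n. \<bar>x i\<bar> \<le> 1) \<and> (\<forall>i\<ge>n. x i = 0)}"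

definition cube_boundary :: "nat \<Rightarrow> (nat \<Rightarrow> real) set" where
  "cube_boundary n = {x \<in> cube n. \<exists>i<n. \<bar>x i\<bar> = 1}"

text \<open>
The intervals of a box may degenerate to points; the box is then a cube whose dimension is the number
of nondegenerate intervals, and only the ends of those contribute to its boundary.
\<close>

lemma lifts_box:
  fixes a b :: "nat \<Rightarrow> real"
  assumes ab: "\<And>i. a i \<le> b i" and fin: "finite {i. a i < b i}"
    and L: "lifts (cube (card {i. a i < b i})) (cube_boundary (card {i. a i < b i})) E B p"
  shows "lifts {x. \<forall>i. a i \<le> x i \<and> x i \<le> b i}
           {x. (\<forall>i. a i \<le> x i \<and> x i \<le> b i) \<and> (\<exists>i. a i < b i \<and> (x i = a i \<or> x i = b i))} E B p"
proof -
  define D where "D = {i. a i < b i}"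
  define d where "d = card D"
  obtain e where e: "bij_betw e {..<d} D"
    using fin unfolding D_def[symmetric] d_def
    by (metis atLeast0LessThan ex_bij_betw_nat_finite)
  \<comment> \<open>\<open>e\<close> enumerates the nondegenerate directions; \<open>s\<close> rescales them to \<open>[-1, 1]\<close>, and \<open>r\<close> is its inverse.\<close>
  define e' where "e' = the_inv_into {..<d} e"
  have eD: "e j \<in> D" if "j < d" for j using e that by (auto simp: bij_betw_def)
  have e'e: "e' (e j) = j" if "j < d" for j
    using e that unfolding e'_def by (simp add: bij_betw_def the_inv_into_f_f)
  have ee': "e (e' i) = i" and e'd: "e' i < d" if "i \<in> D" for i
    using e that the_inv_into_into[of e "{..<d}" i "{..<d}"] unfolding e'_def
    by (auto simp: bij_betw_def f_the_inv_into_f)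
  define s where "s = (\<lambda>x j. if j < d then 2 * ((x (e j) - a (e j)) / (b (e j) - a (e j))) - 1 else 0)"
  define r where "r = (\<lambda>y i. if i \<in> D then a i + (b i - a i) * ((y (e' i) + 1) / 2) else a i)"
  have Dp: "b i - a i > 0" if "i \<in> D" for i using that by (auto simp: D_def)
  have nD: "b i = a i" if "i \<notin> D" for i using that ab[of i] by (auto simp: D_def)
  have s1: "\<bar>s x j\<bar> \<le> 1" if "\<forall>i. a i \<le> x i \<and> x i \<le> b i" "j < d" for x j
  proof -
    have p: "b (e j) - a (e j) > 0" using Dp eD that by auto
    define q where "q = (x (e j) - a (e j)) / (b (e j) - a (e j))"
    have "0 \<le> q" "q \<le> 1" using p that by (auto simp: q_def)
    moreover have "s x j = 2 * q - 1" using that unfolding s_def q_def by simp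
    ultimately show ?thesis by (simp add: abs_le_iff)
  qed
  have s2: "\<bar>s x (e' i)\<bar> = 1" if "i \<in> D" "x i = a i \<or> x i = b i" for x i
  proof -
    define q where "q = (x i - a i) / (b i - a i)"
    have "q = 0 \<or> q = 1" using Dp[OF that(1)] that(2) by (auto simp: q_def)
    moreover have "s x (e' i) = 2 * q - 1"
      unfolding s_def q_def using e'd[OF that(1)] ee'[OF that(1)] by simp
    ultimately show ?thesis by auto
  qed
  have r1: "a i \<le> r y i \<and> r y i \<le> b i" if "y \<in> cube d" for y i
  proof (cases "i \<in> D")
    case True
    have y: "\<bar>y (e' i)\<bar> \<le> 1" using that e'd[OF True] by (auto simp: cube_def)
    have "0 \<le> (b i - a i) * (y (e' i) + 1)" using Dp[OF True] y by (intro mult_nonneg_nonneg) (auto simp: abs_le_iff)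
    moreover have "(b i - a i) * (y (e' i) + 1) \<le> (b i - a i) * 2"
      using Dp[OF True] y by (intro mult_left_mono) (auto simp: abs_le_iff)
    ultimately show ?thesis using True by (simp add: r_def)
  next
    case False then show ?thesis using nD by (auto simp: r_def)
  qed
  have r2: "r y (e j) = a (e j) \<or> r y (e j) = b (e j)" if "\<bar>y j\<bar> = 1" "j < d" for y j
  proof -
    have "y j = 1 \<or> y j = -1" using that by linarith
    moreover have "r y (e j) = a (e j) + (b (e j) - a (e j)) * ((y j + 1) / 2)"
      unfolding r_def using that eD[of j] e'e[of j] by simp
    ultimately show ?thesis by (auto simp: field_simps)
  qed
  have rs: "r (s x) = x" if "\<forall>i. a i \<le> x i \<and> x i \<le> b i" for x
  proof
    fix i show "r (s x) i = x i"
    proof (cases "i \<in> D")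
      case True
      define q where "q = (x i - a i) / (b i - a i)"
      have "s x (e' i) = 2 * q - 1" unfolding s_def q_def using e'd[OF True] ee'[OF True] by simp
      then have "r (s x) i = a i + (b i - a i) * q" using True by (simp add: r_def)
      also have "(b i - a i) * q = x i - a i" using Dp[OF True] by (simp add: q_def)
      finally show ?thesis by simp
    next
      case False then show ?thesis using nD[OF False] that by (metis nle_le r_def)
    qed
  qed
  have cs: "continuous_on X s" for X
  proof (unfold s_def, rule continuous_on_funI)
    show "continuous_on X (\<lambda>x. if j < d then 2 * ((x (e j) - a (e j)) / (b (e j) - a (e j))) - 1 else 0)" for j
    proof (cases "j < d")
      case True
      have "b (e j) - a (e j) \<noteq> 0" using Dp[OF eD[OF True]] by simp
      then have "continuous_on X (\<lambda>x. 2 * ((x (e j) - a (e j)) / (b (e j) - a (e j))) - 1)"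
        by (intro continuous_intros) auto
      then show ?thesis unfolding if_P[OF True] .
    qed simp
  qed
  have cr: "continuous_on X r" for X
  proof (unfold r_def, rule continuous_on_funI)
    show "continuous_on X (\<lambda>y. if i \<in> D then a i + (b i - a i) * ((y (e' i) + 1) / 2) else a i)" for i
    proof (cases "i \<in> D")
      case True
      have "continuous_on X (\<lambda>y. a i + (b i - a i) * ((y (e' i) + 1) / 2))"
        by (intro continuous_intros) auto
      then show ?thesis unfolding if_P[OF True] .
    qed simp
  qed
  show ?thesis
  proof (rule lifts_retract[where K'="cube d" and S'="cube_boundary d" and s=s and r=r, OF _ cs _ _ cr])
    show "lifts (cube d) (cube_boundary d) E B p" using L by (simp add: d_def D_def)
    show "s ` {x. \<forall>i. a i \<le> x i \<and> x i \<le> b i} \<subseteq> cube d"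
      using s1 by (auto simp: cube_def) (simp add: s_def)
    then show "s ` {x. (\<forall>i. a i \<le> x i \<and> x i \<le> b i) \<and> (\<exists>i. a i < b i \<and> (x i = a i \<or> x i = b i))} \<subseteq> cube_boundary d"
      using s2 e'd unfolding cube_boundary_def D_def by blast
    show "r ` cube d \<subseteq> {x. \<forall>i. a i \<le> x i \<and> x i \<le> b i}" using r1 by auto
    then show "r ` cube_boundary d \<subseteq> {x. (\<forall>i. a i \<le> x i \<and> x i \<le> b i) \<and> (\<exists>i. a i < b i \<and> (x i = a i \<or> x i = b i))}"
      using r2 eD unfolding cube_boundary_def D_def by blast
    show "cube_boundary d \<subseteq> cube d" by (auto simp: cube_boundary_def)
    show "r (s x) = x" if "x \<in> {x. \<forall>i. a i \<le> x i \<and> x i \<le> b i}" for x using rs that by blast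
  qed blast
qed

section \<open>Lifting over open subsets of a cube\<close>

lemma continuous_map_glue_closed:
  assumes "closedin X S" "closedin X T" "topspace X \<subseteq> S \<union> T"
    and "continuous_map (subtopology X S) Y f" "continuous_map (subtopology X T) Y g"
    and "\<And>x. x \<in> S \<Longrightarrow> x \<in> T \<Longrightarrow> f x = g x"
  shows "continuous_map X Y (\<lambda>x. if x \<in> S then f x else g x)"
proof (rule pasting_lemma_closed[where I="{True,False}" and T="\<lambda>b. if b then S else T" and f="\<lambda>b. if b then f else g"])
  show "\<exists>j. j \<in> {True, False} \<and> x \<in> (if j then S else T) \<and> (if x \<in> S then f x else g x) = (if j then f else g) x"
    if "x \<in> topspace X" for x
    using assms(3) that by (cases "x \<in> S") (auto intro: exI[of _ True] exI[of _ False])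
qed (use assms in \<open>auto split: if_splits\<close>)

lemma continuous_map_glue_open:
  assumes "openin X S" "openin X T" "topspace X \<subseteq> S \<union> T"
    and "continuous_map (subtopology X S) Y f" "continuous_map (subtopology X T) Y g"
    and "\<And>x. x \<in> S \<Longrightarrow> x \<in> T \<Longrightarrow> f x = g x"
  shows "continuous_map X Y (\<lambda>x. if x \<in> S then f x else g x)"
proof (rule pasting_lemma[where I="{True,False}" and T="\<lambda>b. if b then S else T" and f="\<lambda>b. if b then f else g"])
  show "\<exists>j. j \<in> {True, False} \<and> x \<in> (if j then S else T) \<and> (if x \<in> S then f x else g x) = (if j then f else g) x"
    if "x \<in> topspace X" for x
    using assms(3) that by (cases "x \<in> S") (auto intro: exI[of _ True] exI[of _ False])
qed (use assms in \<open>auto split: if_splits\<close>)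

text \<open>
The dyadic subdivision of mesh \<open>2\<^sup>-\<^sup>k\<close>: in each coordinate a point of \<open>\<real>\<close> scaled by \<open>2\<^sup>k\<close> is either an
integer or lies in an open unit interval, and floor and ceiling say which. Thus \<open>cell_index k x\<close> names
the open cell of \<open>x\<close>, \<open>closed_cell k x\<close> is its closure, and \<open>cell_dim k x\<close> its dimension.
\<close>

definition closed_cell :: "nat \<Rightarrow> (nat \<Rightarrow> real) \<Rightarrow> (nat \<Rightarrow> real) set" where
  "closed_cell k x = {y. \<forall>i. \<lfloor>2 ^ k * x i\<rfloor> \<le> 2 ^ k * y i \<and> 2 ^ k * y i \<le> \<lceil>2 ^ k * x i\<rceil>}"

definition cell_index :: "nat \<Rightarrow> (nat \<Rightarrow> real) \<Rightarrow> nat \<Rightarrow> int \<times> int" where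
  "cell_index k x = (\<lambda>i. (\<lfloor>2 ^ k * x i\<rfloor>, \<lceil>2 ^ k * x i\<rceil>))"

definition cell_dim :: "nat \<Rightarrow> (nat \<Rightarrow> real) \<Rightarrow> nat" where
  "cell_dim k x = card {i. \<lfloor>2 ^ k * x i\<rfloor> < \<lceil>2 ^ k * x i\<rceil>}"

lemma cell_index_eq_iff:
  "cell_index k x = cell_index k y \<longleftrightarrow>
     (\<forall>i. \<lfloor>2 ^ k * x i\<rfloor> = \<lfloor>2 ^ k * y i\<rfloor> \<and> \<lceil>2 ^ k * x i\<rceil> = \<lceil>2 ^ k * y i\<rceil>)"
  by (auto simp: cell_index_def fun_eq_iff)

lemma mem_closed_cell_self: "x \<in> closed_cell k x"
  by (auto simp: closed_cell_def)

lemma closed_cell_cong: "cell_index k x = cell_index k y \<Longrightarrow> closed_cell k x = closed_cell k y"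
  by (simp add: cell_index_eq_iff closed_cell_def)

lemma closed_closed_cell: "closed (closed_cell k x)"
proof -
  have "closed_cell k x = (\<Inter>i. {y. \<lfloor>2 ^ k * x i\<rfloor> \<le> 2 ^ k * y i} \<inter> {y. 2 ^ k * y i \<le> \<lceil>2 ^ k * x i\<rceil>})"
    by (auto simp: closed_cell_def)
  moreover have "closed ({y :: nat \<Rightarrow> real. \<lfloor>2 ^ k * x i\<rfloor> \<le> 2 ^ k * y i} \<inter> {y :: nat \<Rightarrow> real. 2 ^ k * y i \<le> \<lceil>2 ^ k * x i\<rceil>})" for i
    by (intro closed_Int closed_Collect_le continuous_intros continuous_on_id)
  ultimately show ?thesis by auto
qed

lemma closed_cell_trans: "y \<in> closed_cell k x \<Longrightarrow> closed_cell k y \<subseteq> closed_cell k x"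
proof
  fix z assume y: "y \<in> closed_cell k x" and z: "z \<in> closed_cell k y"
  show "z \<in> closed_cell k x"
    unfolding closed_cell_def
  proof (intro CollectI allI)
    fix i
    have "\<lfloor>2 ^ k * x i\<rfloor> \<le> 2 ^ k * y i" "2 ^ k * y i \<le> \<lceil>2 ^ k * x i\<rceil>"
      using y by (auto simp: closed_cell_def)
    then have "\<lfloor>2 ^ k * x i\<rfloor> \<le> \<lfloor>2 ^ k * y i\<rfloor>" "\<lceil>2 ^ k * y i\<rceil> \<le> \<lceil>2 ^ k * x i\<rceil>"
      by (simp_all add: le_floor_iff ceiling_le_iff)
    moreover have "\<lfloor>2 ^ k * y i\<rfloor> \<le> 2 ^ k * z i" "2 ^ k * z i \<le> \<lceil>2 ^ k * y i\<rceil>"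
      using z by (auto simp: closed_cell_def)
    ultimately show "\<lfloor>2 ^ k * x i\<rfloor> \<le> 2 ^ k * z i \<and> 2 ^ k * z i \<le> \<lceil>2 ^ k * x i\<rceil>"
      by linarith
  qed
qed

text \<open>
One coordinate of the statement that the boundary of a cell consists of cells of smaller dimension:
a point of the closed interval leaves the open one exactly at an end point, where it spans a
degenerate interval.
\<close>

lemma in_face_real:
  fixes z w :: real
  assumes "\<lfloor>z\<rfloor> \<le> w" "w \<le> \<lceil>z\<rceil>"
  shows "(\<lfloor>w\<rfloor> \<noteq> \<lfloor>z\<rfloor> \<or> \<lceil>w\<rceil> \<noteq> \<lceil>z\<rceil>) \<longleftrightarrow> \<lfloor>z\<rfloor> < \<lceil>z\<rceil> \<and> (w = \<lfloor>z\<rfloor> \<or> w = \<lceil>z\<rceil>)"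
    and "\<lfloor>w\<rfloor> \<noteq> \<lfloor>z\<rfloor> \<or> \<lceil>w\<rceil> \<noteq> \<lceil>z\<rceil> \<Longrightarrow> \<lfloor>w\<rfloor> = \<lceil>w\<rceil>"
    and "\<lfloor>w\<rfloor> < \<lceil>w\<rceil> \<Longrightarrow> \<lfloor>z\<rfloor> < \<lceil>z\<rceil>"
proof -
  show 1: "(\<lfloor>w\<rfloor> \<noteq> \<lfloor>z\<rfloor> \<or> \<lceil>w\<rceil> \<noteq> \<lceil>z\<rceil>) \<longleftrightarrow> \<lfloor>z\<rfloor> < \<lceil>z\<rceil> \<and> (w = \<lfloor>z\<rfloor> \<or> w = \<lceil>z\<rceil>)"
  proof (cases "\<lfloor>z\<rfloor> < \<lceil>z\<rceil>")
    case False
    then have "\<lceil>z\<rceil> = \<lfloor>z\<rfloor>" by linarith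
    then have "w = of_int \<lfloor>z\<rfloor>" using assms by simp
    then show ?thesis using \<open>\<lceil>z\<rceil> = \<lfloor>z\<rfloor>\<close> by simp
  next
    case True
    then have c: "\<lceil>z\<rceil> = \<lfloor>z\<rfloor> + 1" by linarith
    consider "w = of_int \<lfloor>z\<rfloor>" | "w = of_int (\<lfloor>z\<rfloor> + 1)" | "of_int \<lfloor>z\<rfloor> < w" "w < of_int (\<lfloor>z\<rfloor> + 1)"
      using assms unfolding c by linarith
    then show ?thesis
    proof cases
      case 1 then show ?thesis using c by simp
    next
      case 2 then show ?thesis using c by simp
    next
      case 3
      then have "\<lfloor>w\<rfloor> = \<lfloor>z\<rfloor>" "\<lceil>w\<rceil> = \<lfloor>z\<rfloor> + 1" by (auto simp: floor_eq_iff ceiling_eq_iff)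
      with 3 c show ?thesis by auto
    qed
  qed
  show 2: "\<lfloor>w\<rfloor> = \<lceil>w\<rceil>" if "\<lfloor>w\<rfloor> \<noteq> \<lfloor>z\<rfloor> \<or> \<lceil>w\<rceil> \<noteq> \<lceil>z\<rceil>"
    using that unfolding 1 by auto
  show "\<lfloor>z\<rfloor> < \<lceil>z\<rceil>" if "\<lfloor>w\<rfloor> < \<lceil>w\<rceil>"
    using 2 that by fastforce
qed

lemma abs_scaled_bounds:
  fixes x :: real
  assumes "\<bar>x\<bar> \<le> 1"
  shows "\<lceil>2 ^ k * x\<rceil> \<le> 2 ^ k" "- (2 ^ k) \<le> \<lfloor>2 ^ k * x\<rfloor>"
proof -
  have "\<bar>2 ^ k * x\<bar> \<le> 2 ^ k" using assms by (simp add: abs_mult mult_left_le)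
  then show "\<lceil>2 ^ k * x\<rceil> \<le> 2 ^ k" "- (2 ^ k) \<le> \<lfloor>2 ^ k * x\<rfloor>"
    by (simp_all add: ceiling_le_iff le_floor_iff abs_le_iff)
qed

lemma boundary_closed_cell:
  assumes "y \<in> closed_cell k x"
  shows "cell_index k y \<noteq> cell_index k x \<longleftrightarrow>
    (\<exists>i. \<lfloor>2 ^ k * x i\<rfloor> < \<lceil>2 ^ k * x i\<rceil> \<and> (2 ^ k * y i = \<lfloor>2 ^ k * x i\<rfloor> \<or> 2 ^ k * y i = \<lceil>2 ^ k * x i\<rceil>))"
proof -
  have "(\<lfloor>2 ^ k * y i\<rfloor> \<noteq> \<lfloor>2 ^ k * x i\<rfloor> \<or> \<lceil>2 ^ k * y i\<rceil> \<noteq> \<lceil>2 ^ k * x i\<rceil>) \<longleftrightarrow>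
    \<lfloor>2 ^ k * x i\<rfloor> < \<lceil>2 ^ k * x i\<rceil> \<and> (2 ^ k * y i = \<lfloor>2 ^ k * x i\<rfloor> \<or> 2 ^ k * y i = \<lceil>2 ^ k * x i\<rceil>)" for i
    using assms by (intro in_face_real(1)) (auto simp: closed_cell_def)
  then show ?thesis unfolding cell_index_eq_iff by blast
qed

lemma finite_cell_dim:
  assumes "x \<in> cube n"
  shows "finite {i. \<lfloor>2 ^ k * x i\<rfloor> < \<lceil>2 ^ k * x i\<rceil>}"
proof (rule finite_subset)
  show "{i. \<lfloor>2 ^ k * x i\<rfloor> < \<lceil>2 ^ k * x i\<rceil>} \<subseteq> {..<n}"
  proof
    fix i assume "i \<in> {i. \<lfloor>2 ^ k * x i\<rfloor> < \<lceil>2 ^ k * x i\<rceil>}"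
    moreover have "x i = 0" if "\<not> i < n" using assms that by (auto simp: cube_def)
    ultimately show "i \<in> {..<n}" by (cases "i < n") auto
  qed
qed simp

lemma cell_dim_less:
  assumes x: "x \<in> cube n" and y: "y \<in> closed_cell k x" and ne: "cell_index k y \<noteq> cell_index k x"
  shows "cell_dim k y < cell_dim k x"
proof -
  have b: "\<lfloor>2 ^ k * x i\<rfloor> \<le> 2 ^ k * y i" "2 ^ k * y i \<le> \<lceil>2 ^ k * x i\<rceil>" for i
    using y by (auto simp: closed_cell_def)
  have sub: "{i. \<lfloor>2 ^ k * y i\<rfloor> < \<lceil>2 ^ k * y i\<rceil>} \<subseteq> {i. \<lfloor>2 ^ k * x i\<rfloor> < \<lceil>2 ^ k * x i\<rceil>}"
    using in_face_real(3)[OF b] by blast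
  obtain i where i: "\<lfloor>2 ^ k * y i\<rfloor> \<noteq> \<lfloor>2 ^ k * x i\<rfloor> \<or> \<lceil>2 ^ k * y i\<rceil> \<noteq> \<lceil>2 ^ k * x i\<rceil>"
    using ne unfolding cell_index_eq_iff by blast
  then have "i \<in> {i. \<lfloor>2 ^ k * x i\<rfloor> < \<lceil>2 ^ k * x i\<rceil>}" "i \<notin> {i. \<lfloor>2 ^ k * y i\<rfloor> < \<lceil>2 ^ k * y i\<rceil>}"
    using in_face_real(1,2)[OF b, of i] by auto
  with sub have "{i. \<lfloor>2 ^ k * y i\<rfloor> < \<lceil>2 ^ k * y i\<rceil>} \<subset> {i. \<lfloor>2 ^ k * x i\<rfloor> < \<lceil>2 ^ k * x i\<rceil>}" by blast
  then show ?thesis unfolding cell_dim_def by (rule psubset_card_mono[OF finite_cell_dim[OF x]])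
qed

text \<open>
A closed cell is a box, and its boundary is the union of the other open cells that it meets.
\<close>

lemma lifts_closed_cell:
  assumes L: "\<And>d. lifts (cube d) (cube_boundary d) E B p" and x: "x \<in> cube n"
  shows "lifts (closed_cell k x) {y \<in> closed_cell k x. cell_index k y \<noteq> cell_index k x} E B p"
proof -
  define a b where "a = (\<lambda>i. \<lfloor>2 ^ k * x i\<rfloor> / 2 ^ k)" and "b = (\<lambda>i. \<lceil>2 ^ k * x i\<rceil> / 2 ^ k)"
  have ab: "a i \<le> b i" for i
    unfolding a_def b_def by (intro divide_right_mono) (simp_all add: floor_le_ceiling)
  have lt: "a i < b i \<longleftrightarrow> \<lfloor>2 ^ k * x i\<rfloor> < \<lceil>2 ^ k * x i\<rceil>" for i
    by (simp add: a_def b_def divide_less_cancel)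
  have c: "closed_cell k x = {y. \<forall>i. a i \<le> y i \<and> y i \<le> b i}"
    by (simp add: closed_cell_def a_def b_def field_simps)
  have eq: "2 ^ k * y i = \<lfloor>2 ^ k * x i\<rfloor> \<longleftrightarrow> y i = a i" "2 ^ k * y i = \<lceil>2 ^ k * x i\<rceil> \<longleftrightarrow> y i = b i" for y :: "nat \<Rightarrow> real" and i
    by (auto simp: a_def b_def field_simps)
  have "y \<in> closed_cell k x \<and> cell_index k y \<noteq> cell_index k x \<longleftrightarrow>
      (\<forall>i. a i \<le> y i \<and> y i \<le> b i) \<and> (\<exists>i. a i < b i \<and> (y i = a i \<or> y i = b i))" for y :: "nat \<Rightarrow> real"
    using boundary_closed_cell[of y k x] unfolding lt eq c mem_Collect_eq by blast
  then have d: "{y \<in> closed_cell k x. cell_index k y \<noteq> cell_index k x} =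
      {y. (\<forall>i. a i \<le> y i \<and> y i \<le> b i) \<and> (\<exists>i. a i < b i \<and> (y i = a i \<or> y i = b i))}"
    by (rule Collect_cong)
  have "finite {i. a i < b i}" unfolding lt by (rule finite_cell_dim[OF x])
  from lifts_box[OF ab this L] show ?thesis unfolding d unfolding c .
qed

lemma closed_cell_subset_cube:
  assumes "x \<in> cube n"
  shows "closed_cell k x \<subseteq> cube n"
proof
  fix y assume "y \<in> closed_cell k x"
  then have y: "\<lfloor>2 ^ k * x i\<rfloor> \<le> 2 ^ k * y i" "2 ^ k * y i \<le> \<lceil>2 ^ k * x i\<rceil>" for i
    by (auto simp: closed_cell_def)
  have "\<bar>y i\<bar> \<le> 1" if "i < n" for i
  proof -
    have "\<bar>x i\<bar> \<le> 1" using assms that by (auto simp: cube_def)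
    from abs_scaled_bounds[OF this, of k]
    have "real_of_int \<lceil>2 ^ k * x i\<rceil> \<le> of_int (2 ^ k)" "of_int (- (2 ^ k)) \<le> real_of_int \<lfloor>2 ^ k * x i\<rfloor>"
      by (simp_all only: of_int_le_iff)
    then have "\<bar>2 ^ k * y i\<bar> \<le> 2 ^ k"
      using y[of i] unfolding of_int_power of_int_numeral of_int_minus by linarith
    then have "2 ^ k * \<bar>y i\<bar> \<le> 2 ^ k * 1" by (simp add: abs_mult)
    then show ?thesis by (simp only: mult_le_cancel_left_pos zero_less_power zero_less_numeral)
  qed
  moreover have "y i = 0" if "i \<ge> n" for i
  proof -
    have "x i = 0" using assms that by (auto simp: cube_def)
    then have "2 ^ k * y i = 0" using y[of i] by simp
    then show ?thesis by simp
  qed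
  ultimately show "y \<in> cube n" by (auto simp: cube_def)
qed

lemma finite_cell_index_cube: "finite (cell_index k ` cube n)"
proof (rule finite_subset)
  let ?B = "{- (2 ^ k)..2 ^ k} \<times> {- (2 ^ k)..2 ^ k} :: (int \<times> int) set"
  show "cell_index k ` cube n \<subseteq> {f. \<forall>i. (i \<in> {..<n} \<longrightarrow> f i \<in> ?B) \<and> (i \<notin> {..<n} \<longrightarrow> f i = (0, 0))}"
  proof clarify
    fix x i assume x: "x \<in> cube n"
    have "cell_index k x i \<in> ?B" if "i < n"
    proof -
      have x1: "\<bar>x i\<bar> \<le> 1" using x that by (auto simp: cube_def)
      have "\<lfloor>2 ^ k * x i\<rfloor> \<le> \<lceil>2 ^ k * x i\<rceil>" by linarith
      with abs_scaled_bounds[OF x1, of k]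
      have "\<lfloor>2 ^ k * x i\<rfloor> \<in> {- (2 ^ k)..2 ^ k}" "\<lceil>2 ^ k * x i\<rceil> \<in> {- (2 ^ k)..2 ^ k}"
        unfolding atLeastAtMost_iff by linarith+
      then show ?thesis unfolding cell_index_def by blast
    qed
    moreover have "cell_index k x i = (0, 0)" if "\<not> i < n"
      using x that by (simp add: cell_index_def cube_def)
    ultimately show "(i \<in> {..<n} \<longrightarrow> cell_index k x i \<in> ?B) \<and> (i \<notin> {..<n} \<longrightarrow> cell_index k x i = (0, 0))" by simp
  qed
  show "finite {f. \<forall>i. (i \<in> {..<n} \<longrightarrow> f i \<in> ?B) \<and> (i \<notin> {..<n} \<longrightarrow> f i = (0, 0))}"
    by (rule finite_set_of_finite_funs) auto
qed

text \<open>
Passing from scale \<open>2 z\<close> to \<open>z\<close>: the cells of the finer subdivision refine those of the coarser one.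
\<close>

lemma floor_half_unique:
  fixes z w :: real
  shows "\<lfloor>2 * z\<rfloor> = \<lfloor>2 * w\<rfloor> \<Longrightarrow> \<lfloor>z\<rfloor> = \<lfloor>w\<rfloor>" "\<lceil>2 * z\<rceil> = \<lceil>2 * w\<rceil> \<Longrightarrow> \<lceil>z\<rceil> = \<lceil>w\<rceil>"
    and "\<lfloor>2 * z\<rfloor> \<le> 2 * w \<Longrightarrow> \<lfloor>z\<rfloor> \<le> w" "2 * w \<le> \<lceil>2 * z\<rceil> \<Longrightarrow> w \<le> \<lceil>z\<rceil>"
proof -
  have f: "\<lfloor>a\<rfloor> = \<lfloor>2 * a\<rfloor> div 2" for a :: real
    using floor_divide_real_eq_div[of 2 "2 * a"] by simp
  have c: "\<lceil>a\<rceil> = - (- \<lceil>2 * a\<rceil> div 2)" for a :: real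
    using f[of "- a"] by (simp add: ceiling_def)
  have fl: "2 * \<lfloor>a\<rfloor> \<le> \<lfloor>2 * a\<rfloor>" for a :: real unfolding f[of a] by simp
  have ce: "\<lceil>2 * a\<rceil> \<le> 2 * \<lceil>a\<rceil>" for a :: real unfolding c[of a] by simp
  show "\<lfloor>z\<rfloor> = \<lfloor>w\<rfloor>" if "\<lfloor>2 * z\<rfloor> = \<lfloor>2 * w\<rfloor>" using that f[of z] f[of w] by simp
  show "\<lceil>z\<rceil> = \<lceil>w\<rceil>" if "\<lceil>2 * z\<rceil> = \<lceil>2 * w\<rceil>" using that c[of z] c[of w] by simp
  show "\<lfloor>z\<rfloor> \<le> w" if "\<lfloor>2 * z\<rfloor> \<le> 2 * w" using that fl[of z] by linarith
  show "w \<le> \<lceil>z\<rceil>" if "2 * w \<le> \<lceil>2 * z\<rceil>" using that ce[of z] by linarith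
qed

lemma cell_index_Suc:
  assumes "cell_index (Suc k) x = cell_index (Suc k) y"
  shows "cell_index k x = cell_index k y"
  using assms floor_half_unique(1,2) unfolding cell_index_eq_iff power_Suc mult.assoc by blast

lemma closed_cell_Suc: "closed_cell (Suc k) x \<subseteq> closed_cell k x"
  using floor_half_unique(3,4) unfolding closed_cell_def power_Suc mult.assoc by blast

lemma closed_cell_mesh:
  assumes "y \<in> closed_cell k x"
  shows "\<bar>y i - x i\<bar> \<le> 1 / 2 ^ k"
proof -
  have "\<lfloor>2 ^ k * x i\<rfloor> \<le> 2 ^ k * y i" "2 ^ k * y i \<le> \<lceil>2 ^ k * x i\<rceil>"
    using assms by (auto simp: closed_cell_def)
  then have "\<bar>2 ^ k * y i - 2 ^ k * x i\<bar> \<le> 1" by linarith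
  then have "\<bar>2 ^ k * (y i - x i)\<bar> \<le> 1" by (simp add: right_diff_distrib)
  then have "2 ^ k * \<bar>y i - x i\<bar> \<le> 1" by (simp add: abs_mult)
  then show ?thesis by (simp add: field_simps)
qed

text \<open>
A lift on the closed set \<open>C\<close> is extended over the cells of \<open>R\<close> one at a time. When a cell of minimal
dimension outside \<open>C\<close> is chosen, its boundary lies in \<open>C\<close>, so the next extension problem is that of a
cube. The induction is on the number of open cells that are missing.
\<close>

lemma extend_lift_over_cells:
  fixes C Q R :: "(nat \<Rightarrow> real) set"
  assumes L: "\<And>d. lifts (cube d) (cube_boundary d) E B p"
    and R: "R \<subseteq> cube n" "\<And>x. x \<in> R \<Longrightarrow> closed_cell k x \<subseteq> R" "R \<subseteq> Q"
    and v: "continuous_map (top_of_set Q) B v"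
    and C: "C \<subseteq> Q" "closedin (top_of_set Q) C"
      "\<And>x y. x \<in> C \<Longrightarrow> y \<in> R \<Longrightarrow> cell_index k x = cell_index k y \<Longrightarrow> y \<in> C"
    and u: "continuous_map (top_of_set C) E u" "\<And>x. x \<in> C \<Longrightarrow> p (u x) = v x"
  shows "\<exists>l. continuous_map (top_of_set (C \<union> R)) E l \<and> (\<forall>x\<in>C. l x = u x) \<and> (\<forall>x\<in>C \<union> R. p (l x) = v x)"
  using C u
proof (induction "card (cell_index k ` (R - C))" arbitrary: C u rule: less_induct)
  case less
  note C = less.prems(1-3) and u = less.prems(4,5)
  show ?case
  proof (cases "R \<subseteq> C")
    case True
    then have "C \<union> R = C" by blast
    then show ?thesis using u by auto
  next
    case False
    then obtain x where x: "x \<in> R - C" and xmin: "\<And>y. y \<in> R - C \<Longrightarrow> cell_dim k x \<le> cell_dim k y"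
      using ex_has_least_nat[of "\<lambda>x. x \<in> R - C" _ "cell_dim k"] by blast
    \<comment> \<open>By minimality of the dimension, the part of the new cell that lies in \<open>C\<close> is its boundary.\<close>
    define f where "f = closed_cell k x"
    define C' where "C' = C \<union> f"
    have xc: "x \<in> cube n" and fR: "f \<subseteq> R" using x R unfolding f_def by auto
    have fC: "y \<in> C \<longleftrightarrow> cell_index k y \<noteq> cell_index k x" if "y \<in> f" for y
    proof
      show "cell_index k y \<noteq> cell_index k x" if "y \<in> C"
        using C(3)[OF that] x by blast
      show "y \<in> C" if "cell_index k y \<noteq> cell_index k x"
        using cell_dim_less[OF xc _ that] xmin[of y] \<open>y \<in> f\<close> fR unfolding f_def
        by (meson DiffI leD subsetD)
    qed
    have bd: "{y \<in> closed_cell k x. cell_index k y \<noteq> cell_index k x} = f \<inter> C"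
      using fC unfolding f_def by auto
    have fL: "lifts f (f \<inter> C) E B p" using lifts_closed_cell[OF L xc, of k] unfolding bd f_def .
    have uf: "continuous_map (top_of_set (f \<inter> C)) E u"
      using u(1) by (rule continuous_map_from_subtopology_mono) blast
    have vf: "continuous_map (top_of_set f) B v"
      using v by (rule continuous_map_from_subtopology_mono) (use fR R in blast)
    obtain m where m: "continuous_map (top_of_set f) E m" "\<And>y. y \<in> f \<inter> C \<Longrightarrow> m y = u y"
        "\<And>y. y \<in> f \<Longrightarrow> p (m y) = v y"
      using liftsD[OF fL uf vf] u(2) by blast
    define u' where "u' = (\<lambda>y. if y \<in> C then u y else m y)"
    have C'Q: "C' \<subseteq> Q" using C fR R by (auto simp: C'_def)
    have fcl: "closedin (top_of_set Q) f"
      using closed_closed_cell[of k x] fR R(3) unfolding f_def by (simp add: closed_subset)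
    have C'cl: "closedin (top_of_set Q) C'" using C(2) fcl by (simp add: C'_def closedin_Un)
    have C'sat: "y \<in> C'" if "z \<in> C'" "y \<in> R" "cell_index k z = cell_index k y" for z y
    proof (cases "z \<in> C")
      case True then show ?thesis using C(3)[of z y] that by (auto simp: C'_def)
    next
      case False
      then have "z \<in> closed_cell k x" using that by (auto simp: C'_def f_def)
      then have "closed_cell k z \<subseteq> f" using closed_cell_trans f_def by blast
      moreover have "y \<in> closed_cell k z" using closed_cell_cong[OF that(3)] mem_closed_cell_self by blast
      ultimately show ?thesis by (auto simp: C'_def)
    qed
    have u'c: "continuous_map (top_of_set C') E u'"
      unfolding u'_def
    proof (rule continuous_map_glue_closed)
      show "closedin (top_of_set C') C" "closedin (top_of_set C') f"
        using closedin_subset_topspace[of "top_of_set Q"] C(2) fcl C'Q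
        by (auto simp: C'_def intro: closedin_subset_trans)
      show "continuous_map (subtopology (top_of_set C') C) E u" "continuous_map (subtopology (top_of_set C') f) E m"
        using u(1) m(1) by (simp_all add: subtopology_subtopology C'_def Int_absorb1)
    qed (use m in \<open>auto simp: C'_def\<close>)
    have u'v: "p (u' y) = v y" if "y \<in> C'" for y
      using that u m by (auto simp: u'_def C'_def)
    have less: "card (cell_index k ` (R - C')) < card (cell_index k ` (R - C))"
    proof (rule psubset_card_mono)
      show "finite (cell_index k ` (R - C))"
        using finite_cell_index_cube[of k n] by (rule finite_subset[rotated]) (use R in blast)
      have "cell_index k x \<notin> cell_index k ` (R - C')"
      proof
        assume "cell_index k x \<in> cell_index k ` (R - C')"
        then obtain y where "y \<in> R - C'" "cell_index k x = cell_index k y" by blast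
        moreover have "x \<in> C'" using mem_closed_cell_self by (simp add: C'_def f_def)
        ultimately show False using C'sat by blast
      qed
      then show "cell_index k ` (R - C') \<subset> cell_index k ` (R - C)"
        using x by (auto simp: C'_def)
    qed
    have "\<exists>l. continuous_map (top_of_set (C' \<union> R)) E l \<and> (\<forall>x\<in>C'. l x = u' x) \<and> (\<forall>x\<in>C' \<union> R. p (l x) = v x)"
      by (rule less.hyps[OF less C'Q C'cl _ u'c u'v]) (use C'sat in blast)+
    then obtain l where l: "continuous_map (top_of_set (C' \<union> R)) E l" "\<forall>x\<in>C'. l x = u' x" "\<forall>x\<in>C' \<union> R. p (l x) = v x"
      by blast
    have "C' \<union> R = C \<union> R" using fR by (auto simp: C'_def)
    with l show ?thesis by (intro exI[of _ l]) (auto simp: C'_def u'_def)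
  qed
qed

text \<open>
The union \<open>R k\<close> of the closed cells of mesh \<open>2\<^sup>-\<^sup>k\<close> contained in \<open>Q\<close> is closed, and the interiors of
these sets exhaust \<open>Q\<close>. A lift is constructed successively on the boundary, on \<open>R 0\<close>, on \<open>R 1\<close>, and
so on. The boundary of the cube and the cells of a coarser subdivision are unions of open cells of every finer
one, so that an open cell in \<open>R k\<close> lies in the set where the lift is already defined, or misses it.
\<close>

lemma lifts_open_subset_cube:
  assumes L: "\<And>d. lifts (cube d) (cube_boundary d) E B p"
    and Q: "openin (top_of_set (cube n)) Q"
  shows "lifts Q (Q \<inter> cube_boundary n) E B p"
  unfolding lifts_def
proof (intro allI impI, elim conjE)
  fix u v assume u: "continuous_map (top_of_set (Q \<inter> cube_boundary n)) E u"
    and v: "continuous_map (top_of_set Q) B v" and uv: "\<forall>x\<in>Q \<inter> cube_boundary n. p (u x) = v x"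
  have Qc: "Q \<subseteq> cube n" using openin_imp_subset[OF Q] .
  define R where "R = (\<lambda>k. {x \<in> Q. closed_cell k x \<subseteq> Q})"
  \<comment> \<open>\<open>D k\<close> is the domain of the \<open>k\<close>-th partial lift.\<close>
  define D where "D = (\<lambda>k. (Q \<inter> cube_boundary n) \<union> (case k of 0 \<Rightarrow> {} | Suc j \<Rightarrow> R j))"
  have RQ: "R k \<subseteq> Q" for k by (auto simp: R_def)
  have Rcell: "closed_cell k x \<subseteq> R k" if "x \<in> R k" for k x
    using that closed_cell_trans unfolding R_def by blast
  have Rmono: "R k \<subseteq> R (Suc k)" for k
    using closed_cell_Suc unfolding R_def by blast
  have DQ: "D k \<subseteq> Q" for k using RQ by (auto simp: D_def split: nat.splits)
  have D_Suc: "D (Suc k) = D k \<union> R k" for k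
    using Rmono by (auto simp: D_def split: nat.splits)
  have Rcl: "closedin (top_of_set Q) (R k)" for k
  proof -
    have "R k = (\<Union>x\<in>R k. closed_cell k x)" using Rcell mem_closed_cell_self by blast
    moreover have "finite (closed_cell k ` R k)"
    proof -
      have "finite (cell_index k ` R k)"
        using finite_cell_index_cube[of k n] by (rule finite_subset[rotated]) (use RQ Qc in blast)
      moreover have "closed_cell k ` R k = (\<lambda>c. closed_cell k (SOME x. cell_index k x = c)) ` cell_index k ` R k"
        unfolding image_image
        by (intro image_cong refl closed_cell_cong) (metis (mono_tags, lifting) someI)
      ultimately show ?thesis by simp
    qed
    ultimately have "closed (R k)" using closed_closed_cell closed_Union by (metis (no_types, lifting) imageE)
    then show ?thesis using RQ by (rule closed_subset[rotated])
  qed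
  have bdcl: "closedin (top_of_set Q) (Q \<inter> cube_boundary n)"
  proof -
    have "closed {x :: nat \<Rightarrow> real. \<exists>i<n. \<bar>x i\<bar> = 1}"
    proof -
      have "{x :: nat \<Rightarrow> real. \<exists>i<n. \<bar>x i\<bar> = 1} = (\<Union>i\<in>{..<n}. {x. \<bar>x i\<bar> = 1})" by auto
      moreover have "closed {x :: nat \<Rightarrow> real. \<bar>x i\<bar> = 1}" for i
        by (intro closed_Collect_eq continuous_intros continuous_on_id)
      ultimately show ?thesis by auto
    qed
    moreover have "Q \<inter> cube_boundary n = Q \<inter> {x. \<exists>i<n. \<bar>x i\<bar> = 1}" using Qc by (auto simp: cube_boundary_def)
    ultimately show ?thesis by (simp add: closedin_closed_Int)
  qed
  have Dcl: "closedin (top_of_set Q) (D k)" for k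
    using Rcl bdcl by (auto simp: D_def split: nat.splits)
  have Dsat: "y \<in> D k" if "x \<in> D k" "y \<in> R k" "cell_index k x = cell_index k y" for x y k
  proof (cases "x \<in> cube_boundary n")
    case True
    then obtain i where i: "i < n" "\<bar>x i\<bar> = 1" by (auto simp: cube_boundary_def)
    then have "x i = 1 \<or> x i = -1" by linarith
    then have "\<lfloor>2 ^ k * x i\<rfloor> = \<lceil>2 ^ k * x i\<rceil>" "2 ^ k * x i = \<lfloor>2 ^ k * x i\<rfloor>"
      using floor_of_int[of "2 ^ k", where 'a=real] ceiling_of_int[of "2 ^ k", where 'a=real]
        floor_of_int[of "- (2 ^ k)", where 'a=real] ceiling_of_int[of "- (2 ^ k)", where 'a=real] by auto
    moreover have "\<lfloor>2 ^ k * x i\<rfloor> = \<lfloor>2 ^ k * y i\<rfloor>" "\<lceil>2 ^ k * x i\<rceil> = \<lceil>2 ^ k * y i\<rceil>"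
      using that(3) by (auto simp: cell_index_eq_iff)
    ultimately have "2 ^ k * x i = 2 ^ k * y i" by linarith
    then have "\<bar>y i\<bar> = 1" using i by simp
    then show ?thesis using that RQ Qc i(1) by (auto simp: D_def cube_boundary_def)
  next
    case False
    have "x \<in> D k" by fact
    with False obtain j where j: "k = Suc j" "x \<in> R j" by (cases k) (auto simp: D_def)
    have "closed_cell j x = closed_cell j y" using closed_cell_cong cell_index_Suc that(3) j(1) by blast
    then have "y \<in> R j" using j(2) that(2) RQ unfolding R_def by auto
    then show ?thesis using j by (simp add: D_def)
  qed
  \<comment> \<open>Each point has a neighbourhood in some \<open>R k\<close>: the topology on sequences is the product topology, and
    only the first \<open>n\<close> coordinates vary on the cube.\<close>
  have nbhd: "\<exists>k N. openin (top_of_set Q) N \<and> x \<in> N \<and> N \<subseteq> R k" if x: "x \<in> Q" for x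
  proof -
    obtain W where W: "open W" "Q = cube n \<inter> W" using Q by (auto simp: openin_open)
    have "openin (product_topology (\<lambda>_::nat. euclidean :: real topology) UNIV) W"
      using W(1) by (metis euclidean_product_topology open_openin)
    from product_topology_open_contains_basis[OF this, of x] W(2) x
    obtain U where U0: "x \<in> Pi\<^sub>E UNIV U" "\<And>i. openin euclidean (U i)" "Pi\<^sub>E UNIV U \<subseteq> W"
      by blast
    have U: "x \<in> Pi\<^sub>E UNIV U" "\<And>i. open (U i)" "Pi\<^sub>E UNIV U \<subseteq> W"
      using U0 by (auto intro: open_openin[THEN iffD2])
    have "\<exists>e>0. \<forall>i<n. ball (x i) e \<subseteq> U i"
    proof (induction n)
      case 0 show ?case by (auto intro: exI[of _ 1])
    next
      case (Suc n)
      then obtain e where e: "e > 0" "\<forall>i<n. ball (x i) e \<subseteq> U i" by blast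
      obtain d where "d > 0" "ball (x n) d \<subseteq> U n"
        using U(1,2) open_contains_ball by (metis PiE_UNIV_domain UNIV_I PiE_mem)
      moreover have "ball (x i) (min d e) \<subseteq> ball (x i) d" "ball (x i) (min d e) \<subseteq> ball (x i) e" for i
        by (auto intro: subset_ball)
      ultimately show ?case using e by (intro exI[of _ "min d e"]) (simp add: less_Suc_eq, blast)
    qed
    then obtain e where e: "e > 0" "\<forall>i<n. ball (x i) e \<subseteq> U i" by blast
    have inQ: "y \<in> Q" if "y \<in> cube n" "\<forall>i<n. \<bar>y i - x i\<bar> < e" for y
    proof -
      have "y i \<in> U i" for i
      proof (cases "i < n")
        case True then show ?thesis using e that by (auto simp: dist_real_def abs_minus_commute subset_iff)
      next
        case False
        then have "y i = x i" using that(1) x Qc by (auto simp: cube_def)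
        then show ?thesis using U(1) by (auto simp: PiE_iff)
      qed
      then have "y \<in> W" using U(3) by (auto simp: PiE_iff)
      then show ?thesis using W that by blast
    qed
    obtain k where k: "1 / 2 ^ k < e / 2"
      using real_arch_pow_inv[of "e/2" "1/2"] e(1) by (auto simp: power_divide)
    define N where "N = Q \<inter> (\<Inter>i\<in>{..<n}. {y. \<bar>y i - x i\<bar> < e / 2})"
    have "open {y :: nat \<Rightarrow> real. \<bar>y i - x i\<bar> < e / 2}" for i
      by (intro open_Collect_less continuous_intros continuous_on_id)
    then have "open (\<Inter>i\<in>{..<n}. {y :: nat \<Rightarrow> real. \<bar>y i - x i\<bar> < e / 2})" by (intro open_INT) auto
    then have "openin (top_of_set Q) N" unfolding N_def by blast
    moreover have "x \<in> N" using x e(1) by (auto simp: N_def)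
    moreover have "N \<subseteq> R k"
    proof
      fix y assume y: "y \<in> N"
      have "closed_cell k y \<subseteq> Q"
      proof
        fix z assume z: "z \<in> closed_cell k y"
        have "z \<in> cube n" using closed_cell_subset_cube[of y n k] y z Qc by (auto simp: N_def)
        moreover have "\<bar>z i - x i\<bar> < e" if "i < n" for i
        proof -
          have "\<bar>y i - x i\<bar> < e / 2" using y that by (auto simp: N_def)
          with closed_cell_mesh[OF z, of i] k show ?thesis by linarith
        qed
        ultimately show "z \<in> Q" using inQ by blast
      qed
      then show "y \<in> R k" using y by (auto simp: R_def N_def)
    qed
    ultimately show ?thesis by blast
  qed
  let ?P = "\<lambda>k l. continuous_map (top_of_set (D k)) E l \<and> (\<forall>x\<in>Q \<inter> cube_boundary n. l x = u x) \<and> (\<forall>x\<in>D k. p (l x) = v x)"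
  have "\<exists>l. \<forall>k. ?P k (l k) \<and> (\<forall>x\<in>D k. l (Suc k) x = l k x)"
  proof (rule dependent_nat_choice)
    show "\<exists>l. ?P 0 l" using u uv by (intro exI[of _ u]) (auto simp: D_def)
    fix l k assume l: "?P k l"
    have "\<exists>l'. continuous_map (top_of_set (D k \<union> R k)) E l' \<and> (\<forall>x\<in>D k. l' x = l x) \<and> (\<forall>x\<in>D k \<union> R k. p (l' x) = v x)"
    proof -
      have 1: "R k \<subseteq> cube n" using RQ[of k] Qc by blast
      have 2: "continuous_map (top_of_set (D k)) E l" "\<And>x. x \<in> D k \<Longrightarrow> p (l x) = v x" using l by blast+
      show ?thesis
        using extend_lift_over_cells[OF L 1 Rcell RQ v DQ Dcl _ 2] Dsat by blast
    qed
    then obtain l' where "continuous_map (top_of_set (D (Suc k))) E l'" "\<forall>x\<in>D k. l' x = l x" "\<forall>x\<in>D (Suc k). p (l' x) = v x"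
      unfolding D_Suc by blast
    then show "\<exists>l'. ?P (Suc k) l' \<and> (\<forall>x\<in>D k. l' x = l x)"
      using l by (intro exI[of _ l']) (auto simp: D_def)
  qed
  then obtain l where l: "\<And>k. ?P k (l k)" and l_Suc: "\<And>k x. x \<in> D k \<Longrightarrow> l (Suc k) x = l k x" by blast
  have Dmono: "D j \<subseteq> D k" if "j \<le> k" for j k
    using that by (induction rule: dec_induct) (auto simp: D_Suc)
  have agree: "l k x = l j x" if "j \<le> k" "x \<in> D j" for j k x
    using that(1)
  proof (induction k rule: dec_induct)
    case (step i)
    then show ?case using l_Suc[of x i] Dmono[of j i] that(2) by auto
  qed simp
  have agree2: "l k x = l j x" if "x \<in> D j" "x \<in> D k" for j k x
    using agree[of j k x] agree[of k j x] that by (cases "j \<le> k") auto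
  define m where "m = (\<lambda>x. l (LEAST k. x \<in> D k) x)"
  have m: "m x = l k x" if "x \<in> D k" for x k
    unfolding m_def using LeastI[of "\<lambda>k. x \<in> D k", OF that] that by (rule agree2[rotated])
  have cov: "\<exists>k. x \<in> D k" if "x \<in> Q" for x
    using nbhd[OF that] D_Suc by blast
  have "continuous_map (top_of_set Q) E m"
  proof (rule pasting_lemma[where I=UNIV and T="\<lambda>k. \<Union>{N. openin (top_of_set Q) N \<and> N \<subseteq> R k}" and f="\<lambda>k. l (Suc k)"])
    fix k
    show "openin (top_of_set Q) (\<Union>{N. openin (top_of_set Q) N \<and> N \<subseteq> R k})" by (intro openin_Union) auto
    have "\<Union>{N. openin (top_of_set Q) N \<and> N \<subseteq> R k} \<subseteq> D (Suc k)" unfolding D_Suc by blast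
    moreover have "continuous_map (top_of_set (D (Suc k))) E (l (Suc k))" using l by blast
    ultimately show "continuous_map (subtopology (top_of_set Q) (\<Union>{N. openin (top_of_set Q) N \<and> N \<subseteq> R k})) E (l (Suc k))"
      by (auto simp: subtopology_subtopology elim!: continuous_map_from_subtopology_mono)
  next
    fix i j x assume "x \<in> topspace (top_of_set Q) \<inter> \<Union>{N. openin (top_of_set Q) N \<and> N \<subseteq> R i} \<inter> \<Union>{N. openin (top_of_set Q) N \<and> N \<subseteq> R j}"
    then show "l (Suc i) x = l (Suc j) x" by (intro agree2) (auto simp: D_Suc)
  next
    fix x assume "x \<in> topspace (top_of_set Q)"
    then obtain k N where "openin (top_of_set Q) N" "x \<in> N" "N \<subseteq> R k" using nbhd[of x] by auto
    then show "\<exists>j. j \<in> UNIV \<and> x \<in> \<Union>{N. openin (top_of_set Q) N \<and> N \<subseteq> R j} \<and> m x = l (Suc j) x"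
      using m[of x "Suc k"] D_Suc by blast
  qed
  moreover have "m x = u x" if "x \<in> Q \<inter> cube_boundary n" for x
    using m[of x 0] l[of 0] that by (simp add: D_def)
  moreover have "p (m x) = v x" if "x \<in> Q" for x
    using cov[OF that] m l by metis
  ultimately show "\<exists>l. continuous_map (top_of_set Q) E l \<and> (\<forall>x\<in>Q \<inter> cube_boundary n. l x = u x) \<and> (\<forall>x\<in>Q. p (l x) = v x)"
    by blast
qed

section \<open>Discs, cylinders and cubes\<close>

definition pair_homeo ::
  "'k::topological_space set \<Rightarrow> 'k set \<Rightarrow> 'l::topological_space set \<Rightarrow> 'l set \<Rightarrow> ('k \<Rightarrow> 'l) \<Rightarrow> ('l \<Rightarrow> 'k) \<Rightarrow> bool" where
  "pair_homeo K S K' S' f g \<longleftrightarrow>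
     continuous_on K f \<and> continuous_on K' g \<and> f ` K \<subseteq> K' \<and> g ` K' \<subseteq> K \<and> f ` S \<subseteq> S' \<and> g ` S' \<subseteq> S \<and>
     (\<forall>x\<in>K. g (f x) = x) \<and> (\<forall>y\<in>K'. f (g y) = y) \<and> S \<subseteq> K \<and> S' \<subseteq> K'"

lemma pair_homeo_sym: "pair_homeo K S K' S' f g \<Longrightarrow> pair_homeo K' S' K S g f"
  by (simp add: pair_homeo_def)

lemma pair_homeo_trans:
  assumes "pair_homeo K S K' S' f g" "pair_homeo K' S' K'' S'' f' g'"
  shows "pair_homeo K S K'' S'' (\<lambda>x. f' (f x)) (\<lambda>x. g (g' x))"
proof -
  have "continuous_on K (\<lambda>x. f' (f x))"
    using assms by (auto simp: pair_homeo_def intro: continuous_on_compose2)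
  moreover have "continuous_on K'' (\<lambda>x. g (g' x))"
    using assms by (auto simp: pair_homeo_def intro: continuous_on_compose2)
  ultimately show ?thesis
    using assms unfolding pair_homeo_def image_subset_iff by simp
qed

lemma lifts_pair_homeo:
  assumes "pair_homeo K S K' S' f g" "lifts K' S' E B p"
  shows "lifts K S E B p"
  using assms(1) by (intro lifts_retract[OF assms(2), of K f S g]) (auto simp: pair_homeo_def)

definition norm2 :: "nat \<Rightarrow> (nat \<Rightarrow> real) \<Rightarrow> real" where
  "norm2 n x = sqrt (\<Sum>i<n. (x i)\<^sup>2)"

text \<open>
The underlying sets of \<^const>\<open>disc\<close> and of its boundary, for use with the lifting property.
\<close>

definition disc_set :: "nat \<Rightarrow> (nat \<Rightarrow> real) set" where
  "disc_set n = {x. (\<forall>i\<ge>n. x i = 0) \<and> norm2 n x \<le> 1}"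

definition sphere_set :: "nat \<Rightarrow> (nat \<Rightarrow> real) set" where
  "sphere_set n = {x. (\<forall>i\<ge>n. x i = 0) \<and> norm2 n x = 1}"

lemma disc_eq: "disc n = top_of_set (disc_set n)"
proof -
  have "powertop_real UNIV = (euclidean :: (nat \<Rightarrow> real) topology)"
    by (rule euclidean_product_topology)
  moreover have "{x. \<forall>i\<ge>n. x i = 0} \<inter> {x. (\<Sum>i<n. (x i)\<^sup>2) \<le> 1} = disc_set n"
    by (auto simp: disc_set_def norm2_def)
  ultimately show ?thesis
    unfolding disc_def Euclidean_space_def subtopology_subtopology by (simp only:)
qed

lemma disc_boundary_eq: "disc_boundary n = sphere_set n"
  by (auto simp: disc_boundary_def disc_eq disc_set_def sphere_set_def norm2_def)

lemma sphere_set_subset: "sphere_set n \<subseteq> disc_set n"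
  by (auto simp: sphere_set_def disc_set_def)

lemma continuous_on_norm2 [continuous_intros]:
  "continuous_on S f \<Longrightarrow> continuous_on S (\<lambda>x. norm2 n (f x))"
  unfolding norm2_def by (intro continuous_on_real_sqrt continuous_on_sum continuous_on_power) (rule continuous_on_app)

lemma norm2_nonneg [simp]: "0 \<le> norm2 n x"
  by (simp add: norm2_def sum_nonneg)

lemma norm2_scale: "norm2 n (\<lambda>i. c * x i) = \<bar>c\<bar> * norm2 n x"
  by (simp add: norm2_def power_mult_distrib sum_distrib_left[symmetric] real_sqrt_mult)

lemma abs_le_norm2: "i < n \<Longrightarrow> \<bar>x i\<bar> \<le> norm2 n x"
proof -
  assume "i < n"
  then have "(x i)\<^sup>2 \<le> (\<Sum>i<n. (x i)\<^sup>2)" by (intro member_le_sum) auto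
  then show ?thesis unfolding norm2_def by (intro real_le_rsqrt) simp
qed

primrec max_norm :: "nat \<Rightarrow> (nat \<Rightarrow> real) \<Rightarrow> real" where
  "max_norm 0 x = 0"
| "max_norm (Suc n) x = max (max_norm n x) \<bar>x n\<bar>"

lemma continuous_on_max_norm: "continuous_on S (max_norm n)"
  by (induction n) (auto intro!: continuous_intros continuous_on_id)

lemma max_norm_nonneg [simp]: "0 \<le> max_norm n x" by (induction n) auto

lemma abs_le_max_norm: "i < n \<Longrightarrow> \<bar>x i\<bar> \<le> max_norm n x"
  by (induction n) (auto simp: less_Suc_eq le_max_iff_disj)

lemma max_norm_scale: "0 \<le> c \<Longrightarrow> max_norm n (\<lambda>i. c * x i) = c * max_norm n x"
  by (induction n) (auto simp: abs_mult max_mult_distrib_left)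

lemma max_norm_le_iff: "0 \<le> c \<Longrightarrow> max_norm n x \<le> c \<longleftrightarrow> (\<forall>i<n. \<bar>x i\<bar> \<le> c)"
  by (induction n) (auto simp: less_Suc_eq)

lemma max_norm_attained: "0 < max_norm n x \<Longrightarrow> \<exists>i<n. \<bar>x i\<bar> = max_norm n x"
proof (induction n)
  case (Suc n)
  show ?case
  proof (cases "max_norm n x \<le> \<bar>x n\<bar>")
    case True then show ?thesis by (intro exI[of _ n]) simp
  next
    case False
    then have "max_norm (Suc n) x = max_norm n x" "0 < max_norm n x" by auto
    then show ?thesis using Suc.IH by (auto intro: less_SucI)
  qed
qed simp

lemma max_norm_eq:
  assumes "0 < c"
  shows "max_norm n x = c \<longleftrightarrow> (\<forall>i<n. \<bar>x i\<bar> \<le> c) \<and> (\<exists>i<n. \<bar>x i\<bar> = c)"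
  using assms max_norm_attained[of n x] abs_le_max_norm[of _ n x] max_norm_le_iff[of c n x]
  by (metis less_imp_le order_antisym_conv)

lemma cube_eq_max_norm: "cube n = {x. (\<forall>i\<ge>n. x i = 0) \<and> max_norm n x \<le> 1}"
  using max_norm_le_iff[of 1 n] by (auto simp: cube_def)

lemma cube_boundary_eq_max_norm: "cube_boundary n = {x. (\<forall>i\<ge>n. x i = 0) \<and> max_norm n x = 1}"
  using max_norm_eq[of 1 n] by (auto simp: cube_boundary_def cube_def)

lemma max_norm_eq_0: "\<lbrakk>max_norm n x = 0; \<forall>i\<ge>n. x i = 0\<rbrakk> \<Longrightarrow> x i = 0"
  using abs_le_max_norm[of i n x] by (cases "i < n") auto

lemma norm2_eq_0: "\<lbrakk>norm2 n x = 0; \<forall>i\<ge>n. x i = 0\<rbrakk> \<Longrightarrow> x i = 0"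
  using abs_le_norm2[of i n x] by (cases "i < n") auto

lemma norm2_0 [simp]: "norm2 n (\<lambda>i. 0) = 0" by (simp add: norm2_def)
lemma max_norm_0 [simp]: "max_norm n (\<lambda>i. 0) = 0" by (induction n) auto

text \<open>
Rescaling along rays from one gauge to another. Continuity needs an argument only where \<open>M x = 0\<close>:
there the \<open>i\<close>-th coordinate is bounded by \<open>\<bar>N x\<bar>\<close>, which tends to \<open>0\<close>.
\<close>

lemma continuous_on_radial:
  fixes N M :: "(nat \<Rightarrow> real) \<Rightarrow> real"
  assumes N: "continuous_on S N" and M: "continuous_on S M"
    and z: "\<And>x. x \<in> S \<Longrightarrow> M x = 0 \<Longrightarrow> N x = 0" and le: "\<And>x i. x \<in> S \<Longrightarrow> \<bar>x i\<bar> \<le> M x"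
  shows "continuous_on S (\<lambda>x i. N x / M x * x i)"
proof (rule continuous_on_funI)
  fix i
  show "continuous_on S (\<lambda>x. N x / M x * x i)"
    unfolding continuous_on_def
  proof
    fix a assume a: "a \<in> S"
    have lims: "(N \<longlongrightarrow> N a) (at a within S)" "(M \<longlongrightarrow> M a) (at a within S)"
      using N M a by (auto simp: continuous_on_def)
    have lim_i: "((\<lambda>x. x i) \<longlongrightarrow> a i) (at a within S)"
      using continuous_on_app[OF continuous_on_id, of S i] a by (auto simp: continuous_on_def)
    show "((\<lambda>x. N x / M x * x i) \<longlongrightarrow> N a / M a * a i) (at a within S)"
    proof (cases "M a = 0")
      case False then show ?thesis by (intro tendsto_intros lims lim_i)
    next
      case True
      have "((\<lambda>x. N x / M x * x i) \<longlongrightarrow> 0) (at a within S)"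
      proof (rule Lim_null_comparison)
        show "\<forall>\<^sub>F x in at a within S. norm (N x / M x * x i) \<le> \<bar>N x\<bar>"
          unfolding eventually_at_filter
        proof (rule always_eventually, intro allI impI)
          fix x assume "x \<in> S"
          then have "\<bar>x i\<bar> \<le> M x" using le by blast
          then have "\<bar>N x\<bar> * \<bar>x i\<bar> \<le> \<bar>N x\<bar> * M x" "0 \<le> M x" by (auto intro: mult_left_mono)
          then show "norm (N x / M x * x i) \<le> \<bar>N x\<bar>"
            by (cases "M x = 0") (auto simp: abs_mult divide_le_eq)
        qed
        show "((\<lambda>x. \<bar>N x\<bar>) \<longlongrightarrow> 0) (at a within S)"
          using tendsto_rabs[OF lims(1)] z[OF a True] by simp
      qed
      then show ?thesis using True by simp
    qed
  qed
qed

text \<open>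
On each ray the Euclidean norm is exchanged with the maximum norm.
\<close>

lemma pair_homeo_disc_set_cube:
  "pair_homeo (disc_set n) (sphere_set n) (cube n) (cube_boundary n)
     (\<lambda>x i. norm2 n x / max_norm n x * x i) (\<lambda>x i. max_norm n x / norm2 n x * x i)"
proof -
  define f g where "f = (\<lambda>x i. norm2 n x / max_norm n x * x i)" and "g = (\<lambda>x i. max_norm n x / norm2 n x * x i)"
  have s0: "norm2 n x = 0" if "max_norm n x = 0" "\<forall>i\<ge>n. x i = 0" for x
    using max_norm_eq_0[OF that] by (simp add: norm2_def)
  have n0: "max_norm n x = 0" if "norm2 n x = 0" "\<forall>i\<ge>n. x i = 0" for x
  proof -
    have "x = (\<lambda>i. 0)" using norm2_eq_0[OF that] by auto
    then show ?thesis by simp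
  qed
  have le1: "\<bar>x i\<bar> \<le> max_norm n x" and le2: "\<bar>x i\<bar> \<le> norm2 n x" if "\<forall>i\<ge>n. x i = 0" for x i
    using abs_le_max_norm[of i n x] abs_le_norm2[of i n x] that by (cases "i < n"; simp)+
  have cf: "continuous_on (disc_set n) f"
    unfolding f_def
    by (rule continuous_on_radial) (auto intro: continuous_on_norm2 continuous_on_id continuous_on_max_norm s0 le1 simp: disc_set_def)
  have cg: "continuous_on (cube n) g"
    unfolding g_def
    by (rule continuous_on_radial) (auto intro: continuous_on_norm2 continuous_on_id continuous_on_max_norm n0 le2 simp: cube_eq_max_norm)
  have sf: "max_norm n (f x) = norm2 n x" and nf: "norm2 n (f x) = norm2 n x / max_norm n x * norm2 n x" if "\<forall>i\<ge>n. x i = 0" for x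
    using s0[OF _ that] max_norm_scale[of "norm2 n x / max_norm n x" n x] norm2_scale[of n "norm2 n x / max_norm n x" x]
    unfolding f_def by auto
  have ng: "norm2 n (g x) = max_norm n x" and sg: "max_norm n (g x) = max_norm n x / norm2 n x * max_norm n x" if "\<forall>i\<ge>n. x i = 0" for x
    using n0[OF _ that] norm2_scale[of n "max_norm n x / norm2 n x" x] max_norm_scale[of "max_norm n x / norm2 n x" n x]
    unfolding g_def by auto
  have zf: "f x i = 0" and zg: "g x i = 0" if "x i = 0" for x i using that by (simp_all add: f_def g_def)
  have gf: "g (f x) = x" if z: "\<forall>i\<ge>n. x i = 0" for x
  proof
    fix i
    have "g (f x) i = norm2 n x / (norm2 n x / max_norm n x * norm2 n x) * (norm2 n x / max_norm n x * x i)"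
      unfolding g_def sf[OF z] nf[OF z] by (simp add: f_def)
    then show "g (f x) i = x i"
      using n0[OF _ z] s0[OF _ z] norm2_eq_0[OF _ z, of i] by (cases "norm2 n x = 0") auto
  qed
  have fg: "f (g x) = x" if z: "\<forall>i\<ge>n. x i = 0" for x
  proof
    fix i
    have "f (g x) i = max_norm n x / (max_norm n x / norm2 n x * max_norm n x) * (max_norm n x / norm2 n x * x i)"
      unfolding f_def sg[OF z] ng[OF z] by (simp add: g_def)
    then show "f (g x) i = x i"
      using n0[OF _ z] s0[OF _ z] norm2_eq_0[OF _ z, of i] by (cases "norm2 n x = 0") auto
  qed
  have "pair_homeo (disc_set n) (sphere_set n) (cube n) (cube_boundary n) f g"
    unfolding pair_homeo_def using cf cg
    by (auto simp: disc_set_def sphere_set_def cube_eq_max_norm cube_boundary_eq_max_norm sf ng gf fg zf zg)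
  then show ?thesis unfolding f_def g_def .
qed

definition cylinder_boundary :: "nat \<Rightarrow> ((nat \<Rightarrow> real) \<times> real) set" where
  "cylinder_boundary n = disc_set n \<times> {0, 1} \<union> sphere_set n \<times> {0..1}"

lemma pair_homeo_times_interval:
  assumes "pair_homeo K S K' S' f g" and "A \<subseteq> {0..1}"
  shows "pair_homeo (K \<times> {0..1::real}) (K \<times> A \<union> S \<times> {0..1}) (K' \<times> {0..1}) (K' \<times> A \<union> S' \<times> {0..1})
     (\<lambda>(x, t). (f x, t)) (\<lambda>(x, t). (g x, t))"
proof -
  have "continuous_on (K \<times> {0..1::real}) (\<lambda>(x, t). (f x, t))" "continuous_on (K' \<times> {0..1::real}) (\<lambda>(x, t). (g x, t))"
  proof -
    have f: "continuous_on K f" and g: "continuous_on K' g" using assms(1) by (auto simp: pair_homeo_def)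
    show "continuous_on (K \<times> {0..1::real}) (\<lambda>(x, t). (f x, t))"
      unfolding case_prod_unfold
      by (intro continuous_on_Pair continuous_on_compose2[OF f] continuous_intros) auto
    show "continuous_on (K' \<times> {0..1::real}) (\<lambda>(x, t). (g x, t))"
      unfolding case_prod_unfold
      by (intro continuous_on_Pair continuous_on_compose2[OF g] continuous_intros) auto
  qed
  then show ?thesis
    using assms unfolding pair_homeo_def image_subset_iff by auto
qed

text \<open>
The interval becomes the new last coordinate, rescaled from \<open>[0, 1]\<close> to \<open>[-1, 1]\<close>.
\<close>

lemma pair_homeo_cube_Suc:
  "pair_homeo (cube n \<times> {0..1}) (cube n \<times> {0, 1} \<union> cube_boundary n \<times> {0..1}) (cube (Suc n)) (cube_boundary (Suc n))
     (\<lambda>(x, t). x(n := 2 * t - 1)) (\<lambda>z. (z(n := 0), (z n + 1) / 2))"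
  unfolding pair_homeo_def
proof (intro conjI)
  show "continuous_on (cube n \<times> {0..1}) (\<lambda>(x, t). x(n := 2 * t - 1))"
    unfolding case_prod_unfold fun_upd_def
  proof (rule continuous_on_funI)
    show "continuous_on (cube n \<times> {0..1}) (\<lambda>z. if i = n then 2 * snd z - 1 else fst z i)" for i
    proof (cases "i = n")
      case True
      then show ?thesis by (simp add: continuous_on_diff continuous_on_mult continuous_on_snd continuous_on_id)
    next
      case False
      then show ?thesis by (simp add: continuous_on_app[OF continuous_on_fst[OF continuous_on_id]])
    qed
  qed
  show "continuous_on (cube (Suc n)) (\<lambda>z. (z(n := 0), (z n + 1) / 2))"
  proof (intro continuous_on_Pair)
    show "continuous_on (cube (Suc n)) (\<lambda>z. z(n := 0))"
      unfolding fun_upd_def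
    proof (rule continuous_on_funI)
      show "continuous_on (cube (Suc n)) (\<lambda>z. if i = n then 0 else z i)" for i
        by (cases "i = n") (auto intro!: continuous_intros continuous_on_id)
    qed
    show "continuous_on (cube (Suc n)) (\<lambda>z. (z n + 1) / 2)"
      by (intro continuous_on_divide continuous_on_add continuous_on_coordinate continuous_on_const) simp
  qed
  have le: "\<bar>2 * t - 1\<bar> \<le> 1 \<longleftrightarrow> t \<in> {0..1}" and eq: "\<bar>2 * t - 1\<bar> = 1 \<longleftrightarrow> t \<in> {0, 1}" for t :: real by auto
  have le': "(s + 1) / 2 \<in> {0..1} \<longleftrightarrow> \<bar>s\<bar> \<le> 1" and eq': "(s + 1) / 2 \<in> {0, 1} \<longleftrightarrow> \<bar>s\<bar> = 1" for s :: real by auto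
  have f: "x(n := 2 * t - 1) \<in> cube (Suc n)" if "x \<in> cube n" "t \<in> {0..1}" for x t
    using that le[of t] by (auto simp: cube_def less_Suc_eq)
  have g: "z(n := 0) \<in> cube n" "(z n + 1) / 2 \<in> {0..1}" if "z \<in> cube (Suc n)" for z
    using that unfolding le' by (auto simp: cube_def)
  show "(\<lambda>(x, t). x(n := 2 * t - 1)) ` (cube n \<times> {0..1}) \<subseteq> cube (Suc n)" using f by auto
  show "(\<lambda>z. (z(n := 0), (z n + 1) / 2)) ` cube (Suc n) \<subseteq> cube n \<times> {0..1}" using g by blast
  have b1: "x(n := 2 * t - 1) \<in> cube_boundary (Suc n)" if "x \<in> cube n" "t \<in> {0, 1}" for x t
    using that f[of x t] eq[of t] by (auto simp: cube_boundary_def)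
  have b2: "x(n := 2 * t - 1) \<in> cube_boundary (Suc n)" if "x \<in> cube_boundary n" "t \<in> {0..1}" for x t
  proof -
    obtain i where "i < n" "\<bar>x i\<bar> = 1" "x \<in> cube n" using \<open>x \<in> cube_boundary n\<close> by (auto simp: cube_boundary_def)
    then have "i < Suc n" "\<bar>(x(n := 2 * t - 1)) i\<bar> = 1" "x(n := 2 * t - 1) \<in> cube (Suc n)"
      using f[of x t] that(2) by auto
    then show ?thesis unfolding cube_boundary_def by blast
  qed
  show "(\<lambda>(x, t). x(n := 2 * t - 1)) ` (cube n \<times> {0, 1} \<union> cube_boundary n \<times> {0..1}) \<subseteq> cube_boundary (Suc n)"
  proof (rule image_subsetI)
    fix z assume z: "z \<in> cube n \<times> {0, 1} \<union> cube_boundary n \<times> {0..1::real}"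
    obtain x t where zx: "z = (x, t)" by (cases z)
    from z have "x \<in> cube n \<and> t \<in> {0, 1} \<or> x \<in> cube_boundary n \<and> t \<in> {0..1}"
      unfolding zx by blast
    then have "x(n := 2 * t - 1) \<in> cube_boundary (Suc n)" using b1 b2 by blast
    then show "(case z of (x, t) \<Rightarrow> x(n := 2 * t - 1)) \<in> cube_boundary (Suc n)" unfolding zx by simp
  qed
  have "(z(n := 0), (z n + 1) / 2) \<in> cube n \<times> {0, 1} \<union> cube_boundary n \<times> {0..1}" if z: "z \<in> cube_boundary (Suc n)" for z
  proof -
    obtain i where i: "i < Suc n" "\<bar>z i\<bar> = 1" and zc: "z \<in> cube (Suc n)" using z by (auto simp: cube_boundary_def)
    show ?thesis
    proof (cases "i = n")
      case True
      then have "(z n + 1) / 2 \<in> {0, 1}" using i unfolding eq' by simp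
      then show ?thesis using g[OF zc] by blast
    next
      case False
      then have "z(n := 0) \<in> cube_boundary n" using i g(1)[OF zc] by (auto simp: cube_boundary_def intro!: exI[of _ i])
      then show ?thesis using g[OF zc] by blast
    qed
  qed
  then show "(\<lambda>z. (z(n := 0), (z n + 1) / 2)) ` cube_boundary (Suc n) \<subseteq> cube n \<times> {0, 1} \<union> cube_boundary n \<times> {0..1}"
    by blast
  show "\<forall>x\<in>cube n \<times> {0..1}. (\<lambda>z. (z(n := 0), (z n + 1) / 2)) (case x of (x, t) \<Rightarrow> x(n := 2 * t - 1)) = x"
    by (auto simp: cube_def fun_eq_iff)
  show "\<forall>y\<in>cube (Suc n). (\<lambda>(x, t). x(n := 2 * t - 1)) ((\<lambda>z. (z(n := 0), (z n + 1) / 2)) y) = y"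
    by (simp add: fun_eq_iff field_simps)
  show "cube n \<times> {0, 1} \<union> cube_boundary n \<times> {0..1} \<subseteq> cube n \<times> {0..1::real}" by (auto simp: cube_boundary_def)
  show "cube_boundary (Suc n) \<subseteq> cube (Suc n)" by (auto simp: cube_boundary_def)
qed

lemma pair_homeo_cyl_cube:
  obtains f g where "pair_homeo (disc_set n \<times> {0..1}) (cylinder_boundary n) (cube (Suc n)) (cube_boundary (Suc n)) f g"
  using pair_homeo_trans[OF pair_homeo_times_interval[OF pair_homeo_disc_set_cube[of n], of "{0, 1}"] pair_homeo_cube_Suc]
  unfolding cylinder_boundary_def by auto

lemma pair_homeo_cyl_disc_set:
  obtains f g where "pair_homeo (disc_set n \<times> {0..1}) (cylinder_boundary n) (disc_set (Suc n)) (sphere_set (Suc n)) f g"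
proof -
  obtain f g where "pair_homeo (disc_set n \<times> {0..1}) (cylinder_boundary n) (cube (Suc n)) (cube_boundary (Suc n)) f g"
    by (rule pair_homeo_cyl_cube)
  from that[OF pair_homeo_trans[OF this pair_homeo_sym[OF pair_homeo_disc_set_cube]]] show ?thesis .
qed

text \<open>
Radial projection of the cylinder \<open>D\<^sup>n \<times> I\<close> from the point \<open>(0, 2)\<close>. Along the rays from that point the
gauge \<open>m (y, t) = max \<bar>y\<bar> (1 - t / 2)\<close> is linear, it is at most \<open>1\<close> on the cylinder, and it equals \<open>1\<close>
exactly on the base and the sides. \<open>push n z s\<close> moves \<open>z\<close> outwards until the gauge is at least \<open>1 - s\<close>. So
\<open>s = 0\<close> is the retraction onto base and sides, and \<open>s = depth n z\<close> is the first time at which \<open>z\<close> does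
not move.
\<close>

definition push :: "nat \<Rightarrow> (nat \<Rightarrow> real) \<times> real \<Rightarrow> real \<Rightarrow> (nat \<Rightarrow> real) \<times> real" where
  "push n z s = (let c = max 1 ((1 - s) / max (norm2 n (fst z)) (1 - snd z / 2))
     in (\<lambda>i. c * fst z i, 2 - c * (2 - snd z)))"

definition depth :: "nat \<Rightarrow> (nat \<Rightarrow> real) \<times> real \<Rightarrow> real" where
  "depth n z = 1 - max (norm2 n (fst z)) (1 - snd z / 2)"

lemma depth_bounds: "z \<in> disc_set n \<times> {0..1} \<Longrightarrow> 0 \<le> depth n z \<and> depth n z \<le> 1"
  by (auto simp: depth_def disc_set_def)

lemma continuous_on_depth: "continuous_on X (depth n)"
  unfolding depth_def by (intro continuous_intros continuous_on_max continuous_on_id) auto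

lemma push_depth: "z \<in> disc_set n \<times> {0..1} \<Longrightarrow> push n z (depth n z) = z"
  by (auto simp: push_def depth_def Let_def max_def split: if_splits)

lemma push_mem:
  assumes z: "z \<in> disc_set n \<times> {0..1}" and s: "0 \<le> s" "s \<le> 1"
  shows "push n z s \<in> disc_set n \<times> {0..1}"
proof -
  obtain y t where zy: "z = (y, t)" by (cases z)
  define m where "m = max (norm2 n y) (1 - t / 2)"
  define c where "c = max 1 ((1 - s) / m)"
  have yt: "norm2 n y \<le> 1" "\<forall>i\<ge>n. y i = 0" "0 \<le> t" "t \<le> 1" using z by (auto simp: zy disc_set_def)
  have m: "1/2 \<le> m" "m \<le> 1" "norm2 n y \<le> m" "1 - t / 2 \<le> m" using yt unfolding m_def by linarith+
  have "(1 - s) / m \<le> 1 / m" using m s by (intro divide_right_mono) auto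
  moreover have "1 \<le> 1 / m" using m by simp
  ultimately have c: "1 \<le> c" "c * m \<le> 1" using m by (auto simp: c_def max_def field_simps)
  have "c * norm2 n y \<le> 1" using mult_left_mono[OF m(3), of c] c by linarith
  then have "norm2 n (\<lambda>i. c * y i) \<le> 1" using c by (simp add: norm2_scale)
  moreover have "c * (2 - t) \<le> 2" using mult_left_mono[OF m(4), of c] c
    by (simp add: algebra_simps)
  moreover have "1 * 1 \<le> c * (2 - t)" using c yt by (intro mult_mono) auto
  ultimately show ?thesis using yt(2) by (auto simp: push_def zy Let_def disc_set_def m_def[symmetric] c_def[symmetric])
qed

lemma push_0_mem:
  assumes z: "z \<in> disc_set n \<times> {0..1}"
  shows "push n z 0 \<in> disc_set n \<times> {0} \<union> sphere_set n \<times> {0..1}"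
proof -
  obtain y t where zy: "z = (y, t)" by (cases z)
  define m where "m = max (norm2 n y) (1 - t / 2)"
  have yt: "norm2 n y \<le> 1" "\<forall>i\<ge>n. y i = 0" "0 \<le> t" "t \<le> 1" using z by (auto simp: zy disc_set_def)
  have m: "1/2 \<le> m" "m \<le> 1" using yt unfolding m_def by linarith+
  have c: "max 1 (1 / m) = 1 / m" using m by simp
  have p: "push n z 0 = (\<lambda>i. 1 / m * y i, 2 - 1 / m * (2 - t))"
    unfolding push_def zy Let_def fst_conv snd_conv m_def[symmetric] using c by simp
  have "norm2 n (\<lambda>i. 1 / m * y i) = 1 \<or> 2 - 1 / m * (2 - t) = 0"
  proof (cases "norm2 n y = m")
    case True then show ?thesis unfolding norm2_scale using m by simp
  next
    case False
    then have "1 - t / 2 = m" by (auto simp: m_def max_def split: if_splits)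
    then have "2 - t = 2 * m" by simp
    then show ?thesis using m by simp
  qed
  then show ?thesis using push_mem[OF z, of 0] yt(2) unfolding p by (auto simp: disc_set_def sphere_set_def)
qed

lemma push_fixed:
  assumes "z \<in> disc_set n \<times> {0} \<union> sphere_set n \<times> {0..1}"
  shows "push n z 0 = z" "depth n z = 0"
proof -
  show "depth n z = 0" using assms by (auto simp: depth_def disc_set_def sphere_set_def)
  moreover have "z \<in> disc_set n \<times> {0..1}" using assms sphere_set_subset by auto
  ultimately show "push n z 0 = z" using push_depth by metis
qed

lemma continuous_on_push:
  assumes "X \<subseteq> (disc_set n \<times> {0..1}) \<times> UNIV"
  shows "continuous_on X (\<lambda>z. push n (fst z) (snd z))"
proof -
  define m where "m = (\<lambda>z :: ((nat \<Rightarrow> real) \<times> real) \<times> real. max (norm2 n (fst (fst z))) (1 - snd (fst z) / 2))"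
  define c where "c = (\<lambda>z. max 1 ((1 - snd z) / m z))"
  have m: "continuous_on X m" "\<And>z. z \<in> X \<Longrightarrow> m z \<noteq> 0"
  proof -
    show "continuous_on X m"
      unfolding m_def by (intro continuous_intros continuous_on_max continuous_on_id) auto
    show "m z \<noteq> 0" if "z \<in> X" for z
    proof -
      have "snd (fst z) \<le> 1" using assms that by auto
      then have "0 < 1 - snd (fst z) / 2" by simp
      then show ?thesis unfolding m_def by linarith
    qed
  qed
  have c: "continuous_on X c"
    unfolding c_def using m(2) by (intro continuous_on_max continuous_intros m(1) continuous_on_id) auto
  have "continuous_on X (\<lambda>z i. c z * fst (fst z) i)"
    by (intro continuous_on_funI continuous_on_mult c continuous_on_app[OF continuous_on_fst[OF continuous_on_fst[OF continuous_on_id]]])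
  moreover have "continuous_on X (\<lambda>z. 2 - c z * (2 - snd (fst z)))"
    by (intro continuous_on_mult continuous_on_diff c continuous_intros continuous_on_id)
  ultimately have "continuous_on X (\<lambda>z. (\<lambda>i. c z * fst (fst z) i, 2 - c z * (2 - snd (fst z))))"
    by (rule continuous_on_Pair)
  then show ?thesis unfolding push_def Let_def c_def m_def .
qed

lemma disc_set_scale: "y \<in> disc_set n \<Longrightarrow> 0 \<le> c \<Longrightarrow> c \<le> 1 \<Longrightarrow> (\<lambda>i. c * y i) \<in> disc_set n"
  by (auto simp: disc_set_def norm2_scale intro: mult_le_one)

section \<open>Relative homotopy lifting\<close>

lemma continuous_on_pair_const: "continuous_on X (\<lambda>x. (x, c))"
  by (rule continuous_on_Pair[OF continuous_on_id continuous_on_const])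

lemma continuous_on_fst_id: "continuous_on X fst"
  by (rule continuous_on_fst[OF continuous_on_id])

lemma continuous_on_push_const: "continuous_on (disc_set n \<times> {0..1}) (\<lambda>z. push n z s)"
proof -
  have "continuous_on (disc_set n \<times> {0..1}) (\<lambda>z. (\<lambda>z. push n (fst z) (snd z)) (z, s))"
    by (rule continuous_on_compose2[OF continuous_on_push[OF subset_refl] continuous_on_pair_const]) auto
  then show ?thesis by simp
qed

lemma disc_interval_eq: "prod_topology (disc n) unit_interval = top_of_set (disc_set n \<times> {0..1::real})"
  by (simp add: disc_eq unit_interval_def)

lemma Serre_fibration_disc_set:
  "Serre_fibration E B p \<longleftrightarrow>
     continuous_map E B p \<and>
     (\<forall>n f h. continuous_map (top_of_set (disc_set n)) E f \<and> continuous_map (top_of_set (disc_set n \<times> {0..1::real})) B h \<and>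
        (\<forall>x\<in>disc_set n. h (x, 0) = p (f x))
        \<longrightarrow> (\<exists>k. continuous_map (top_of_set (disc_set n \<times> {0..1::real})) E k \<and>
                 (\<forall>x\<in>disc_set n. k (x, 0) = f x) \<and> (\<forall>z\<in>disc_set n \<times> {0..1::real}. p (k z) = h z)))"
  unfolding Serre_fibration_def disc_interval_eq unfolding disc_eq topspace_euclidean_subtopology ..

lemma Serre_fibration_iff_lifts:
  "Serre_fibration E B p \<longleftrightarrow>
     continuous_map E B p \<and> (\<forall>n. lifts (disc_set n \<times> {0..1::real}) (disc_set n \<times> {0::real}) E B p)"
proof (intro iffI conjI allI)
  assume S: "Serre_fibration E B p"
  then show "continuous_map E B p" by (simp add: Serre_fibration_def)
  fix n
  show "lifts (disc_set n \<times> {0..1::real}) (disc_set n \<times> {0::real}) E B p"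
    unfolding lifts_def
  proof (intro allI impI, elim conjE)
    fix u v assume u: "continuous_map (top_of_set (disc_set n \<times> {0::real})) E u"
      and v: "continuous_map (top_of_set (disc_set n \<times> {0..1::real})) B v" and uv: "\<forall>x\<in>disc_set n \<times> {0::real}. p (u x) = v x"
    have u0: "continuous_map (top_of_set (disc_set n)) E (\<lambda>x. u (x, 0))"
      by (rule continuous_map_top_of_set_compose[OF u continuous_on_pair_const]) auto
    obtain k where "continuous_map (top_of_set (disc_set n \<times> {0..1::real})) E k"
        "\<forall>x\<in>disc_set n. k (x, 0) = u (x, 0)" "\<forall>z\<in>disc_set n \<times> {0..1::real}. p (k z) = v z"
      using conjunct2[OF S[unfolded Serre_fibration_disc_set], rule_format, of n "\<lambda>x. u (x, 0)" v] u0 v uv by auto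
    then show "\<exists>l. continuous_map (top_of_set (disc_set n \<times> {0..1::real})) E l \<and> (\<forall>x\<in>disc_set n \<times> {0::real}. l x = u x) \<and> (\<forall>x\<in>disc_set n \<times> {0..1::real}. p (l x) = v x)"
      by (intro exI[of _ k]) auto
  qed
next
  assume S: "continuous_map E B p \<and> (\<forall>n. lifts (disc_set n \<times> {0..1::real}) (disc_set n \<times> {0::real}) E B p)"
  show "Serre_fibration E B p"
    unfolding Serre_fibration_disc_set
  proof (intro conjI allI impI, use S in blast, elim conjE)
    fix n f h assume f: "continuous_map (top_of_set (disc_set n)) E f" and h: "continuous_map (top_of_set (disc_set n \<times> {0..1::real})) B h"
      and fh: "\<forall>x\<in>disc_set n. h (x, 0) = p (f x)"
    have u: "continuous_map (top_of_set (disc_set n \<times> {0::real})) E (\<lambda>z. f (fst z))"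
      by (rule continuous_map_top_of_set_compose[OF f continuous_on_fst_id]) auto
    have uh: "p (f (fst z)) = h z" if "z \<in> disc_set n \<times> {0::real}" for z using fh that by auto
    obtain l where "continuous_map (top_of_set (disc_set n \<times> {0..1::real})) E l" "\<And>x. x \<in> disc_set n \<times> {0::real} \<Longrightarrow> l x = f (fst x)"
        "\<And>x. x \<in> disc_set n \<times> {0..1::real} \<Longrightarrow> p (l x) = h x"
      using liftsD[OF conjunct2[OF S, rule_format, of n] u h uh] by blast
    then show "\<exists>k. continuous_map (top_of_set (disc_set n \<times> {0..1::real})) E k \<and> (\<forall>x\<in>disc_set n. k (x, 0) = f x) \<and>
         (\<forall>z\<in>disc_set n \<times> {0..1::real}. p (k z) = h z)"
      by (intro exI[of _ l]) auto
  qed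
qed

lemma pair_homeo_empty: "pair_homeo K S K' S' f g \<Longrightarrow> pair_homeo K {} K' {} f g"
  by (simp add: pair_homeo_def)

text \<open>
The pair of the cylinder and its base and sides is a retract of (cylinder \<open>\<times> I\<close>, cylinder \<open>\<times> 0\<close>), by
\<open>z \<mapsto> (z, depth z)\<close> and \<open>(z, s) \<mapsto> push z s\<close>.
\<close>

lemma lifts_cylinder_rel:
  assumes "lifts ((disc_set n \<times> {0..1::real}) \<times> {0..1::real}) ((disc_set n \<times> {0..1::real}) \<times> {0::real}) E B p"
  shows "lifts (disc_set n \<times> {0..1::real}) (disc_set n \<times> {0::real} \<union> sphere_set n \<times> {0..1::real}) E B p"
  unfolding lifts_def
proof (intro allI impI, elim conjE)
  let ?K = "disc_set n \<times> {0..1::real}" and ?J = "disc_set n \<times> {0::real} \<union> sphere_set n \<times> {0..1::real}"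
  fix u v assume u: "continuous_map (top_of_set ?J) E u" and v: "continuous_map (top_of_set ?K) B v"
    and uv: "\<forall>x\<in>?J. p (u x) = v x"
  have JK: "?J \<subseteq> ?K" using sphere_set_subset by auto
  have u': "continuous_map (top_of_set (?K \<times> {0::real})) E (\<lambda>z. u (push n (fst z) (snd z)))"
  proof (rule continuous_map_top_of_set_compose[OF u continuous_on_push])
    show "?K \<times> {0::real} \<subseteq> ?K \<times> UNIV" by auto
    show "(\<lambda>z. push n (fst z) (snd z)) ` (?K \<times> {0::real}) \<subseteq> ?J"
    proof (rule image_subsetI)
      fix z assume "z \<in> ?K \<times> {0::real}"
      then show "push n (fst z) (snd z) \<in> ?J" using push_0_mem[of "fst z" n] unfolding mem_Times_iff by simp
    qed
  qed
  have v': "continuous_map (top_of_set (?K \<times> {0..1::real})) B (\<lambda>z. v (push n (fst z) (snd z)))"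
  proof (rule continuous_map_top_of_set_compose[OF v continuous_on_push])
    show "?K \<times> {0..1::real} \<subseteq> ?K \<times> UNIV" by auto
    show "(\<lambda>z. push n (fst z) (snd z)) ` (?K \<times> {0..1::real}) \<subseteq> ?K"
    proof (rule image_subsetI)
      fix z assume z: "z \<in> ?K \<times> {0..1::real}"
      then have "fst z \<in> ?K" "0 \<le> snd z" "snd z \<le> 1" by auto
      then show "push n (fst z) (snd z) \<in> ?K" by (rule push_mem)
    qed
  qed
  have uv': "p (u (push n (fst z) (snd z))) = v (push n (fst z) (snd z))" if "z \<in> ?K \<times> {0::real}" for z
  proof -
    have "fst z \<in> ?K" "snd z = 0" using that by auto
    then show ?thesis using uv push_0_mem[of "fst z" n] by simp
  qed
  obtain k where k: "continuous_map (top_of_set (?K \<times> {0..1::real})) E k"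
      "\<And>z. z \<in> ?K \<times> {0::real} \<Longrightarrow> k z = u (push n (fst z) (snd z))"
      "\<And>z. z \<in> ?K \<times> {0..1::real} \<Longrightarrow> p (k z) = v (push n (fst z) (snd z))"
    using liftsD[OF assms u' v' uv'] by blast
  have "continuous_map (top_of_set ?K) E (\<lambda>z. k (z, depth n z))"
  proof (rule continuous_map_top_of_set_compose[OF k(1)])
    show "continuous_on ?K (\<lambda>z. (z, depth n z))"
      by (rule continuous_on_Pair[OF continuous_on_id continuous_on_depth])
    show "(\<lambda>z. (z, depth n z)) ` ?K \<subseteq> ?K \<times> {0..1::real}"
      using depth_bounds[of _ n] by (simp add: image_subset_iff mem_Times_iff)
  qed
  moreover have "k (z, depth n z) = u z" if "z \<in> ?J" for z
    using k(2)[of "(z, 0)"] push_fixed[OF that] that JK by auto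
  moreover have "p (k (z, depth n z)) = v z" if "z \<in> ?K" for z
    using k(3)[of "(z, depth n z)"] depth_bounds[OF that] push_depth[OF that] that by auto
  ultimately show "\<exists>l. continuous_map (top_of_set ?K) E l \<and> (\<forall>x\<in>?J. l x = u x) \<and> (\<forall>x\<in>?K. p (l x) = v x)"
    by (intro exI[of _ "\<lambda>z. k (z, depth n z)"]) blast
qed

text \<open>
Relative homotopy lifting for any pair homeomorphic to a disc and its boundary: the cylinder over a
disc is a disc of the next dimension, so homotopy lifting for discs provides the hypothesis of the
preceding retract argument.
\<close>

lemma Serre_lifts_rel:
  assumes S: "Serre_fibration E B p" and h: "pair_homeo K S (disc_set m) (sphere_set m) f g"
  shows "lifts (K \<times> {0..1::real}) (K \<times> {0::real} \<union> S \<times> {0..1::real}) E B p"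
proof -
  obtain f' g' where "pair_homeo (disc_set m \<times> {0..1::real}) (cylinder_boundary m) (disc_set (Suc m)) (sphere_set (Suc m)) f' g'"
    by (rule pair_homeo_cyl_disc_set)
  from pair_homeo_times_interval[OF pair_homeo_empty[OF this], of "{0}"]
  have "pair_homeo ((disc_set m \<times> {0..1::real}) \<times> {0..1::real}) ((disc_set m \<times> {0..1::real}) \<times> {0::real}) (disc_set (Suc m) \<times> {0..1::real}) (disc_set (Suc m) \<times> {0::real})
     (\<lambda>(x, t). (f' x, t)) (\<lambda>(x, t). (g' x, t))" by simp
  moreover have "lifts (disc_set (Suc m) \<times> {0..1::real}) (disc_set (Suc m) \<times> {0::real}) E B p"
    using S unfolding Serre_fibration_iff_lifts by blast
  ultimately have "lifts ((disc_set m \<times> {0..1::real}) \<times> {0..1::real}) ((disc_set m \<times> {0..1::real}) \<times> {0::real}) E B p"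
    by (rule lifts_pair_homeo)
  then have "lifts (disc_set m \<times> {0..1::real}) (disc_set m \<times> {0::real} \<union> sphere_set m \<times> {0..1::real}) E B p"
    by (rule lifts_cylinder_rel)
  then show ?thesis
    using lifts_pair_homeo[OF pair_homeo_times_interval[OF h, of "{0}"]] by simp
qed

lemma closed_subset_pair_homeo:
  assumes h: "pair_homeo K S (disc_set m) (sphere_set m) f g"
  shows "closedin (top_of_set K) S"
proof -
  have "sphere_set m = disc_set m \<inter> {x. norm2 m x = 1}" by (auto simp: sphere_set_def disc_set_def)
  moreover have "closed {x. norm2 m x = 1}"
    by (intro closed_Collect_eq continuous_on_norm2 continuous_on_const continuous_on_id)
  ultimately have "closedin (top_of_set (disc_set m)) (sphere_set m)" by (simp add: closedin_closed_Int)
  moreover have "continuous_map (top_of_set K) (top_of_set (disc_set m)) f"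
    using h by (auto simp: pair_homeo_def continuous_map_in_subtopology)
  ultimately have "closedin (top_of_set K) {x \<in> K. f x \<in> sphere_set m}"
    using closedin_continuous_map_preimage[of "top_of_set K" "top_of_set (disc_set m)" f "sphere_set m"] by simp
  moreover have "{x \<in> K. f x \<in> sphere_set m} = S"
  proof
    show "{x \<in> K. f x \<in> sphere_set m} \<subseteq> S"
    proof
      fix x assume x: "x \<in> {x \<in> K. f x \<in> sphere_set m}"
      then have "g (f x) \<in> S" "g (f x) = x" using h by (auto simp: pair_homeo_def)
      then show "x \<in> S" by simp
    qed
    show "S \<subseteq> {x \<in> K. f x \<in> sphere_set m}" using h by (auto simp: pair_homeo_def)
  qed
  ultimately show ?thesis by simp
qed

lemma continuous_map_top_of_set_union_closed:
  assumes "closedin (top_of_set (S \<union> T)) S" "closedin (top_of_set (S \<union> T)) T"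
    and "continuous_map (top_of_set S) E f" "continuous_map (top_of_set T) E g"
    and "\<And>x. x \<in> S \<Longrightarrow> x \<in> T \<Longrightarrow> f x = g x"
  shows "continuous_map (top_of_set (S \<union> T)) E (\<lambda>x. if x \<in> S then f x else g x)"
  using assms(3,4)
  by (intro continuous_map_glue_closed[OF assms(1,2) _ _ _ assms(5)])
     (simp_all add: subtopology_subtopology Int_absorb1)

lemma closedin_base_and_sides:
  assumes "closedin (top_of_set K) S"
  shows "closedin (top_of_set (K \<times> {0::real} \<union> S \<times> {0..1::real})) (K \<times> {0::real})"
    and "closedin (top_of_set (K \<times> {0::real} \<union> S \<times> {0..1::real})) (S \<times> {0..1::real})"
proof -
  have SK: "S \<subseteq> K" using assms closedin_subset by fastforce
  have "closedin (top_of_set (K \<times> {0..1::real})) (K \<times> {0::real})" "closedin (top_of_set (K \<times> {0..1::real})) (S \<times> {0..1::real})"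
    using assms unfolding prod_topology_subtopology_eu[symmetric] closedin_prod_Times_iff by (auto simp: closed_subset)
  then show "closedin (top_of_set (K \<times> {0::real} \<union> S \<times> {0..1::real})) (K \<times> {0::real})"
    and "closedin (top_of_set (K \<times> {0::real} \<union> S \<times> {0..1::real})) (S \<times> {0..1::real})"
    using SK by (auto elim!: closedin_subset_trans)
qed

text \<open>
The values on base and sides are extended by composing with the retraction \<open>push\<close> at time \<open>0\<close>.
\<close>

lemma homotopy_extension:
  fixes K S :: "'k::topological_space set"
  assumes h: "pair_homeo K S (disc_set m) (sphere_set m) f g"
    and v: "continuous_map (top_of_set K) B v" and W: "continuous_map (top_of_set (S \<times> {0..1::real})) B W"
    and vW: "\<And>x. x \<in> S \<Longrightarrow> W (x, 0) = v x"
  obtains V where "continuous_map (top_of_set (K \<times> {0..1::real})) B V" "\<And>x. x \<in> K \<Longrightarrow> V (x, 0) = v x"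
    "\<And>z. z \<in> S \<times> {0..1::real} \<Longrightarrow> V z = W z"
proof -
  define c where "c = (\<lambda>z. if z \<in> K \<times> {0::real} then v (fst z) else W z)"
  have SK: "S \<subseteq> K" using h by (simp add: pair_homeo_def)
  have vf: "continuous_map (top_of_set (K \<times> {0::real})) B (\<lambda>z. v (fst z))"
    by (rule continuous_map_top_of_set_compose[OF v continuous_on_fst_id]) auto
  have c: "continuous_map (top_of_set (K \<times> {0::real} \<union> S \<times> {0..1::real})) B c"
    unfolding c_def using vW
    by (intro continuous_map_top_of_set_union_closed closedin_base_and_sides closed_subset_pair_homeo[OF h] vf W) auto
  define r where "r = (\<lambda>z. (\<lambda>(y, t). (g y, t)) (push m ((\<lambda>(x, t). (f x, t)) z) (0::real)))"
  have "{0} \<subseteq> {0..1::real}" by simp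
  note hh = pair_homeo_times_interval[OF h this]
  have f': "continuous_on (K \<times> {0..1::real}) (\<lambda>(x, t::real). (f x, t))" "(\<lambda>(x, t). (f x, t)) ` (K \<times> {0..1::real}) \<subseteq> disc_set m \<times> {0..1::real}"
    and g': "continuous_on (disc_set m \<times> {0..1::real}) (\<lambda>(x, t::real). (g x, t))"
      "(\<lambda>(x, t). (g x, t)) ` (disc_set m \<times> {0::real} \<union> sphere_set m \<times> {0..1::real}) \<subseteq> K \<times> {0::real} \<union> S \<times> {0..1::real}"
    using hh by (auto simp: pair_homeo_def)
  have p': "continuous_on (disc_set m \<times> {0..1::real}) (\<lambda>z. push m z 0)"
    by (rule continuous_on_push_const)
  have p'': "(\<lambda>z. push m z 0) ` (disc_set m \<times> {0..1::real}) \<subseteq> disc_set m \<times> {0..1::real}" by (intro image_subsetI push_mem) auto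
  have r: "continuous_on (K \<times> {0..1::real}) r"
    unfolding r_def by (intro continuous_on_compose2[OF g'(1)] continuous_on_compose2[OF p'] f'(1)) (use f'(2) p'' in blast)+
  have rim: "r ` (K \<times> {0..1::real}) \<subseteq> K \<times> {0::real} \<union> S \<times> {0..1::real}"
  proof (rule image_subsetI)
    fix z :: "'k \<times> real" assume "z \<in> K \<times> {0..1::real}"
    then have "(\<lambda>(x, t). (f x, t)) z \<in> disc_set m \<times> {0..1::real}" using f'(2) by blast
    from imageI[OF push_0_mem[OF this], of "\<lambda>(x, t). (g x, t)"]
    have "r z \<in> (\<lambda>(x, t). (g x, t)) ` (disc_set m \<times> {0} \<union> sphere_set m \<times> {0..1})" unfolding r_def .
    then show "r z \<in> K \<times> {0::real} \<union> S \<times> {0..1::real}" using g'(2) by (rule rev_subsetD)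
  qed
  have rfix: "r z = z" if "z \<in> K \<times> {0::real} \<union> S \<times> {0..1::real}" for z
  proof -
    have "(\<lambda>(x, t). (f x, t)) z \<in> disc_set m \<times> {0::real} \<union> sphere_set m \<times> {0..1::real}" using hh that unfolding pair_homeo_def by blast
    from push_fixed(1)[OF this] show ?thesis using hh that unfolding r_def pair_homeo_def by auto
  qed
  show thesis
  proof (rule that)
    show "continuous_map (top_of_set (K \<times> {0..1::real})) B (\<lambda>z. c (r z))"
      by (rule continuous_map_top_of_set_compose[OF c r rim])
    show "c (r (x, 0)) = v x" if "x \<in> K" for x using rfix[of "(x, 0)"] that by (simp add: c_def)
    show "c (r z) = W z" if "z \<in> S \<times> {0..1::real}" for z
      using rfix[of z] that vW by (auto simp: c_def)
  qed
qed

text \<open>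
A solution of a lifting problem can be carried along a homotopy of lifting problems: the solution is the
initial value of a relative homotopy lifting problem, whose end value solves the deformed problem.
\<close>

lemma transport_lift:
  assumes S: "Serre_fibration E B p" and h: "pair_homeo K S (disc_set m) (sphere_set m) f g"
    and U: "continuous_map (top_of_set (S \<times> {0..1::real})) E U" and V: "continuous_map (top_of_set (K \<times> {0..1::real})) B V"
    and UV: "\<And>z. z \<in> S \<times> {0..1::real} \<Longrightarrow> p (U z) = V z"
    and l: "continuous_map (top_of_set K) E l" "\<And>x. x \<in> S \<Longrightarrow> l x = U (x, 0)" "\<And>x. x \<in> K \<Longrightarrow> p (l x) = V (x, 0)"
  shows "\<exists>l'. continuous_map (top_of_set K) E l' \<and> (\<forall>x\<in>S. l' x = U (x, 1)) \<and> (\<forall>x\<in>K. p (l' x) = V (x, 1))"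
proof -
  define c where "c = (\<lambda>z. if z \<in> K \<times> {0::real} then l (fst z) else U z)"
  have SK: "S \<subseteq> K" using h by (simp add: pair_homeo_def)
  have lf: "continuous_map (top_of_set (K \<times> {0::real})) E (\<lambda>z. l (fst z))"
    by (rule continuous_map_top_of_set_compose[OF l(1) continuous_on_fst_id]) auto
  have c: "continuous_map (top_of_set (K \<times> {0::real} \<union> S \<times> {0..1::real})) E c"
    unfolding c_def using l(2)
    by (intro continuous_map_top_of_set_union_closed closedin_base_and_sides closed_subset_pair_homeo[OF h] lf U) auto
  have cV: "p (c z) = V z" if "z \<in> K \<times> {0::real} \<union> S \<times> {0..1::real}" for z
    using that l(3) UV by (auto simp: c_def)
  obtain k where k: "continuous_map (top_of_set (K \<times> {0..1::real})) E k" "\<And>z. z \<in> K \<times> {0::real} \<union> S \<times> {0..1::real} \<Longrightarrow> k z = c z"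
      "\<And>z. z \<in> K \<times> {0..1::real} \<Longrightarrow> p (k z) = V z"
    using liftsD[OF Serre_lifts_rel[OF S h] c V cV] by blast
  have "continuous_map (top_of_set K) E (\<lambda>x. k (x, 1))"
    by (rule continuous_map_top_of_set_compose[OF k(1) continuous_on_pair_const]) auto
  moreover have "k (x, 1) = U (x, 1)" if "x \<in> S" for x using k(2)[of "(x, 1)"] that by (simp add: c_def)
  moreover have "p (k (x, 1)) = V (x, 1)" if "x \<in> K" for x using k(3)[of "(x, 1)"] that by simp
  ultimately show ?thesis by blast
qed

text \<open>
It suffices to solve a lifting problem after a deformation \<open>U\<close> of its upper map alone: the lower map
can be deformed along by homotopy extension, and the solution is transported back along the reversed
homotopy. The hypothesis \<open>solve\<close> quantifies over all lower maps since nothing is known about the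
deformed one.
\<close>

lemma lift_up_to_homotopy:
  fixes K S :: "'k::topological_space set"
  assumes S: "Serre_fibration E B p" and h: "pair_homeo K S (disc_set m) (sphere_set m) f g"
    and U: "continuous_map (top_of_set (S \<times> {0..1::real})) E U" and v: "continuous_map (top_of_set K) B v"
    and Uv: "\<And>x. x \<in> S \<Longrightarrow> p (U (x, 0)) = v x"
    and solve: "\<And>v'. continuous_map (top_of_set K) B v' \<Longrightarrow> (\<And>x. x \<in> S \<Longrightarrow> p (U (x, 1)) = v' x) \<Longrightarrow>
       \<exists>l. continuous_map (top_of_set K) E l \<and> (\<forall>x\<in>S. l x = U (x, 1)) \<and> (\<forall>x\<in>K. p (l x) = v' x)"
  shows "\<exists>l. continuous_map (top_of_set K) E l \<and> (\<forall>x\<in>S. l x = U (x, 0)) \<and> (\<forall>x\<in>K. p (l x) = v x)"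
proof -
  have "continuous_map E B p" using S by (simp add: Serre_fibration_def)
  from continuous_map_compose[OF U this]
  have W: "continuous_map (top_of_set (S \<times> {0..1::real})) B (\<lambda>z. p (U z))" by (simp add: o_def)
  obtain V where V: "continuous_map (top_of_set (K \<times> {0..1::real})) B V" "\<And>x. x \<in> K \<Longrightarrow> V (x, 0) = v x"
    "\<And>z. z \<in> S \<times> {0..1::real} \<Longrightarrow> V z = p (U z)"
    using homotopy_extension[OF h v W Uv] by blast
  have "continuous_map (top_of_set K) B (\<lambda>x. V (x, 1))"
    by (rule continuous_map_top_of_set_compose[OF V(1) continuous_on_pair_const]) auto
  then obtain l where l: "continuous_map (top_of_set K) E l" "\<forall>x\<in>S. l x = U (x, 1)" "\<forall>x\<in>K. p (l x) = V (x, 1)"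
    using solve[of "\<lambda>x. V (x, 1)"] V(3) by auto
  have rev: "continuous_on X (\<lambda>z. (fst z, 1 - snd z))" for X :: "('k \<times> real) set"
    by (intro continuous_intros continuous_on_id)
  have "\<exists>l'. continuous_map (top_of_set K) E l' \<and> (\<forall>x\<in>S. l' x = U (fst (x, 1::real), 1 - snd (x, 1::real))) \<and>
      (\<forall>x\<in>K. p (l' x) = V (fst (x, 1::real), 1 - snd (x, 1::real)))"
  proof (rule transport_lift[OF S h _ _ _ l(1)])
    show "continuous_map (top_of_set (S \<times> {0..1::real})) E (\<lambda>z. U (fst z, 1 - snd z))"
      by (rule continuous_map_top_of_set_compose[OF U rev]) auto
    show "continuous_map (top_of_set (K \<times> {0..1::real})) B (\<lambda>z. V (fst z, 1 - snd z))"
      by (rule continuous_map_top_of_set_compose[OF V(1) rev]) auto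
  qed (use l V(3) in auto)
  then show ?thesis using V(2) by simp
qed

section \<open>Acyclic Serre fibrations lift cubes\<close>

lemma cylinder_boundary_eq: "cylinder_boundary m = (disc_set m \<times> {0} \<union> sphere_set m \<times> {0..1}) \<union> disc_set m \<times> {1}"
  by (auto simp: cylinder_boundary_def)

lemma closed_disc_set: "closed (disc_set n)" and closed_sphere_set: "closed (sphere_set n)"
proof -
  have c: "closed {x :: nat \<Rightarrow> real. x i = 0}" for i
    by (intro closed_Collect_eq continuous_on_coordinate continuous_on_const)
  have "disc_set n = (\<Inter>i\<in>{n..}. {x. x i = 0}) \<inter> {x. norm2 n x \<le> 1}" by (auto simp: disc_set_def)
  moreover have "closed {x. norm2 n x \<le> 1}"
    by (intro closed_Collect_le continuous_on_norm2 continuous_on_const continuous_on_id)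
  ultimately show "closed (disc_set n)" using c by (simp add: closed_Int closed_INT)
  have "sphere_set n = (\<Inter>i\<in>{n..}. {x. x i = 0}) \<inter> {x. norm2 n x = 1}" by (auto simp: sphere_set_def)
  moreover have "closed {x. norm2 n x = 1}"
    by (intro closed_Collect_eq continuous_on_norm2 continuous_on_const continuous_on_id)
  ultimately show "closed (sphere_set n)" using c by (simp add: closed_Int closed_INT)
qed

definition shrink :: "(nat \<Rightarrow> real) \<times> real \<Rightarrow> real \<Rightarrow> (nat \<Rightarrow> real) \<times> real" where
  "shrink z s = (\<lambda>i. (1 - s) * fst z i, (1 - s) * snd z)"

lemma continuous_on_shrink: "continuous_on X (\<lambda>z. shrink (fst z) (snd z))"
  unfolding shrink_def
proof (rule continuous_on_Pair)
  show "continuous_on X (\<lambda>z. \<lambda>i. (1 - snd z) * fst (fst z) i)"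
    by (intro continuous_on_funI continuous_on_mult continuous_on_diff continuous_on_const
        continuous_on_snd continuous_on_id continuous_on_app[OF continuous_on_fst[OF continuous_on_fst[OF continuous_on_id]]])
  show "continuous_on X (\<lambda>z. (1 - snd z) * snd (fst z))"
    by (intro continuous_on_mult continuous_on_diff continuous_on_const continuous_on_snd continuous_on_fst continuous_on_id)
qed

lemma shrink_mem: "z \<in> disc_set m \<times> {0..1} \<Longrightarrow> 0 \<le> s \<Longrightarrow> s \<le> 1 \<Longrightarrow> shrink z s \<in> disc_set m \<times> {0..1}"
  by (auto simp: shrink_def disc_set_scale mult_le_one)

lemma shrink_0: "shrink z 0 = z" and shrink_1: "shrink z 1 = (\<lambda>i. 0, 0)"
  by (simp_all add: shrink_def)

text \<open>
The problem is deformed twice. Base and sides together are contractible, so the upper map may be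
assumed constant there, with value \<open>x0\<close>. It is then an element of \<open>\<pi>\<^sub>m(E, x0)\<close> on the top, and the
lower map is a null homotopy of its image; by injectivity (on path components if \<open>m = 0\<close>) the
upper map extends over the cylinder. Contracting it through this extension makes it constant on the
whole boundary, so that the lower map is an element of \<open>\<pi>\<^bsub>m+1\<^esub>(B, p x0)\<close>. By surjectivity that
element has a preimage up to homotopy, which homotopy lifting turns into a preimage on the nose.
\<close>

lemma acyclic_fibration_lifts_cylinder:
  assumes S: "Serre_fibration E B p" and W: "weak_homotopy_equivalence E B p"
  shows "lifts (disc_set m \<times> {0..1}) (cylinder_boundary m) E B p"
  unfolding lifts_def
proof (intro allI impI, elim conjE)
  let ?K = "disc_set m \<times> {0..1::real}" and ?J = "disc_set m \<times> {0::real} \<union> sphere_set m \<times> {0..1}"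
  fix u v assume u: "continuous_map (top_of_set (cylinder_boundary m)) E u" and v: "continuous_map (top_of_set ?K) B v"
    and uv: "\<forall>x\<in>cylinder_boundary m. p (u x) = v x"
  have cp: "continuous_map E B p" using S by (simp add: Serre_fibration_def)
  obtain \<phi> \<psi> where h: "pair_homeo ?K (cylinder_boundary m) (disc_set (Suc m)) (sphere_set (Suc m)) \<phi> \<psi>" by (rule pair_homeo_cyl_disc_set)
  have JK: "?J \<subseteq> ?K" and JC: "?J \<subseteq> cylinder_boundary m" and CK: "cylinder_boundary m \<subseteq> ?K" using sphere_set_subset by (auto simp: cylinder_boundary_def)
  define c :: "(nat \<Rightarrow> real) \<times> real" where "c = (\<lambda>i. 0, 0)"
  have cJ: "c \<in> ?J" by (simp add: c_def disc_set_def)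
  define x0 where "x0 = u c"
  have x0E: "x0 \<in> topspace E" using u cJ JC by (auto simp: x0_def continuous_map_def Pi_iff)
  \<comment> \<open>\<open>\<kappa>\<close> contracts base and sides to the centre \<open>c\<close> within themselves: contract linearly inside the
    cylinder and retract back.\<close>
  define \<kappa> where "\<kappa> = (\<lambda>z. push m (shrink (fst z) (snd z)) 0)"
  have \<kappa>c: "continuous_on (?K \<times> {0..1}) \<kappa>"
    unfolding \<kappa>_def
    by (rule continuous_on_compose2[OF continuous_on_push_const continuous_on_shrink])
       (use shrink_mem in \<open>simp add: image_subset_iff mem_Times_iff\<close>)
  have \<kappa>J: "\<kappa> (z, s) \<in> ?J" if "z \<in> ?K" "s \<in> {0..1}" for z s
    using push_0_mem[OF shrink_mem[OF that(1), of s]] that(2) by (simp add: \<kappa>_def)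
  have \<kappa>0: "\<kappa> (z, 0) = z" if "z \<in> ?J" for z
    using push_fixed(1)[OF that] by (simp add: \<kappa>_def shrink_0)
  have \<kappa>1: "\<kappa> (z, 1) = c" for z
    using push_fixed(1)[OF cJ] by (simp add: \<kappa>_def shrink_1 c_def)
  have u\<kappa>: "continuous_map (top_of_set (X \<times> {0..1})) E (\<lambda>z. u (\<kappa> z))" if "X \<subseteq> ?K" for X
  proof (rule continuous_map_top_of_set_compose[OF u])
    show "continuous_on (X \<times> {0..1}) \<kappa>" using \<kappa>c by (rule continuous_on_subset) (use that in blast)
    show "\<kappa> ` (X \<times> {0..1}) \<subseteq> cylinder_boundary m"
    proof (rule image_subsetI)
      fix z assume "z \<in> X \<times> {0..1::real}"
      then have "fst z \<in> ?K" "snd z \<in> {0..1}" using that by auto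
      from \<kappa>J[OF this] show "\<kappa> z \<in> cylinder_boundary m" using JC by auto
    qed
  qed
  define top where "top = (\<lambda>y::nat\<Rightarrow>real. (y, 1::real))"
  define w where "w = (\<lambda>z. if z \<in> disc_set m \<times> {0::real} then u (fst z, 1) else u (\<kappa> ((fst z, 1), snd z)))"
  have wc: "continuous_map (top_of_set ?J) E w"
    unfolding w_def
  proof (rule continuous_map_top_of_set_union_closed)
    show "closedin (top_of_set ?J) (disc_set m \<times> {0})" "closedin (top_of_set ?J) (sphere_set m \<times> {0..1})"
      using closed_disc_set[of m] closed_sphere_set[of m] by (auto intro!: closed_subset closed_Times)
    show "continuous_map (top_of_set (disc_set m \<times> {0::real})) E (\<lambda>z. u (fst z, 1))"
      by (rule continuous_map_top_of_set_compose[OF u continuous_on_Pair[OF continuous_on_fst_id continuous_on_const]])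
         (auto simp: cylinder_boundary_def)
    have "continuous_on (sphere_set m \<times> {0..1::real}) (\<lambda>z. ((fst z, 1::real), snd z))"
      by (intro continuous_on_Pair continuous_on_fst_id continuous_on_const continuous_on_snd[OF continuous_on_id])
    moreover have "(\<lambda>z. ((fst z, 1::real), snd z)) ` (sphere_set m \<times> {0..1::real}) \<subseteq> (sphere_set m \<times> {1}) \<times> {0..1}" by auto
    moreover have "sphere_set m \<times> {1} \<subseteq> ?K" using sphere_set_subset[of m] by auto
    ultimately show "continuous_map (top_of_set (sphere_set m \<times> {0..1::real})) E (\<lambda>z. u (\<kappa> ((fst z, 1), snd z)))"
      using continuous_map_top_of_set_compose[OF u\<kappa>[of "sphere_set m \<times> {1}"]] by blast
    show "u (fst z, 1) = u (\<kappa> ((fst z, 1), snd z))" if "z \<in> disc_set m \<times> {0::real}" "z \<in> sphere_set m \<times> {0..1}" for z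
      using that \<kappa>0[of "(fst z, 1)"] by auto
  qed
  \<comment> \<open>\<open>U\<close> is the induced deformation of the upper map. On the top face it has to extend what happens on
    the rim: the top face times the time interval is retracted onto its initial face and the rim by \<open>r\<close>,
    and \<open>w\<close> has the prescribed values there.\<close>
  define r :: "((nat \<Rightarrow> real) \<times> real) \<times> real \<Rightarrow> _" where "r = (\<lambda>z. push m (fst (fst z), snd z) 0)"
  define U where "U = (\<lambda>z :: ((nat \<Rightarrow> real) \<times> real) \<times> real. if z \<in> ?J \<times> {0..1::real} then u (\<kappa> z) else w (r z))"
  have rJ: "r ((y, t), s) \<in> ?J" if "y \<in> disc_set m" "s \<in> {0..1}" for y t s
    using push_0_mem[of "(y, s)" m] that by (simp add: r_def)
  have Uc: "continuous_map (top_of_set (cylinder_boundary m \<times> {0..1})) E U"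
  proof -
    let ?T = "(disc_set m \<times> {1::real}) \<times> {0..1::real}"
    have eq: "cylinder_boundary m \<times> {0..1::real} = ?J \<times> {0..1} \<union> ?T" unfolding cylinder_boundary_eq by blast
    show ?thesis
      unfolding eq U_def
    proof (rule continuous_map_top_of_set_union_closed)
      show "closedin (top_of_set (?J \<times> {0..1::real} \<union> ?T)) (?J \<times> {0..1::real})"
        "closedin (top_of_set (?J \<times> {0..1::real} \<union> ?T)) ?T"
        using closed_disc_set[of m] closed_sphere_set[of m] by (auto intro!: closed_subset closed_Times closed_Un)
      show "continuous_map (top_of_set (?J \<times> {0..1})) E (\<lambda>z. u (\<kappa> z))" by (rule u\<kappa>[OF JK])
      have "continuous_on ((disc_set m \<times> {1::real}) \<times> {0..1::real}) (\<lambda>z. (fst (fst z), snd z))"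
        by (intro continuous_on_Pair continuous_on_fst continuous_on_snd continuous_on_id)
      then have "continuous_on ((disc_set m \<times> {1::real}) \<times> {0..1::real}) r"
        unfolding r_def by (rule continuous_on_compose2[OF continuous_on_push_const]) auto
      then show "continuous_map (top_of_set ((disc_set m \<times> {1::real}) \<times> {0..1})) E (\<lambda>z. w (r z))"
      proof (rule continuous_map_top_of_set_compose[OF wc])
        show "r ` ?T \<subseteq> ?J"
        proof (rule image_subsetI)
          fix z assume "z \<in> ?T"
          then obtain y s where "z = ((y, 1), s)" "y \<in> disc_set m" "s \<in> {0..1}" by blast
          then show "r z \<in> ?J" using rJ by simp
        qed
      qed
      show "u (\<kappa> z) = w (r z)" if zJ: "z \<in> ?J \<times> {0..1}" and zT: "z \<in> ?T" for z
      proof -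
        obtain y s where z: "z = ((y, 1), s)" "y \<in> sphere_set m" "s \<in> {0..1}" using zJ zT by auto
        have "r z = (y, s)" using push_fixed(1)[of "(y, s)" m] z by (simp add: r_def)
        moreover have "w (y, s) = u (\<kappa> ((y, 1), s))"
          using z(2) \<kappa>0[of "(y, 1)"] by (auto simp: w_def)
        ultimately show ?thesis using z by simp
      qed
    qed
  qed
  have U0: "U (z, 0) = u z" if zC: "z \<in> cylinder_boundary m" for z
  proof (cases "z \<in> ?J")
    case True then show ?thesis using \<kappa>0[OF True] by (simp add: U_def)
  next
    case False
    then obtain y where z: "z = (y, 1)" "y \<in> disc_set m" using zC unfolding cylinder_boundary_eq by auto
    have "r (z, 0) = (y, 0)" using push_fixed(1)[of "(y, 0)" m] z by (simp add: r_def)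
    then show ?thesis using False z by (auto simp: U_def w_def)
  qed
  have U1: "U (z, 1) = x0" if "z \<in> ?J" for z
    using that \<kappa>1 by (simp add: U_def x0_def)
  have "\<exists>l. continuous_map (top_of_set ?K) E l \<and> (\<forall>x\<in>cylinder_boundary m. l x = U (x, 0)) \<and> (\<forall>x\<in>?K. p (l x) = v x)"
  proof (rule lift_up_to_homotopy[OF S h Uc v])
    show "p (U (x, 0)) = v x" if "x \<in> cylinder_boundary m" for x using U0[OF that] uv that by simp
  next
    fix v1 assume v1: "continuous_map (top_of_set ?K) B v1" and Uv1: "\<And>x. x \<in> cylinder_boundary m \<Longrightarrow> p (U (x, 1)) = v1 x"
    \<comment> \<open>The deformed upper map \<open>U (_, 1)\<close> is constant on base and sides and is extended over the cylinder to \<open>e\<close>.\<close>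
    have U1c: "continuous_map (top_of_set (cylinder_boundary m)) E (\<lambda>x. U (x, 1))"
      by (rule continuous_map_top_of_set_compose[OF Uc continuous_on_pair_const]) auto
    have ac: "continuous_map (top_of_set (disc_set m)) E (\<lambda>y. U ((y, 1), 1))"
      by (rule continuous_map_top_of_set_compose[OF U1c continuous_on_pair_const]) (auto simp: cylinder_boundary_def)
    have v1c: "v1 (y, 0) = p x0" if "y \<in> disc_set m" for y
      using Uv1[of "(y, 0)"] U1[of "(y, 0)"] that by (simp add: cylinder_boundary_def)
    have v1s: "v1 (y, t) = p x0" if "y \<in> sphere_set m" "t \<in> {0..1}" for y t
      using Uv1[of "(y, t)"] U1[of "(y, t)"] that by (simp add: cylinder_boundary_def)
    have v1t: "v1 (y, 1) = p (U ((y, 1), 1))" if "y \<in> disc_set m" for y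
      using Uv1[of "(y, 1)"] that by (simp add: cylinder_boundary_def)
    have "\<exists>e. continuous_map (top_of_set ?K) E e \<and> (\<forall>y\<in>disc_set m. e (y, 0) = x0 \<and> e (y, 1) = U ((y, 1), 1)) \<and>
        (\<forall>y\<in>sphere_set m. \<forall>t\<in>{0..1}. e (y, t) = x0)"
    proof (cases "m = 0")
      case True
      have d0: "disc_set m = {\<lambda>i. 0}" using True by (auto simp: disc_set_def norm2_def)
      have s0: "sphere_set m = {}" using True by (auto simp: sphere_set_def norm2_def)
      define x1 where "x1 = U ((\<lambda>i. 0, 1), 1)"
      have x1E: "x1 \<in> topspace E" using ac d0 by (auto simp: x1_def continuous_map_def Pi_iff)
      have "pathin B (\<lambda>t. v1 (\<lambda>i. 0, t))"
        unfolding pathin_def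
        by (rule continuous_map_top_of_set_compose[OF v1 continuous_on_Pair[OF continuous_on_const continuous_on_id]])
           (auto simp: d0)
      then have "path_component_of B (p x0) (p x1)"
        unfolding path_component_of_def using v1c v1t d0 by (auto simp: x1_def intro!: exI[of _ "\<lambda>t. v1 (\<lambda>i. 0, t)"])
      then have "path_component_of E x0 x1"
        using W x0E x1E unfolding weak_homotopy_equivalence_def by blast
      then obtain g where g: "continuous_map (top_of_set {0..1::real}) E g" "g 0 = x0" "g 1 = x1"
        unfolding path_component_of_def pathin_def by blast
      have "continuous_map (top_of_set ?K) E (\<lambda>z. g (snd z))"
        by (rule continuous_map_top_of_set_compose[OF g(1) continuous_on_snd[OF continuous_on_id]]) auto
      then show ?thesis using g d0 s0 by (intro exI[of _ "\<lambda>z. g (snd z)"]) (auto simp: x1_def)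
    next
      case False
      have sc: "spheroid m E x0 (\<lambda>y. x0)" using x0E by (simp add: spheroid_def)
      have sa: "spheroid m E x0 (\<lambda>y. U ((y, 1), 1))"
        using ac U1 by (simp add: spheroid_def disc_eq disc_boundary_eq)
      have swap: "continuous_on X (\<lambda>z. (snd z, fst z))" for X :: "('s::topological_space \<times> 't::topological_space) set"
        by (intro continuous_on_Pair continuous_on_fst_id continuous_on_snd[OF continuous_on_id])
      have "spheroid_homotopic m B (p x0) (p \<circ> (\<lambda>y. x0)) (p \<circ> (\<lambda>y. U ((y, 1), 1)))"
        unfolding spheroid_homotopic_def
      proof (subst homotopic_with)
        show "\<exists>h. continuous_map (prod_topology (top_of_set {0..1::real}) (disc m)) B h \<and>
          (\<forall>x\<in>topspace (disc m). h (0, x) = (p \<circ> (\<lambda>y. x0)) x) \<and>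
          (\<forall>x\<in>topspace (disc m). h (1, x) = (p \<circ> (\<lambda>y. U ((y, 1), 1))) x) \<and>
          (\<forall>t\<in>{0..1::real}. \<forall>s\<in>disc_boundary m. h (t, s) = p x0)"
        proof (intro exI conjI)
          show "continuous_map (prod_topology (top_of_set {0..1::real}) (disc m)) B (\<lambda>z. v1 (snd z, fst z))"
            unfolding disc_eq prod_topology_subtopology_eu
            by (rule continuous_map_top_of_set_compose[OF v1 swap]) auto
        qed (use v1c v1s v1t in \<open>auto simp: disc_eq disc_boundary_eq\<close>)
      qed (use sphere_set_subset in \<open>auto simp: disc_eq disc_boundary_eq subset_iff\<close>)
      then have "spheroid_homotopic m E x0 (\<lambda>y. x0) (\<lambda>y. U ((y, 1), 1))"
        using W x0E sc sa False unfolding weak_homotopy_equivalence_def by (metis One_nat_def Suc_leI neq0_conv)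
      then obtain e where e: "continuous_map (prod_topology (top_of_set {0..1::real}) (disc m)) E e"
        "\<forall>x. e (0, x) = x0" "\<forall>x. e (1, x) = U ((x, 1), 1)" "\<forall>t\<in>{0..1}. \<forall>s\<in>disc_boundary m. e (t, s) = x0"
        unfolding spheroid_homotopic_def homotopic_with_def by blast
      have "continuous_map (top_of_set ?K) E (\<lambda>z. e (snd z, fst z))"
        using e(1) unfolding disc_eq prod_topology_subtopology_eu
        by (rule continuous_map_top_of_set_compose[OF _ swap]) auto
      then show ?thesis using e by (intro exI[of _ "\<lambda>z. e (snd z, fst z)"]) (auto simp: disc_boundary_eq)
    qed
    then obtain e where e: "continuous_map (top_of_set ?K) E e" "\<forall>y\<in>disc_set m. e (y, 0) = x0 \<and> e (y, 1) = U ((y, 1), 1)"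
        "\<forall>y\<in>sphere_set m. \<forall>t\<in>{0..1}. e (y, t) = x0" by blast
    have eU: "e z = U (z, 1)" if zC: "z \<in> cylinder_boundary m" for z
    proof (cases "z \<in> ?J")
      case True then show ?thesis using e U1[OF True] by auto
    next
      case False
      then obtain y where "z = (y, 1)" "y \<in> disc_set m" using zC unfolding cylinder_boundary_eq by auto
      then show ?thesis using e by simp
    qed
    have ec: "e c = x0" using e(2) by (simp add: c_def disc_set_def)
    \<comment> \<open>The second deformation contracts the cylinder, on which \<open>e\<close> is defined.\<close>
    define U2 where "U2 = (\<lambda>z. e (shrink (fst z) (snd z)))"
    have U2c: "continuous_map (top_of_set (cylinder_boundary m \<times> {0..1})) E U2"
      unfolding U2_def
    proof (rule continuous_map_top_of_set_compose[OF e(1) continuous_on_shrink], rule image_subsetI)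
      fix z assume "z \<in> cylinder_boundary m \<times> {0..1::real}"
      then have "fst z \<in> ?K" "0 \<le> snd z" "snd z \<le> 1" using CK by auto
      then show "shrink (fst z) (snd z) \<in> ?K" by (rule shrink_mem)
    qed
    have "\<exists>l. continuous_map (top_of_set ?K) E l \<and> (\<forall>x\<in>cylinder_boundary m. l x = U2 (x, 0)) \<and> (\<forall>x\<in>?K. p (l x) = v1 x)"
    proof (rule lift_up_to_homotopy[OF S h U2c v1])
      show "p (U2 (x, 0)) = v1 x" if "x \<in> cylinder_boundary m" for x
        using eU[OF that] Uv1[OF that] by (simp add: U2_def shrink_0)
    next
      fix v2 assume v2: "continuous_map (top_of_set ?K) B v2" and Uv2: "\<And>x. x \<in> cylinder_boundary m \<Longrightarrow> p (U2 (x, 1)) = v2 x"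
      have v2b: "v2 x = p x0" if "x \<in> cylinder_boundary m" for x
        using Uv2[OF that] ec by (simp add: U2_def shrink_1 c_def)
      have h\<psi>: "continuous_on (disc_set (Suc m)) \<psi>" "\<psi> ` disc_set (Suc m) \<subseteq> ?K" "\<psi> ` sphere_set (Suc m) \<subseteq> cylinder_boundary m"
        and h\<phi>: "continuous_on ?K \<phi>" "\<phi> ` ?K \<subseteq> disc_set (Suc m)" "\<phi> ` cylinder_boundary m \<subseteq> sphere_set (Suc m)" "\<And>x. x \<in> ?K \<Longrightarrow> \<psi> (\<phi> x) = x"
        using h unfolding pair_homeo_def by blast+
      have "v2 (\<psi> y) = p x0" if "y \<in> sphere_set (Suc m)" for y
        using v2b[of "\<psi> y"] h\<psi>(3) that by blast
      then have "spheroid (Suc m) B (p x0) (\<lambda>y. v2 (\<psi> y))"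
        unfolding spheroid_def disc_eq disc_boundary_eq
        using continuous_map_top_of_set_compose[OF v2 h\<psi>(1,2)] by auto
      then obtain f where f: "spheroid (Suc m) E x0 f"
          "spheroid_homotopic (Suc m) B (p x0) (p \<circ> f) (\<lambda>y. v2 (\<psi> y))"
        using W x0E unfolding weak_homotopy_equivalence_def by (metis One_nat_def Suc_le_mono zero_le)
      then obtain q where q: "continuous_map (prod_topology (top_of_set {0..1::real}) (disc (Suc m))) B q"
        "\<forall>x. q (0, x) = p (f x)" "\<forall>x. q (1, x) = v2 (\<psi> x)" "\<forall>t\<in>{0..1}. \<forall>s\<in>disc_boundary (Suc m). q (t, s) = p x0"
        unfolding spheroid_homotopic_def homotopic_with_def by auto
      have "pair_homeo (disc_set (Suc m)) (sphere_set (Suc m)) (disc_set (Suc m)) (sphere_set (Suc m)) (\<lambda>x. x) (\<lambda>x. x)"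
        using sphere_set_subset by (simp add: pair_homeo_def continuous_on_id)
      \<comment> \<open>The homotopy from \<open>p \<circ> f\<close> to the lower map is constant on the boundary; \<open>f\<close> is transported along it.\<close>
      from transport_lift[OF S this, of "\<lambda>z. x0" "\<lambda>z. q (snd z, fst z)" f]
      have "\<exists>l'. continuous_map (top_of_set (disc_set (Suc m))) E l' \<and> (\<forall>x\<in>sphere_set (Suc m). l' x = x0) \<and>
          (\<forall>x\<in>disc_set (Suc m). p (l' x) = q (snd (x, 1::real), fst (x, 1::real)))"
      proof
        show "continuous_map (top_of_set (disc_set (Suc m) \<times> {0..1})) B (\<lambda>z. q (snd z, fst z))"
          using q(1) unfolding disc_eq prod_topology_subtopology_eu
          by (rule continuous_map_top_of_set_compose)
             (auto intro: continuous_on_Pair continuous_on_fst_id continuous_on_snd[OF continuous_on_id])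
      qed (use x0E f(1) q in \<open>auto simp: spheroid_def disc_eq disc_boundary_eq\<close>)
      then obtain l' where l': "continuous_map (top_of_set (disc_set (Suc m))) E l'" "\<forall>x\<in>sphere_set (Suc m). l' x = x0"
          "\<forall>x\<in>disc_set (Suc m). p (l' x) = v2 (\<psi> x)" using q(3) by auto
      have "continuous_map (top_of_set ?K) E (\<lambda>x. l' (\<phi> x))"
        by (rule continuous_map_top_of_set_compose[OF l'(1) h\<phi>(1,2)])
      moreover have "l' (\<phi> x) = U2 (x, 1)" if "x \<in> cylinder_boundary m" for x
        using l'(2) h\<phi>(3) that ec by (auto simp: U2_def shrink_1 c_def)
      moreover have "p (l' (\<phi> x)) = v2 x" if "x \<in> ?K" for x
      proof -
        have "\<phi> x \<in> disc_set (Suc m)" using h\<phi>(2) that by blast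
        then show ?thesis using l'(3) h\<phi>(4)[OF that] by simp
      qed
      ultimately show "\<exists>l. continuous_map (top_of_set ?K) E l \<and> (\<forall>x\<in>cylinder_boundary m. l x = U2 (x, 1)) \<and> (\<forall>x\<in>?K. p (l x) = v2 x)"
        by blast
    qed
    then show "\<exists>l. continuous_map (top_of_set ?K) E l \<and> (\<forall>x\<in>cylinder_boundary m. l x = U (x, 1)) \<and> (\<forall>x\<in>?K. p (l x) = v1 x)"
      using eU by (simp add: U2_def shrink_0)
  qed
  then show "\<exists>l. continuous_map (top_of_set ?K) E l \<and> (\<forall>x\<in>cylinder_boundary m. l x = u x) \<and> (\<forall>x\<in>?K. p (l x) = v x)"
    using U0 by simp
qed

text \<open>
For \<open>n = 0\<close> the boundary is empty, and what is needed is surjectivity on points: it follows from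
surjectivity on path components by lifting a path.
\<close>

lemma acyclic_fibration_lifts_cube:
  assumes S: "Serre_fibration E B p" and W: "weak_homotopy_equivalence E B p"
  shows "lifts (cube n) (cube_boundary n) E B p"
proof (cases n)
  case (Suc m)
  obtain f g where "pair_homeo (disc_set m \<times> {0..1}) (cylinder_boundary m) (cube (Suc m)) (cube_boundary (Suc m)) f g"
    by (rule pair_homeo_cyl_cube)
  from lifts_pair_homeo[OF pair_homeo_sym[OF this] acyclic_fibration_lifts_cylinder[OF S W]]
  show ?thesis using Suc by simp
next
  case 0
  have c0: "cube n = {\<lambda>i. 0}" "cube_boundary n = {}" using 0 by (auto simp: cube_def cube_boundary_def)
  have d0: "disc_set 0 = {\<lambda>i. 0}" by (auto simp: disc_set_def norm2_def)
  show ?thesis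
    unfolding lifts_def c0
  proof (intro allI impI, elim conjE)
    fix u v assume v: "continuous_map (top_of_set {\<lambda>i::nat. 0::real}) B v"
    have "v (\<lambda>i. 0) \<in> topspace B" using v by (auto simp: continuous_map_def Pi_iff)
    then obtain x where x: "x \<in> topspace E" and "path_component_of B (p x) (v (\<lambda>i. 0))"
      using W unfolding weak_homotopy_equivalence_def by blast
    then obtain g where g: "continuous_map (top_of_set {0..1::real}) B g" "g 0 = p x" "g 1 = v (\<lambda>i. 0)"
      unfolding path_component_of_def pathin_def by blast
    have L: "lifts (disc_set 0 \<times> {0..1::real}) (disc_set 0 \<times> {0::real}) E B p"
      using S unfolding Serre_fibration_iff_lifts by blast
    have ux: "continuous_map (top_of_set (disc_set 0 \<times> {0::real})) E (\<lambda>z. x)" using x by simp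
    have vg: "continuous_map (top_of_set (disc_set 0 \<times> {0..1::real})) B (\<lambda>z. g (snd z))"
      by (rule continuous_map_top_of_set_compose[OF g(1) continuous_on_snd[OF continuous_on_id]]) auto
    have xg: "p x = g (snd z)" if "z \<in> disc_set 0 \<times> {0::real}" for z using that g by auto
    obtain k where k: "continuous_map (top_of_set (disc_set 0 \<times> {0..1::real})) E k"
        "\<And>z. z \<in> disc_set 0 \<times> {0::real} \<Longrightarrow> k z = x" "\<And>z. z \<in> disc_set 0 \<times> {0..1::real} \<Longrightarrow> p (k z) = g (snd z)"
      using liftsD[OF L ux vg xg] by metis
    have "k (\<lambda>i. 0, 1) \<in> topspace E" using k(1) by (auto simp: continuous_map_def Pi_iff d0)
    then show "\<exists>l. continuous_map (top_of_set {\<lambda>i::nat. 0::real}) E l \<and> (\<forall>x\<in>{}. l x = u x) \<and> (\<forall>x\<in>{\<lambda>i. 0}. p (l x) = v x)"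
      using k(3)[of "(\<lambda>i. 0, 1)"] g(3) by (intro exI[of _ "\<lambda>z. k (\<lambda>i. 0, 1)"]) (auto simp: d0)
  qed
qed

section \<open>Maps that lift cubes are acyclic Serre fibrations\<close>

text \<open>
A cube with an interval, relative to the base, is a retract of an open subset of the next cube
relative to the boundary: shrink the cylinder by the factor \<open>1/2\<close> and place it on the bottom face, so that
it avoids the other faces, and retract the open set \<open>Q\<close> where the other faces are removed by
clamping coordinates. The lifting property for open subsets thus replaces the usual
decomposition of the inclusion of the base into two cell attachments.
\<close>

lemma lifts_cube_interval_base:
  assumes L: "\<And>d. lifts (cube d) (cube_boundary d) E B p"
  shows "lifts (cube n \<times> {0..1::real}) (cube n \<times> {0::real}) E B p"
proof -
  define Q where "Q = {z \<in> cube (Suc n). (\<forall>i<n. \<bar>z i\<bar> < 1) \<and> z n < 1}"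
  define s :: "(nat \<Rightarrow> real) \<times> real \<Rightarrow> nat \<Rightarrow> real" where "s = (\<lambda>z i. if i = n then snd z / 2 - 1 else fst z i / 2)"
  define cl :: "real \<Rightarrow> real" where "cl = (\<lambda>t. max (- 1) (min 1 t))"
  define r :: "(nat \<Rightarrow> real) \<Rightarrow> (nat \<Rightarrow> real) \<times> real" where
    "r = (\<lambda>z. (\<lambda>i. if i = n then 0 else cl (2 * z i), cl (2 * (z n + 1))))"
  have cl: "\<bar>cl t\<bar> \<le> 1" "\<bar>t\<bar> \<le> 1 \<Longrightarrow> cl t = t" "0 \<le> t \<Longrightarrow> 0 \<le> cl t" "cl 0 = 0" for t
    by (auto simp: cl_def)
  have "openin (top_of_set (cube (Suc n))) Q"
  proof -
    have "open {z :: nat \<Rightarrow> real. \<bar>z i\<bar> < 1}" for i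
      by (intro open_Collect_less continuous_on_rabs continuous_on_coordinate continuous_on_const)
    then have "open (\<Inter>i\<in>{..<n}. {z :: nat \<Rightarrow> real. \<bar>z i\<bar> < 1})" by (intro open_INT) auto
    moreover have "open {z :: nat \<Rightarrow> real. z n < 1}"
      by (intro open_Collect_less continuous_on_coordinate continuous_on_const)
    moreover have "Q = cube (Suc n) \<inter> ((\<Inter>i\<in>{..<n}. {z. \<bar>z i\<bar> < 1}) \<inter> {z. z n < 1})" by (auto simp: Q_def)
    ultimately show ?thesis by (auto simp: openin_open)
  qed
  from lifts_open_subset_cube[OF L this] have LQ: "lifts Q (Q \<inter> cube_boundary (Suc n)) E B p" .
  have sQ: "s z \<in> Q" if "z \<in> cube n \<times> {0..1::real}" for z
  proof -
    have "\<bar>fst z i\<bar> \<le> 1" if "i < n" for i using \<open>z \<in> _\<close> that by (auto simp: cube_def)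
    then have "\<bar>fst z i / 2\<bar> < 1" if "i < n" for i using that by fastforce
    moreover have "\<bar>snd z / 2 - 1\<bar> \<le> 1" "snd z / 2 - 1 < 1" using that by auto
    moreover have "fst z i = 0" if "i \<ge> n" for i using \<open>z \<in> _\<close> that by (auto simp: cube_def)
    ultimately show ?thesis by (auto simp: Q_def cube_def s_def less_Suc_eq intro: less_imp_le)
  qed
  have rK: "r z \<in> cube n \<times> {0..1::real}" if "z \<in> Q" for z
  proof -
    have "0 \<le> 2 * (z n + 1)" using that by (auto simp: Q_def cube_def abs_le_iff)
    then have "cl (2 * (z n + 1)) \<in> {0..1::real}" using cl(1)[of "2 * (z n + 1)"] cl(3) by auto
    moreover have "(\<lambda>i. if i = n then 0 else cl (2 * z i)) \<in> cube n"
      using that cl by (auto simp: Q_def cube_def)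
    ultimately show ?thesis by (simp add: r_def)
  qed
  show ?thesis
  proof (rule lifts_retract[OF LQ])
    show "continuous_on (cube n \<times> {0..1::real}) s"
      unfolding s_def
    proof (rule continuous_on_funI)
      show "continuous_on (cube n \<times> {0..1::real}) (\<lambda>z. if i = n then snd z / 2 - 1 else fst z i / 2)" for i
        by (cases "i = n")
           (simp_all add: continuous_on_diff continuous_on_divide continuous_on_snd continuous_on_id continuous_on_app[OF continuous_on_fst_id])
    qed
    show "s ` (cube n \<times> {0..1::real}) \<subseteq> Q" using sQ by blast
    show "s ` (cube n \<times> {0::real}) \<subseteq> Q \<inter> cube_boundary (Suc n)"
    proof (rule image_subsetI)
      fix z assume "z \<in> cube n \<times> {0::real}"
      then have "s z \<in> Q" "s z n = - 1" using sQ[of z] by (auto simp: s_def)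
      then show "s z \<in> Q \<inter> cube_boundary (Suc n)" by (auto simp: Q_def cube_boundary_def)
    qed
    show "continuous_on Q r"
      unfolding r_def
    proof (rule continuous_on_Pair[OF continuous_on_funI])
      show "continuous_on Q (\<lambda>z. if i = n then 0 else cl (2 * z i))" for i
        by (cases "i = n") (auto simp: cl_def intro!: continuous_on_max continuous_on_min continuous_on_mult continuous_on_coordinate)
      show "continuous_on Q (\<lambda>z. cl (2 * (z n + 1)))"
        by (auto simp: cl_def intro!: continuous_on_max continuous_on_min continuous_on_mult continuous_on_add continuous_on_coordinate)
    qed
    show "r ` Q \<subseteq> cube n \<times> {0..1::real}" using rK by blast
    show "r ` (Q \<inter> cube_boundary (Suc n)) \<subseteq> cube n \<times> {0::real}"
    proof (rule image_subsetI)
      fix z assume z: "z \<in> Q \<inter> cube_boundary (Suc n)"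
      then have "z n = - 1" by (auto simp: Q_def cube_boundary_def less_Suc_eq)
      then show "r z \<in> cube n \<times> {0::real}" using rK[of z] z cl by (auto simp: r_def)
    qed
    show "r (s z) = z" if "z \<in> cube n \<times> {0..1::real}" for z
    proof -
      obtain x t where z: "z = (x, t)" by (cases z)
      have xt: "x \<in> cube n" "t \<in> {0..1::real}" using that z by auto
      have "cl (x i) = x i" for i using xt(1) cl by (cases "i < n") (auto simp: cube_def)
      moreover have "x n = 0" using xt(1) by (simp add: cube_def)
      moreover have "cl t = t" using xt(2) cl(2)[of t] by auto
      ultimately show ?thesis by (auto simp: z r_def s_def fun_eq_iff)
    qed
  qed (auto simp: Q_def)
qed

text \<open>
The converse of the preceding section. Continuity of \<open>p\<close> is a separate hypothesis because the lifting property only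
sees the composites of \<open>p\<close> with maps out of cubes.
\<close>

lemma lifts_cube_imp_Serre_fibration:
  assumes L: "\<And>d. lifts (cube d) (cube_boundary d) E B p" and p: "continuous_map E B p"
  shows "Serre_fibration E B p"
  unfolding Serre_fibration_iff_lifts
proof (intro conjI allI p)
  fix n
  have "{0} \<subseteq> {0..1::real}" by simp
  from pair_homeo_times_interval[OF pair_homeo_empty[OF pair_homeo_disc_set_cube[of n]] this]
  show "lifts (disc_set n \<times> {0..1::real}) (disc_set n \<times> {0::real}) E B p"
    using lifts_pair_homeo lifts_cube_interval_base[OF L, of n] by fastforce
qed

text \<open>
Two maps on a disc that agree on the boundary, and a homotopy below between their images, form a
lifting problem for the boundary of the cylinder. This yields injectivity on homotopy groups and on
path components.
\<close>

lemma lift_homotopy_rel_boundary: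
  assumes L: "\<And>d. lifts (cube d) (cube_boundary d) E B p"
    and f: "continuous_map (top_of_set (disc_set m)) E f" "continuous_map (top_of_set (disc_set m)) E g"
      "\<And>y. y \<in> sphere_set m \<Longrightarrow> f y = c" "\<And>y. y \<in> sphere_set m \<Longrightarrow> g y = c" and c: "c \<in> topspace E"
    and h: "continuous_map (top_of_set (disc_set m \<times> {0..1::real})) B h"
      "\<And>y. y \<in> disc_set m \<Longrightarrow> h (y, 0) = p (f y)" "\<And>y. y \<in> disc_set m \<Longrightarrow> h (y, 1) = p (g y)"
      "\<And>y t. y \<in> sphere_set m \<Longrightarrow> t \<in> {0..1::real} \<Longrightarrow> h (y, t) = p c"
  obtains e where "continuous_map (top_of_set (disc_set m \<times> {0..1::real})) E e"
    "\<And>y. y \<in> disc_set m \<Longrightarrow> e (y, 0) = f y" "\<And>y. y \<in> disc_set m \<Longrightarrow> e (y, 1) = g y"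
    "\<And>y t. y \<in> sphere_set m \<Longrightarrow> t \<in> {0..1::real} \<Longrightarrow> e (y, t) = c"
proof -
  define u where "u = (\<lambda>z. if z \<in> disc_set m \<times> {0::real} \<union> sphere_set m \<times> {0..1::real} then (if z \<in> disc_set m \<times> {0::real} then f (fst z) else c) else g (fst z))"
  have fc: "continuous_map (top_of_set (disc_set m \<times> X)) E (\<lambda>z. f (fst z))" "continuous_map (top_of_set (disc_set m \<times> X)) E (\<lambda>z. g (fst z))" for X :: "real set"
    by (rule continuous_map_top_of_set_compose[OF f(1) continuous_on_fst_id]
             continuous_map_top_of_set_compose[OF f(2) continuous_on_fst_id]; force)+
  have J: "continuous_map (top_of_set (disc_set m \<times> {0::real} \<union> sphere_set m \<times> {0..1::real})) E (\<lambda>z. if z \<in> disc_set m \<times> {0::real} then f (fst z) else c)"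
  proof (rule continuous_map_top_of_set_union_closed[OF _ _ fc(1)])
    show "closedin (top_of_set (disc_set m \<times> {0::real} \<union> sphere_set m \<times> {0..1::real})) (disc_set m \<times> {0::real})"
      "closedin (top_of_set (disc_set m \<times> {0::real} \<union> sphere_set m \<times> {0..1::real})) (sphere_set m \<times> {0..1::real})"
      using closed_disc_set[of m] closed_sphere_set[of m] by (auto intro!: closed_subset closed_Times)
  qed (use c f(3) in auto)
  have u: "continuous_map (top_of_set (cylinder_boundary m)) E u"
    unfolding cylinder_boundary_eq u_def
  proof (rule continuous_map_top_of_set_union_closed[OF _ _ J fc(2)])
    show "closedin (top_of_set ((disc_set m \<times> {0::real} \<union> sphere_set m \<times> {0..1::real}) \<union> disc_set m \<times> {1})) (disc_set m \<times> {0::real} \<union> sphere_set m \<times> {0..1::real})"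
      "closedin (top_of_set ((disc_set m \<times> {0::real} \<union> sphere_set m \<times> {0..1::real}) \<union> disc_set m \<times> {1})) (disc_set m \<times> {1::real})"
      using closed_disc_set[of m] closed_sphere_set[of m] by (auto intro!: closed_subset closed_Times closed_Un)
  qed (use f(4) in auto)
  have uh: "p (u z) = h z" if "z \<in> cylinder_boundary m" for z
    using that h(2-4) f(3,4) sphere_set_subset by (auto simp: cylinder_boundary_def u_def)
  obtain f' g' where "pair_homeo (disc_set m \<times> {0..1::real}) (cylinder_boundary m) (cube (Suc m)) (cube_boundary (Suc m)) f' g'"
    by (rule pair_homeo_cyl_cube)
  from lifts_pair_homeo[OF this L] have "lifts (disc_set m \<times> {0..1::real}) (cylinder_boundary m) E B p" .
  from liftsD[OF this u h(1) uh]
  obtain e where e: "continuous_map (top_of_set (disc_set m \<times> {0..1::real})) E e" "\<And>z. z \<in> cylinder_boundary m \<Longrightarrow> e z = u z"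
    by metis
  show thesis
  proof (rule that[OF e(1)])
    show "e (y, 0) = f y" if "y \<in> disc_set m" for y using e(2)[of "(y, 0)"] that by (simp add: cylinder_boundary_def u_def)
    show "e (y, 1) = g y" if "y \<in> disc_set m" for y using e(2)[of "(y, 1)"] that f(4)[of y] by (auto simp: cylinder_boundary_def u_def)
    show "e (y, t) = c" if "y \<in> sphere_set m" "t \<in> {0..1::real}" for y t
      using e(2)[of "(y, t)"] that f(3)[of y] by (auto simp: cylinder_boundary_def u_def)
  qed
qed

text \<open>
Injectivity is lifting of homotopies relative to the boundary, and surjectivity is lifting over discs with
constant value on the boundary.
\<close>

lemma lifts_cube_imp_weak_homotopy_equivalence:
  assumes L: "\<And>d. lifts (cube d) (cube_boundary d) E B p" and p: "continuous_map E B p"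
  shows "weak_homotopy_equivalence E B p"
proof -
  have d0: "disc_set 0 = {\<lambda>i. 0}" "sphere_set 0 = {}" by (auto simp: disc_set_def sphere_set_def norm2_def)
  have swap: "continuous_on X (\<lambda>z. (snd z, fst z))" for X :: "('s::topological_space \<times> 't::topological_space) set"
    by (intro continuous_on_Pair continuous_on_fst_id continuous_on_snd[OF continuous_on_id])
  have inj0: "path_component_of E x x'" if x: "x \<in> topspace E" "x' \<in> topspace E" and "path_component_of B (p x) (p x')" for x x'
  proof -
    obtain g where g: "continuous_map (top_of_set {0..1::real}) B g" "g 0 = p x" "g 1 = p x'"
      using \<open>path_component_of B (p x) (p x')\<close> unfolding path_component_of_def pathin_def by blast
    have gs: "continuous_map (top_of_set (disc_set 0 \<times> {0..1::real})) B (\<lambda>z. g (snd z))"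
      by (rule continuous_map_top_of_set_compose[OF g(1) continuous_on_snd[OF continuous_on_id]]) auto
    obtain e where e: "continuous_map (top_of_set (disc_set 0 \<times> {0..1::real})) E e"
        "\<And>y. y \<in> disc_set 0 \<Longrightarrow> e (y, 0) = x" "\<And>y. y \<in> disc_set 0 \<Longrightarrow> e (y, 1) = x'"
      by (rule lift_homotopy_rel_boundary[OF L, of 0 "\<lambda>y. x" "\<lambda>y. x'" x "\<lambda>z. g (snd z)"]) (use x g gs d0 in auto)
    have "continuous_map (top_of_set {0..1::real}) E (\<lambda>t. e (\<lambda>i. 0, t))"
      by (rule continuous_map_top_of_set_compose[OF e(1) continuous_on_Pair[OF continuous_on_const continuous_on_id]]) (auto simp: d0)
    then show ?thesis
      unfolding path_component_of_def pathin_def using e(2,3) d0 by (intro exI[of _ "\<lambda>t. e (\<lambda>i. 0, t)"]) auto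
  qed
  have surj0: "\<exists>x\<in>topspace E. path_component_of B (p x) y" if y: "y \<in> topspace B" for y
  proof -
    have b0: "cube_boundary 0 = {}" by (simp add: cube_boundary_def)
    have L0: "lifts (cube 0) {} E B p" using L[of 0] b0 by simp
    have "\<exists>l. continuous_map (top_of_set (cube 0)) E l \<and> (\<forall>x\<in>{}. l x = undefined) \<and> (\<forall>x\<in>cube 0. p (l x) = y)"
      by (rule L0[unfolded lifts_def, THEN spec, THEN spec, THEN mp]) (use y in simp)
    then obtain l where l: "continuous_map (top_of_set (cube 0)) E l" "\<And>z. z \<in> cube 0 \<Longrightarrow> p (l z) = y"
      by blast
    have "(\<lambda>i. 0) \<in> cube 0" by (simp add: cube_def)
    then have "l (\<lambda>i. 0) \<in> topspace E" "p (l (\<lambda>i. 0)) = y" using l by (auto simp: continuous_map_def Pi_iff)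
    then show ?thesis using y by (auto intro!: bexI[of _ "l (\<lambda>i. 0)"] simp: path_component_of_refl)
  qed
  have inj: "spheroid_homotopic n E x f g"
    if x: "x \<in> topspace E" and fg: "spheroid n E x f" "spheroid n E x g" and hom: "spheroid_homotopic n B (p x) (p \<circ> f) (p \<circ> g)" for n x f g
  proof -
    obtain h where h: "continuous_map (prod_topology (top_of_set {0..1::real}) (disc n)) B h"
      "\<forall>y. h (0, y) = p (f y)" "\<forall>y. h (1, y) = p (g y)" "\<forall>t\<in>{0..1::real}. \<forall>s\<in>sphere_set n. h (t, s) = p x"
      using hom unfolding spheroid_homotopic_def homotopic_with_def disc_boundary_eq by auto
    have hc: "continuous_map (top_of_set (disc_set n \<times> {0..1::real})) B (\<lambda>z. h (snd z, fst z))"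
      using h(1) unfolding disc_eq prod_topology_subtopology_eu
      by (rule continuous_map_top_of_set_compose[OF _ swap]) auto
    obtain e where e: "continuous_map (top_of_set (disc_set n \<times> {0..1::real})) E e"
        "\<And>y. y \<in> disc_set n \<Longrightarrow> e (y, 0) = f y" "\<And>y. y \<in> disc_set n \<Longrightarrow> e (y, 1) = g y"
        "\<And>y t. y \<in> sphere_set n \<Longrightarrow> t \<in> {0..1::real} \<Longrightarrow> e (y, t) = x"
      by (rule lift_homotopy_rel_boundary[OF L, of n f g x "\<lambda>z. h (snd z, fst z)"])
         (use x h hc fg in \<open>auto simp: spheroid_def disc_eq disc_boundary_eq\<close>)
    show ?thesis
      unfolding spheroid_homotopic_def
    proof (subst homotopic_with)
      show "\<exists>h. continuous_map (prod_topology (top_of_set {0..1::real}) (disc n)) E h \<and>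
        (\<forall>x\<in>topspace (disc n). h (0, x) = f x) \<and> (\<forall>x\<in>topspace (disc n). h (1, x) = g x) \<and>
        (\<forall>t\<in>{0..1::real}. \<forall>s\<in>disc_boundary n. h (t, s) = x)"
      proof (intro exI conjI)
        show "continuous_map (prod_topology (top_of_set {0..1::real}) (disc n)) E (\<lambda>z. e (snd z, fst z))"
          unfolding disc_eq prod_topology_subtopology_eu
          by (rule continuous_map_top_of_set_compose[OF e(1) swap]) auto
      qed (use e in \<open>auto simp: disc_eq disc_boundary_eq\<close>)
    qed (use sphere_set_subset in \<open>auto simp: disc_eq disc_boundary_eq subset_iff\<close>)
  qed
  have surj: "\<exists>f. spheroid n E x f \<and> spheroid_homotopic n B (p x) (p \<circ> f) g"
    if x: "x \<in> topspace E" and g: "spheroid n B (p x) g" for n x g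
  proof -
    have "lifts (disc_set n) (sphere_set n) E B p" using lifts_pair_homeo[OF pair_homeo_disc_set_cube L] .
    moreover have "continuous_map (top_of_set (sphere_set n)) E (\<lambda>z. x)" using x by simp
    moreover have gc: "continuous_map (top_of_set (disc_set n)) B g" "\<And>y. y \<in> sphere_set n \<Longrightarrow> p x = g y"
      using g by (auto simp: spheroid_def disc_eq disc_boundary_eq)
    ultimately obtain l where l: "continuous_map (top_of_set (disc_set n)) E l" "\<And>z. z \<in> sphere_set n \<Longrightarrow> l z = x"
        "\<And>z. z \<in> disc_set n \<Longrightarrow> p (l z) = g z"
      by (rule liftsD) blast+
    have "spheroid_homotopic n B (p x) (p \<circ> l) g"
      unfolding spheroid_homotopic_def
    proof (subst homotopic_with)
      show "\<exists>h. continuous_map (prod_topology (top_of_set {0..1::real}) (disc n)) B h \<and>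
        (\<forall>y\<in>topspace (disc n). h (0, y) = (p \<circ> l) y) \<and> (\<forall>x\<in>topspace (disc n). h (1, x) = g x) \<and>
        (\<forall>t\<in>{0..1::real}. \<forall>s\<in>disc_boundary n. h (t, s) = p x)"
      proof (intro exI conjI)
        show "continuous_map (prod_topology (top_of_set {0..1::real}) (disc n)) B (\<lambda>z. g (snd z))"
          unfolding disc_eq prod_topology_subtopology_eu
          by (rule continuous_map_top_of_set_compose[OF gc(1) continuous_on_snd[OF continuous_on_id]]) auto
      qed (use l gc in \<open>auto simp: disc_eq disc_boundary_eq\<close>)
    qed (use sphere_set_subset in \<open>auto simp: disc_eq disc_boundary_eq subset_iff\<close>)
    moreover have "spheroid n E x l" using l by (auto simp: spheroid_def disc_eq disc_boundary_eq)
    ultimately show ?thesis by blast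
  qed
  show ?thesis
    unfolding weak_homotopy_equivalence_def using p inj0 surj0 inj surj by blast
qed

section \<open>Coincidence sets of maps from compact Hausdorff spaces\<close>

text \<open>
The topology transported along an injection; test spaces are moved with it to the carrier types that
the definitions prescribe.
\<close>

definition copy_topology :: "('a \<Rightarrow> 'b) \<Rightarrow> 'a topology \<Rightarrow> 'b topology" where
  "copy_topology \<phi> X = pullback_topology (\<phi> ` topspace X) (inv_into (topspace X) \<phi>) X"

lemma copy_topology:
  assumes "inj_on \<phi> (topspace X)"
  shows topspace_copy_topology: "topspace (copy_topology \<phi> X) = \<phi> ` topspace X"
    and continuous_map_copy_topology: "continuous_map X (copy_topology \<phi> X) \<phi>"
    and continuous_map_copy_topology_inv: "continuous_map (copy_topology \<phi> X) X (inv_into (topspace X) \<phi>)"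
proof -
  show "topspace (copy_topology \<phi> X) = \<phi> ` topspace X"
    using assms by (auto simp: copy_topology_def topspace_pullback_topology)
  have "continuous_map X X (inv_into (topspace X) \<phi> \<circ> \<phi>)"
    using assms by (intro continuous_map_eq[OF continuous_map_id]) auto
  then show "continuous_map X (copy_topology \<phi> X) \<phi>"
    unfolding copy_topology_def by (rule continuous_map_pullback') auto
  show "continuous_map (copy_topology \<phi> X) X (inv_into (topspace X) \<phi>)"
    using continuous_map_pullback[OF continuous_map_id, of "\<phi> ` topspace X" "inv_into (topspace X) \<phi>" X]
    by (simp add: copy_topology_def)
qed

lemma compact_Hausdorff_copy_topology:
  assumes "inj_on \<phi> (topspace X)" "compact_space X" "Hausdorff_space X"
  shows "compact_space (copy_topology \<phi> X)" "Hausdorff_space (copy_topology \<phi> X)"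
proof -
  have "homeomorphic_maps X (copy_topology \<phi> X) \<phi> (inv_into (topspace X) \<phi>)"
    using assms(1) by (auto simp: homeomorphic_maps_def copy_topology[OF assms(1)])
  then have "X homeomorphic_space copy_topology \<phi> X" by (auto simp: homeomorphic_space_def)
  then show "compact_space (copy_topology \<phi> X)" "Hausdorff_space (copy_topology \<phi> X)"
    using assms homeomorphic_compact_space homeomorphic_Hausdorff_space by blast+
qed

text \<open>
The definition of \<^const>\<open>weak_Hausdorff\<close> tests with spaces carried by \<open>'a set set\<close> only. Let \<open>D\<close>
contain one point of \<open>K\<close> over each point of the image. The closure of \<open>D\<close> is compact with the same image, and
since \<open>K\<close> is Hausdorff a point of this closure is determined by the traces on \<open>D\<close> of its neighbourhoods.
As \<open>u\<close> is injective on \<open>D\<close>, such a trace amounts to a subset of \<open>X\<close>, so the closure embeds into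
\<open>'a set set\<close>.
\<close>

lemma closedin_compact_image_weak_Hausdorff:
  fixes X :: "'a topology" and K :: "'k topology"
  assumes X: "weak_Hausdorff X" and K: "compact_space K" "Hausdorff_space K" and u: "continuous_map K X u"
  shows "closedin X (u ` topspace K)"
proof -
  \<comment> \<open>\<open>sel\<close> chooses the points of \<open>D\<close>, and \<open>\<phi>\<close> is the embedding into \<open>'a set set\<close>.\<close>
  define sel where "sel = (\<lambda>x. SOME k. k \<in> topspace K \<and> u k = x)"
  have sel: "sel x \<in> topspace K" "u (sel x) = x" if "x \<in> u ` topspace K" for x
  proof -
    have "\<exists>k. k \<in> topspace K \<and> u k = x" using that by auto
    from someI_ex[OF this] show "sel x \<in> topspace K" "u (sel x) = x" unfolding sel_def by blast+
  qed
  define D where "D = sel ` u ` topspace K"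
  have DK: "D \<subseteq> topspace K" using sel by (auto simp: D_def)
  have injD: "d = d'" if "d \<in> D" "d' \<in> D" "u d = u d'" for d d'
    using that sel unfolding D_def by (metis (no_types, lifting) imageE)
  define C where "C = K closure_of D"
  have DC: "D \<subseteq> C" using DK by (simp add: C_def closure_of_subset)
  have CK: "C \<subseteq> topspace K" by (simp add: C_def closure_of_subset_topspace)
  have uC: "u ` C = u ` topspace K"
  proof
    show "u ` topspace K \<subseteq> u ` C"
    proof
      fix x assume "x \<in> u ` topspace K"
      then have "u (sel x) = x" "sel x \<in> C" using sel DC by (auto simp: D_def)
      then show "x \<in> u ` C" by (metis imageI)
    qed
  qed (use CK in blast)
  define L where "L = subtopology K C"
  have topL: "topspace L = C" using CK by (auto simp: L_def)
  have L: "compact_space L" "Hausdorff_space L"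
    unfolding L_def C_def using K by (simp_all add: closedin_compact_space compact_space_subtopology Hausdorff_space_subtopology)
  define \<phi> where "\<phi> = (\<lambda>k. {u ` (D \<inter> N) |N. openin K N \<and> k \<in> N})"
  have "inj_on \<phi> C"
  proof (rule inj_onI, rule ccontr)
    fix k k' assume k: "k \<in> C" "k' \<in> C" and eq: "\<phi> k = \<phi> k'" and ne: "k \<noteq> k'"
    obtain N N' where N: "openin K N" "openin K N'" "k \<in> N" "k' \<in> N'" "disjnt N N'"
      using K(2) k ne CK unfolding Hausdorff_space_def by (metis subsetD)
    have "u ` (D \<inter> N) \<in> \<phi> k'" using eq N by (auto simp: \<phi>_def)
    then obtain M where M: "openin K M" "k' \<in> M" "u ` (D \<inter> N) = u ` (D \<inter> M)" by (auto simp: \<phi>_def)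
    then have DNM: "D \<inter> N = D \<inter> M" using injD by blast
    have "openin K (M \<inter> N')" "k' \<in> M \<inter> N'" using M N by auto
    then obtain d where "d \<in> D" "d \<in> M \<inter> N'" using k(2) unfolding C_def in_closure_of by blast
    then show False using DNM N(5) by (auto simp: disjnt_def)
  qed
  then have inj: "inj_on \<phi> (topspace L)" by (simp add: topL)
  have "continuous_map (copy_topology \<phi> L) X (u \<circ> inv_into (topspace L) \<phi>)"
    using continuous_map_copy_topology_inv[OF inj] continuous_map_from_subtopology[OF u, of C]
    unfolding L_def by (rule continuous_map_compose)
  then have "closedin X ((u \<circ> inv_into (topspace L) \<phi>) ` topspace (copy_topology \<phi> L))"
    using X compact_Hausdorff_copy_topology[OF inj L] unfolding weak_Hausdorff_def by blast
  moreover have "(u \<circ> inv_into (topspace L) \<phi>) ` topspace (copy_topology \<phi> L) = u ` topspace K"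
    using inj unfolding topspace_copy_topology[OF inj] image_comp[symmetric] uC[symmetric] topL[symmetric] by simp
  ultimately show ?thesis by simp
qed

lemma closedin_singleton_weak_Hausdorff:
  assumes "weak_Hausdorff X" "x \<in> topspace X"
  shows "closedin X {x}"
  using closedin_compact_image_weak_Hausdorff[OF assms(1), of "discrete_topology {()}" "\<lambda>_. x"] assms(2)
  by (simp add: compact_space_discrete_topology)

text \<open>
The map onto the image is closed, so disjoint neighbourhoods of two fibres descend to the image.
\<close>

lemma Hausdorff_compact_image_weak_Hausdorff:
  assumes X: "weak_Hausdorff X" and K: "compact_space K" "Hausdorff_space K" and u: "continuous_map K X u"
  shows "Hausdorff_space (subtopology X (u ` topspace K))"
  unfolding Hausdorff_space_def
proof (intro allI impI, elim conjE)
  let ?Q = "subtopology X (u ` topspace K)"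
  fix x y assume xy: "x \<in> topspace ?Q" "y \<in> topspace ?Q" "x \<noteq> y"
  have fib: "closedin K {k \<in> topspace K. u k \<in> {z}}" if "z \<in> topspace ?Q" for z
    using closedin_continuous_map_preimage[OF u closedin_singleton_weak_Hausdorff[OF X]] that by simp
  have "normal_space K" using K by (simp add: compact_Hausdorff_or_regular_imp_normal_space)
  moreover have "disjnt {k \<in> topspace K. u k \<in> {x}} {k \<in> topspace K. u k \<in> {y}}"
    using xy(3) by (auto simp: disjnt_def)
  ultimately have "\<exists>M N. openin K M \<and> openin K N \<and> {k \<in> topspace K. u k \<in> {x}} \<subseteq> M \<and>
      {k \<in> topspace K. u k \<in> {y}} \<subseteq> N \<and> disjnt M N"
    using fib[OF xy(1)] fib[OF xy(2)] unfolding normal_space_def by meson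
  then obtain M N where MN: "openin K M" "openin K N" "{k \<in> topspace K. u k \<in> {x}} \<subseteq> M"
      "{k \<in> topspace K. u k \<in> {y}} \<subseteq> N" "disjnt M N"
    by blast
  have op: "openin ?Q (topspace ?Q - u ` (topspace K - V))" if V: "openin K V" for V
  proof -
    have "closedin K (topspace K - V)" using V by blast
    then have "compact_space (subtopology K (topspace K - V))"
      using K by (intro compact_space_subtopology closedin_compact_space)
    then have "closedin X (u ` topspace (subtopology K (topspace K - V)))"
      using X K u by (intro closedin_compact_image_weak_Hausdorff continuous_map_from_subtopology Hausdorff_space_subtopology)
    then have "closedin ?Q (u ` (topspace K - V))"
      by (intro closedin_subset_topspace) (auto simp: Int_absorb1)
    then show ?thesis by blast
  qed
  show "\<exists>U V. openin ?Q U \<and> openin ?Q V \<and> x \<in> U \<and> y \<in> V \<and> disjnt U V"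
  proof (intro exI conjI)
    show "openin ?Q (topspace ?Q - u ` (topspace K - M))" "openin ?Q (topspace ?Q - u ` (topspace K - N))"
      using op MN by auto
    show "x \<in> topspace ?Q - u ` (topspace K - M)" "y \<in> topspace ?Q - u ` (topspace K - N)"
      using xy MN by auto
    show "disjnt (topspace ?Q - u ` (topspace K - M)) (topspace ?Q - u ` (topspace K - N))"
      using MN(5) unfolding disjnt_def by fastforce
  qed
qed

text \<open>
Over the closed set of those \<open>l\<close> whose value lies in the Hausdorff space \<open>f ` K\<close>, both maps go to that
space.
\<close>

lemma closedin_coincidence_weak_Hausdorff:
  assumes X: "weak_Hausdorff X" and K: "compact_space K" "Hausdorff_space K" and L: "compact_space L" "Hausdorff_space L"
    and f: "continuous_map K X f" and g: "continuous_map L X g"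
  shows "closedin (prod_topology K L) {z \<in> topspace K \<times> topspace L. f (fst z) = g (snd z)}"
proof -
  let ?Q = "subtopology X (f ` topspace K)"
  define M where "M = {l \<in> topspace L. g l \<in> f ` topspace K}"
  have M: "closedin L M"
    unfolding M_def by (rule closedin_continuous_map_preimage[OF g closedin_compact_image_weak_Hausdorff[OF X K f]])
  let ?P = "prod_topology K (subtopology L M)"
  have "continuous_map ?P X (f \<circ> fst)" "continuous_map ?P X (g \<circ> snd)"
    using f g by (auto intro: continuous_map_compose continuous_map_fst continuous_map_snd continuous_map_from_subtopology)
  then have "continuous_map ?P ?Q (f \<circ> fst)" "continuous_map ?P ?Q (g \<circ> snd)"
    by (auto simp: continuous_map_in_subtopology M_def)
  from closedin_continuous_maps_eq[OF Hausdorff_compact_image_weak_Hausdorff[OF X K f] this]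
  have "closedin ?P {z \<in> topspace ?P. f (fst z) = g (snd z)}" by simp
  then have "closedin (subtopology (prod_topology K L) (topspace K \<times> M)) {z \<in> topspace ?P. f (fst z) = g (snd z)}"
    unfolding subtopology_Times subtopology_topspace .
  moreover have "closedin (prod_topology K L) (topspace K \<times> M)" using M by (simp add: closedin_prod_Times_iff)
  ultimately have "closedin (prod_topology K L) {z \<in> topspace ?P. f (fst z) = g (snd z)}"
    by (rule closedin_trans_full)
  moreover have "{z \<in> topspace ?P. f (fst z) = g (snd z)} = {z \<in> topspace K \<times> topspace L. f (fst z) = g (snd z)}"
    unfolding M_def by (auto simp: rev_image_eqI)
  ultimately show ?thesis by simp
qed

text \<open>
A separation property of points that ensures closed coincidence sets and passes to mapping cylinders
with a coarse topology. There, points at different heights have disjoint neighbourhoods, and points at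
the same height are separated by a coordinate which is defined on an open set and has values in a space
with the same property. The type argument fixes the carrier of the weak Hausdorff spaces.
\<close>

definition separated_by_weak_Hausdorff :: "'x itself \<Rightarrow> 'z topology \<Rightarrow> bool" where
  "separated_by_weak_Hausdorff (_ :: 'x itself) Z \<longleftrightarrow>
     (\<forall>z\<in>topspace Z. \<forall>z'\<in>topspace Z. z \<noteq> z' \<longrightarrow>
        (\<exists>V V'. openin Z V \<and> openin Z V' \<and> z \<in> V \<and> z' \<in> V' \<and> disjnt V V') \<or>
        (\<exists>V (X :: 'x topology) h. openin Z V \<and> z \<in> V \<and> z' \<in> V \<and> weak_Hausdorff X \<and>
           continuous_map (subtopology Z V) X h \<and> h z \<noteq> h z'))"

lemma closed_neighbourhood_compact_Hausdorff:
  assumes "compact_space K" "Hausdorff_space K" "openin K W" "x \<in> W"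
  obtains V C where "openin K V" "closedin K C" "x \<in> V" "V \<subseteq> C" "C \<subseteq> W"
proof -
  have "neighbourhood_base_of (closedin K) K"
    using compact_Hausdorff_imp_regular_space[OF assms(1,2)] by (simp add: neighbourhood_base_of_closedin)
  then have "\<exists>V C. openin K V \<and> closedin K C \<and> x \<in> V \<and> V \<subseteq> C \<and> C \<subseteq> W"
    using assms(3,4) unfolding neighbourhood_base_of by simp
  then show ?thesis using that by blast
qed

text \<open>
The complement is open near \<open>(k, l)\<close>: in the case of a separating map \<open>h\<close> on an open set \<open>V\<close>, the
points \<open>k\<close> and \<open>l\<close> have compact neighbourhoods that are mapped into \<open>V\<close>, and there the coincidence set of
\<open>h \<circ> f\<close> and \<open>h \<circ> g\<close> is closed.
\<close>

lemma closedin_coincidence: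
  assumes Z: "separated_by_weak_Hausdorff TYPE('x) Z" and K: "compact_space K" "Hausdorff_space K"
    and L: "compact_space L" "Hausdorff_space L" and f: "continuous_map K Z f" and g: "continuous_map L Z g"
  shows "closedin (prod_topology K L) {z \<in> topspace K \<times> topspace L. f (fst z) = g (snd z)}" (is "closedin ?P ?E")
proof -
  have "openin ?P (topspace ?P - ?E)"
  proof (subst openin_subopen, intro ballI)
    fix z assume "z \<in> topspace ?P - ?E"
    then obtain k l where z: "z = (k, l)" "k \<in> topspace K" "l \<in> topspace L" "f k \<noteq> g l" by auto
    then have fg: "f k \<in> topspace Z" "g l \<in> topspace Z" using f g by (auto simp: continuous_map_def Pi_iff)
    have pre: "openin K {k \<in> topspace K. f k \<in> V}" "openin L {l \<in> topspace L. g l \<in> V}" if "openin Z V" for V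
      using openin_continuous_map_preimage[OF f that] openin_continuous_map_preimage[OF g that] .
    from Z[unfolded separated_by_weak_Hausdorff_def, rule_format, OF fg z(4)] consider
      V V' where "openin Z V" "openin Z V'" "f k \<in> V" "g l \<in> V'" "disjnt V V'"
    | V X h where "openin Z V" "f k \<in> V" "g l \<in> V" "weak_Hausdorff (X :: 'x topology)"
         "continuous_map (subtopology Z V) X h" "h (f k) \<noteq> h (g l)"
      by blast
    then show "\<exists>T. openin ?P T \<and> z \<in> T \<and> T \<subseteq> topspace ?P - ?E"
    proof cases
      case 1
      show ?thesis
      proof (intro exI conjI)
        show "openin ?P ({k \<in> topspace K. f k \<in> V} \<times> {l \<in> topspace L. g l \<in> V'})"
          using pre 1 by (simp add: openin_prod_Times_iff)
      qed (use z 1 in \<open>auto simp: disjnt_iff\<close>)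
    next
      case 2
      obtain A C where A: "openin K A" "closedin K C" "k \<in> A" "A \<subseteq> C" "C \<subseteq> {k \<in> topspace K. f k \<in> V}"
        using closed_neighbourhood_compact_Hausdorff[OF K pre(1)[OF 2(1)], of k] z 2 by blast
      obtain B D where B: "openin L B" "closedin L D" "l \<in> B" "B \<subseteq> D" "D \<subseteq> {l \<in> topspace L. g l \<in> V}"
        using closed_neighbourhood_compact_Hausdorff[OF L pre(2)[OF 2(1)], of l] z 2 by blast
      have top: "topspace (subtopology K C) = C" "topspace (subtopology L D) = D" using A B by auto
      have cK: "compact_space (subtopology K C)" "Hausdorff_space (subtopology K C)"
        and cL: "compact_space (subtopology L D)" "Hausdorff_space (subtopology L D)"
        using A B K L by (simp_all add: closedin_compact_space compact_space_subtopology Hausdorff_space_subtopology)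
      have "continuous_map (subtopology K C) (subtopology Z V) f" "continuous_map (subtopology L D) (subtopology Z V) g"
        using f g A(5) B(5) by (auto simp: continuous_map_in_subtopology continuous_map_from_subtopology)
      then have "continuous_map (subtopology K C) X (h \<circ> f)" "continuous_map (subtopology L D) X (h \<circ> g)"
        using 2(5) by (auto intro: continuous_map_compose)
      from closedin_coincidence_weak_Hausdorff[OF 2(4) cK cL this]
      have "closedin (subtopology ?P (C \<times> D)) {z \<in> C \<times> D. h (f (fst z)) = h (g (snd z))}"
        unfolding top subtopology_Times[symmetric] o_def .
      moreover have "closedin ?P (C \<times> D)" using A B by (simp add: closedin_prod_Times_iff)
      ultimately have E': "closedin ?P {z \<in> C \<times> D. h (f (fst z)) = h (g (snd z))}"
        using closedin_trans_full by blast
      show ?thesis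
      proof (intro exI conjI)
        show "openin ?P (A \<times> B - {z \<in> C \<times> D. h (f (fst z)) = h (g (snd z))})"
          using A B by (intro openin_diff E') (simp add: openin_prod_Times_iff)
        show "z \<in> A \<times> B - {z \<in> C \<times> D. h (f (fst z)) = h (g (snd z))}" using z A B 2 by auto
        show "A \<times> B - {z \<in> C \<times> D. h (f (fst z)) = h (g (snd z))} \<subseteq> topspace ?P - ?E"
          using A B by auto
      qed
    qed
  qed
  then show ?thesis by (auto simp: closedin_def)
qed

section \<open>Retopologizing a coarse space\<close>

text \<open>
The final topology for all maps from compact Hausdorff spaces. As in \<^const>\<open>compactly_generated\<close>, the test
spaces are carried by \<open>'z set set\<close>.
\<close>

definition k_topology :: "'z topology \<Rightarrow> 'z topology" where
  "k_topology Z = topology (\<lambda>S. S \<subseteq> topspace Z \<and>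
     (\<forall>(K :: 'z set set topology) u. compact_space K \<and> Hausdorff_space K \<and> continuous_map K Z u
        \<longrightarrow> openin K {k \<in> topspace K. u k \<in> S}))"

lemma openin_k_topology:
  fixes Z :: "'z topology"
  shows "openin (k_topology Z) S \<longleftrightarrow> S \<subseteq> topspace Z \<and>
     (\<forall>(K :: 'z set set topology) u. compact_space K \<and> Hausdorff_space K \<and> continuous_map K Z u
        \<longrightarrow> openin K {k \<in> topspace K. u k \<in> S})" (is "_ \<longleftrightarrow> ?P S")
proof -
  have "istopology ?P"
    unfolding istopology_def
  proof (intro conjI allI impI ballI)
    fix S T assume S: "?P S" and T: "?P T"
    show "S \<inter> T \<subseteq> topspace Z" using S by blast
    fix K :: "'z set set topology" and u assume K: "compact_space K \<and> Hausdorff_space K \<and> continuous_map K Z u"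
    have "{k \<in> topspace K. u k \<in> S \<inter> T} = {k \<in> topspace K. u k \<in> S} \<inter> {k \<in> topspace K. u k \<in> T}" by blast
    moreover have "openin K {k \<in> topspace K. u k \<in> S}" "openin K {k \<in> topspace K. u k \<in> T}" using K S T by blast+
    ultimately show "openin K {k \<in> topspace K. u k \<in> S \<inter> T}" by auto
  next
    fix \<S> assume S: "\<forall>S\<in>\<S>. ?P S"
    show "\<Union>\<S> \<subseteq> topspace Z" using S by blast
    fix K :: "'z set set topology" and u assume K: "compact_space K \<and> Hausdorff_space K \<and> continuous_map K Z u"
    have "{k \<in> topspace K. u k \<in> \<Union>\<S>} = (\<Union>S\<in>\<S>. {k \<in> topspace K. u k \<in> S})" by blast
    moreover have "openin K {k \<in> topspace K. u k \<in> S}" if "S \<in> \<S>" for S using K S that by blast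
    ultimately show "openin K {k \<in> topspace K. u k \<in> \<Union>\<S>}" by auto
  qed
  then show ?thesis unfolding k_topology_def by (simp add: topology_inverse')
qed

lemma openin_imp_openin_k_topology: "openin Z S \<Longrightarrow> openin (k_topology Z) S"
  unfolding openin_k_topology
proof (intro conjI allI impI, rule openin_subset, assumption, elim conjE)
  fix K :: "'a set set topology" and u assume "openin Z S" "continuous_map K Z u"
  then show "openin K {k \<in> topspace K. u k \<in> S}" by (intro openin_continuous_map_preimage)
qed

lemma topspace_k_topology [simp]: "topspace (k_topology Z) = topspace Z"
proof
  show "topspace (k_topology Z) \<subseteq> topspace Z"
    using openin_topspace[of "k_topology Z"] unfolding openin_k_topology by blast
  show "topspace Z \<subseteq> topspace (k_topology Z)"
    using openin_imp_openin_k_topology[OF openin_topspace] by (rule openin_subset)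
qed

lemma continuous_map_from_k_topology: "continuous_map Z W f \<Longrightarrow> continuous_map (k_topology Z) W f"
  unfolding continuous_map_def using openin_imp_openin_k_topology by fastforce

lemma continuous_map_into_k_topologyD: "continuous_map W (k_topology Z) f \<Longrightarrow> continuous_map W Z f"
  unfolding continuous_map_def by (simp add: openin_imp_openin_k_topology)

text \<open>
For a compact Hausdorff space \<open>K\<close> on an arbitrary type, the quotient of \<open>K\<close> by the fibres of \<open>u\<close>
is used as a test space: the fibre relation is closed, so the quotient is compact Hausdorff, and its points
are points of \<open>Z\<close>.
\<close>

lemma continuous_map_compact_into_k_topology:
  fixes Z :: "'z topology" and K :: "'k topology"
  assumes Z: "separated_by_weak_Hausdorff TYPE('x) Z" and K: "compact_space K" "Hausdorff_space K"
    and u: "continuous_map K Z u"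
  shows "continuous_map K (k_topology Z) u"
proof -
  have uZ: "u ` topspace K \<subseteq> topspace Z" using u by (auto simp: continuous_map_def)
  \<comment> \<open>\<open>Q\<close> is the image of \<open>u\<close> with the quotient topology.\<close>
  define Q where "Q = topology (\<lambda>S. S \<subseteq> u ` topspace K \<and> openin K {k \<in> topspace K. u k \<in> S})"
  have opQ: "openin Q S \<longleftrightarrow> S \<subseteq> u ` topspace K \<and> openin K {k \<in> topspace K. u k \<in> S}" for S
  proof -
    have "istopology (\<lambda>S. S \<subseteq> u ` topspace K \<and> openin K {k \<in> topspace K. u k \<in> S})"
      unfolding istopology_def
    proof (intro conjI allI impI ballI)
      fix S T assume S: "S \<subseteq> u ` topspace K \<and> openin K {k \<in> topspace K. u k \<in> S}"
        and T: "T \<subseteq> u ` topspace K \<and> openin K {k \<in> topspace K. u k \<in> T}"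
      show "S \<inter> T \<subseteq> u ` topspace K" using S by blast
      have "{k \<in> topspace K. u k \<in> S \<inter> T} = {k \<in> topspace K. u k \<in> S} \<inter> {k \<in> topspace K. u k \<in> T}" by blast
      then show "openin K {k \<in> topspace K. u k \<in> S \<inter> T}" using S T by auto
    next
      fix \<S> assume S: "\<forall>S\<in>\<S>. S \<subseteq> u ` topspace K \<and> openin K {k \<in> topspace K. u k \<in> S}"
      show "\<Union>\<S> \<subseteq> u ` topspace K" using S by blast
      have "{k \<in> topspace K. u k \<in> \<Union>\<S>} = (\<Union>S\<in>\<S>. {k \<in> topspace K. u k \<in> S})" by blast
      then show "openin K {k \<in> topspace K. u k \<in> \<Union>\<S>}" using S by auto
    qed
    then show ?thesis unfolding Q_def by (simp add: topology_inverse')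
  qed
  have topQ: "topspace Q = u ` topspace K"
  proof
    show "topspace Q \<subseteq> u ` topspace K" using openin_topspace[of Q] unfolding opQ by blast
    have "{k \<in> topspace K. u k \<in> u ` topspace K} = topspace K" by blast
    then have "openin Q (u ` topspace K)" unfolding opQ by simp
    then show "u ` topspace K \<subseteq> topspace Q" by (rule openin_subset)
  qed
  have uQ: "continuous_map K Q u"
    unfolding continuous_map_def using topQ opQ by auto
  have clQ: "closedin Q S" if "S \<subseteq> u ` topspace K" "closedin K {k \<in> topspace K. u k \<in> S}" for S
  proof -
    have "{k \<in> topspace K. u k \<in> topspace Q - S} = topspace K - {k \<in> topspace K. u k \<in> S}" by (auto simp: topQ)
    then show ?thesis using that unfolding closedin_def[of Q] opQ topQ by auto
  qed
  have "closed_map K Q u"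
    unfolding closed_map_def
  proof (intro allI impI)
    fix C assume C: "closedin K C"
    \<comment> \<open>The saturation of \<open>C\<close> is the projection of a closed subset of \<open>K \<times> K\<close>.\<close>
    let ?E = "{z \<in> topspace K \<times> topspace K. u (fst z) = u (snd z)}"
    have "closedin (prod_topology K K) (?E \<inter> C \<times> topspace K)"
      using closedin_coincidence[OF Z K K u u] C by (intro closedin_Int) (simp_all add: closedin_prod_Times_iff)
    then have "closedin K (snd ` (?E \<inter> C \<times> topspace K))"
      using closed_map_snd[OF K(1)] unfolding closed_map_def by blast
    moreover have "snd ` (?E \<inter> C \<times> topspace K) = {k \<in> topspace K. u k \<in> u ` C}"
    proof (intro equalityI subsetI)
      fix k assume "k \<in> snd ` (?E \<inter> C \<times> topspace K)"
      then obtain c where "c \<in> C" "k \<in> topspace K" "u c = u k" by auto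
      then show "k \<in> {k \<in> topspace K. u k \<in> u ` C}" using image_eqI[of "u k" u c C] by auto
    next
      fix k assume "k \<in> {k \<in> topspace K. u k \<in> u ` C}"
      then obtain c where "c \<in> C" "k \<in> topspace K" "u k = u c" by auto
      then have "(c, k) \<in> ?E \<inter> C \<times> topspace K" using closedin_subset[OF C] by auto
      then show "k \<in> snd ` (?E \<inter> C \<times> topspace K)" by (rule image_eqI[rotated]) simp
    qed
    ultimately show "closedin Q (u ` C)" using closedin_subset[OF C] by (intro clQ) auto
  qed
  then have "normal_space Q"
    using K uQ topQ by (intro normal_space_continuous_closed_map_image[of K Q u] compact_Hausdorff_or_regular_imp_normal_space) auto
  moreover have "t1_space Q"
  proof -
    have "closedin Q {q}" if "q \<in> topspace Q" for q
    proof -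
      obtain k where k: "k \<in> topspace K" "q = u k" using \<open>q \<in> _\<close> topQ by auto
      then have "closedin K {k}" using K(2) by (simp add: closedin_Hausdorff_singleton)
      then have "closedin Q (u ` {k})" using \<open>closed_map K Q u\<close> unfolding closed_map_def by blast
      then show ?thesis using k by simp
    qed
    then show ?thesis by (simp add: t1_space_closedin_singleton)
  qed
  ultimately have HQ: "Hausdorff_space Q" by (rule normal_t1_imp_Hausdorff_space)
  have cQ: "compact_space Q"
    using image_compactin[of K "topspace K" Q u] K uQ unfolding compact_space_def topQ by simp
  define \<phi> where "\<phi> = (\<lambda>z::'z. {{z}})"
  have inj: "inj_on \<phi> (topspace Q)" by (auto simp: \<phi>_def inj_on_def)
  have QZ: "continuous_map Q Z (\<lambda>q. q)"
    unfolding continuous_map_def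
  proof (intro conjI allI impI)
    show "(\<lambda>q. q) \<in> topspace Q \<rightarrow> topspace Z" using topQ uZ by auto
    fix W assume "openin Z W"
    then have "openin K {k \<in> topspace K. u k \<in> W}" by (rule openin_continuous_map_preimage[OF u])
    moreover have "{k \<in> topspace K. u k \<in> W} = {k \<in> topspace K. u k \<in> {q \<in> topspace Q. q \<in> W}}" by (auto simp: topQ)
    ultimately show "openin Q {q \<in> topspace Q. q \<in> W}" unfolding opQ by (auto simp: topQ)
  qed
  let ?C = "copy_topology \<phi> Q" and ?i = "inv_into (topspace Q) \<phi>"
  have iZ: "continuous_map ?C Z ?i"
    using continuous_map_compose[OF continuous_map_copy_topology_inv[OF inj] QZ] by (simp add: o_def)
  show ?thesis
    unfolding continuous_map_def
  proof (intro conjI allI impI)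
    show "u \<in> topspace K \<rightarrow> topspace (k_topology Z)" using uZ by auto
    fix S assume S: "openin (k_topology Z) S"
    have "openin ?C {c \<in> topspace ?C. ?i c \<in> S}"
      using S iZ compact_Hausdorff_copy_topology[OF inj cQ HQ] unfolding openin_k_topology by blast
    from openin_continuous_map_preimage[OF continuous_map_compose[OF uQ continuous_map_copy_topology[OF inj]] this]
    have "openin K {k \<in> topspace K. (\<phi> \<circ> u) k \<in> {c \<in> topspace ?C. ?i c \<in> S}}" .
    moreover have "{k \<in> topspace K. (\<phi> \<circ> u) k \<in> {c \<in> topspace ?C. ?i c \<in> S}} = {k \<in> topspace K. u k \<in> S}"
      using inj by (auto simp: topspace_copy_topology[OF inj] topQ)
    ultimately show "openin K {k \<in> topspace K. u k \<in> S}" by simp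
  qed
qed

lemma continuous_map_into_k_topology:
  fixes Z :: "'z topology" and M :: "'m topology"
  assumes Z: "separated_by_weak_Hausdorff TYPE('x) Z" and M: "compactly_generated M" and f: "continuous_map M Z f"
  shows "continuous_map M (k_topology Z) f"
  unfolding continuous_map_closedin
proof (intro conjI allI impI)
  show "f \<in> topspace M \<rightarrow> topspace (k_topology Z)" using f by (auto simp: continuous_map_def)
  fix C assume C: "closedin (k_topology Z) C"
  have "closedin K {k \<in> topspace K. w k \<in> {m \<in> topspace M. f m \<in> C}}"
    if K: "compact_space K" "Hausdorff_space K" and w: "continuous_map K M w" for K :: "'m set set topology" and w
  proof -
    have "continuous_map K (k_topology Z) (f \<circ> w)"
      using continuous_map_compact_into_k_topology[OF Z K continuous_map_compose[OF w f]] .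
    from closedin_continuous_map_preimage[OF this C]
    have "closedin K {k \<in> topspace K. f (w k) \<in> C}" by simp
    moreover have "{k \<in> topspace K. f (w k) \<in> C} = {k \<in> topspace K. w k \<in> {m \<in> topspace M. f m \<in> C}}"
      using w by (auto simp: continuous_map_def)
    ultimately show ?thesis by simp
  qed
  then show "closedin M {m \<in> topspace M. f m \<in> C}"
    by (intro M[unfolded compactly_generated_def, rule_format]) auto
qed

text \<open>
Every map from a compact Hausdorff space into \<open>Z\<close> is continuous for the new topology, so the two have
the same test maps; this gives compact generation. The preimage of \<open>u K\<close> under a second test map \<open>g\<close> is the
projection of the coincidence set of \<open>u\<close> and \<open>g\<close>, hence closed; this gives weak Hausdorffness.
\<close>

lemma CGWH_k_topology:
  fixes Z :: "'z topology"
  assumes Z: "separated_by_weak_Hausdorff TYPE('x) Z"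
  shows "CGWH (k_topology Z)"
proof -
  have "compactly_generated (k_topology Z)"
    unfolding compactly_generated_def
  proof (intro allI impI)
    fix S assume S: "S \<subseteq> topspace (k_topology Z)"
      and t: "\<forall>(K :: 'z set set topology) u. compact_space K \<and> Hausdorff_space K \<and> continuous_map K (k_topology Z) u
           \<longrightarrow> closedin K {k \<in> topspace K. u k \<in> S}"
    have "openin (k_topology Z) (topspace Z - S)"
      unfolding openin_k_topology
    proof (intro conjI allI impI)
      fix K :: "'z set set topology" and u assume K: "compact_space K \<and> Hausdorff_space K \<and> continuous_map K Z u"
      then have u: "continuous_map K (k_topology Z) u"
        using continuous_map_compact_into_k_topology[OF Z] by blast
      then have "closedin K {k \<in> topspace K. u k \<in> S}" using t K by blast
      moreover have "{k \<in> topspace K. u k \<in> topspace Z - S} = topspace K - {k \<in> topspace K. u k \<in> S}"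
        using u by (auto simp: continuous_map_def)
      ultimately show "openin K {k \<in> topspace K. u k \<in> topspace Z - S}" by (auto simp: closedin_def)
    qed auto
    then show "closedin (k_topology Z) S" using S by (simp add: closedin_def)
  qed
  moreover have "weak_Hausdorff (k_topology Z)"
    unfolding weak_Hausdorff_def
  proof (intro allI impI, elim conjE)
    fix K :: "'z set set topology" and u
    assume K: "compact_space K" "Hausdorff_space K" and u: "continuous_map K (k_topology Z) u"
    have uZ: "continuous_map K Z u" by (rule continuous_map_into_k_topologyD[OF u])
    have "openin (k_topology Z) (topspace Z - u ` topspace K)"
      unfolding openin_k_topology
    proof (intro conjI allI impI, blast, elim conjE)
      fix L :: "'z set set topology" and g
      assume L: "compact_space L" "Hausdorff_space L" and g: "continuous_map L Z g"
      have "closedin L (snd ` {z \<in> topspace K \<times> topspace L. u (fst z) = g (snd z)})"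
        using closed_map_snd[OF K(1)] closedin_coincidence[OF Z K L uZ g] unfolding closed_map_def by blast
      moreover have "{l \<in> topspace L. g l \<in> topspace Z - u ` topspace K} =
          topspace L - snd ` {z \<in> topspace K \<times> topspace L. u (fst z) = g (snd z)}"
        using g by (auto simp: continuous_map_def image_iff)
      ultimately show "openin L {l \<in> topspace L. g l \<in> topspace Z - u ` topspace K}" by auto
    qed
    then show "closedin (k_topology Z) (u ` topspace K)"
      using uZ by (auto simp: closedin_def continuous_map_def)
  qed
  ultimately show ?thesis by (simp add: CGWH_def)
qed

text \<open>
The product with the new topology need not be a test object, but \<open>T\<close> is compact Hausdorff: if \<open>a g0 z0\<close> lies
in the open set \<open>S\<close>, then so does \<open>a g z0\<close> for all \<open>g\<close> in a compact neighbourhood \<open>N\<close> of \<open>g0\<close>, and the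
set \<open>O'\<close> of all \<open>z\<close> with \<open>a g z \<in> S\<close> for all \<open>g \<in> N\<close> is open, since its preimage in a test space \<open>K\<close> is
the complement of a projection along the compact space \<open>N\<close>.
\<close>

lemma continuous_action_k_topology:
  fixes Z :: "'z topology" and T :: "'g topology"
  assumes Z: "separated_by_weak_Hausdorff TYPE('x) Z" and T: "compact_space T" "Hausdorff_space T"
    and a: "continuous_map (prod_topology T Z) Z (\<lambda>(g, z). a g z)"
  shows "continuous_map (prod_topology T (k_topology Z)) (k_topology Z) (\<lambda>(g, z). a g z)"
  unfolding continuous_map_def
proof (intro conjI allI impI)
  have aZ: "a g z \<in> topspace Z" if "g \<in> topspace T" "z \<in> topspace Z" for g z
    using a that by (auto simp: continuous_map_def Pi_iff)
  then show "(\<lambda>(g, z). a g z) \<in> topspace (prod_topology T (k_topology Z)) \<rightarrow> topspace (k_topology Z)" by auto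
  fix S assume S: "openin (k_topology Z) S"
  show "openin (prod_topology T (k_topology Z)) {x \<in> topspace (prod_topology T (k_topology Z)). (case x of (g, z) \<Rightarrow> a g z) \<in> S}"
    unfolding openin_prod_topology_alt
  proof (intro allI impI)
    fix g0 z0 assume "(g0, z0) \<in> {x \<in> topspace (prod_topology T (k_topology Z)). (case x of (g, z) \<Rightarrow> a g z) \<in> S}"
    then have gz: "g0 \<in> topspace T" "z0 \<in> topspace Z" "a g0 z0 \<in> S" by auto
    have "continuous_map T Z (\<lambda>g. a g z0)"
      using continuous_map_compose[OF _ a, of T "\<lambda>g. (g, z0)"] gz by (simp add: o_def continuous_map_pairwise)
    from openin_continuous_map_preimage[OF continuous_map_compact_into_k_topology[OF Z T this] S]
    have "openin T {g \<in> topspace T. a g z0 \<in> S}" .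
    then obtain V N where N: "openin T V" "closedin T N" "g0 \<in> V" "V \<subseteq> N" "N \<subseteq> {g \<in> topspace T. a g z0 \<in> S}"
      using closed_neighbourhood_compact_Hausdorff[OF T] gz by (metis (no_types, lifting) mem_Collect_eq)
    define O' where "O' = {z \<in> topspace Z. \<forall>g\<in>N. a g z \<in> S}"
    have NT: "N \<subseteq> topspace T" using N(2) by (rule closedin_subset)
    have cN: "compact_space (subtopology T N)" "Hausdorff_space (subtopology T N)"
      using N T by (simp_all add: closedin_compact_space compact_space_subtopology Hausdorff_space_subtopology)
    have "openin (k_topology Z) O'"
      unfolding openin_k_topology
    proof (intro conjI allI impI, simp add: O'_def, elim conjE)
      fix K :: "'z set set topology" and u
      assume K: "compact_space K" "Hausdorff_space K" and u: "continuous_map K Z u"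
      let ?P = "prod_topology (subtopology T N) K"
      have "continuous_map ?P (prod_topology T Z) (\<lambda>x. (fst x, u (snd x)))"
        using u by (intro continuous_map_pairedI)
          (auto intro: continuous_map_from_subtopology continuous_map_into_fulltopology[of _ _ N] continuous_map_fst
             continuous_map_compose[of _ K snd _ u, unfolded o_def] continuous_map_snd)
      from continuous_map_compose[OF this a]
      have "continuous_map ?P Z (\<lambda>x. a (fst x) (u (snd x)))" by (simp add: o_def)
      moreover have "compact_space ?P" "Hausdorff_space ?P"
        using cN K by (simp_all add: compact_space_prod_topology Hausdorff_space_prod_topology)
      ultimately have "continuous_map ?P (k_topology Z) (\<lambda>x. a (fst x) (u (snd x)))"
        by (intro continuous_map_compact_into_k_topology[OF Z])
      from openin_continuous_map_preimage[OF this S]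
      have "closedin ?P (topspace ?P - {x \<in> topspace ?P. a (fst x) (u (snd x)) \<in> S})" by blast
      then have "closedin K (snd ` (topspace ?P - {x \<in> topspace ?P. a (fst x) (u (snd x)) \<in> S}))"
        using closed_map_snd[OF cN(1)] unfolding closed_map_def by blast
      moreover have "{k \<in> topspace K. u k \<in> O'} = topspace K - snd ` (topspace ?P - {x \<in> topspace ?P. a (fst x) (u (snd x)) \<in> S})"
      proof -
        have "k \<in> snd ` (topspace ?P - {x \<in> topspace ?P. a (fst x) (u (snd x)) \<in> S}) \<longleftrightarrow> (\<exists>g\<in>N. a g (u k) \<notin> S)"
          if "k \<in> topspace K" for k
          using that NT by (force simp: image_iff)
        moreover have "u k \<in> topspace Z" if "k \<in> topspace K" for k using u that by (auto simp: continuous_map_def)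
        ultimately show ?thesis unfolding O'_def by blast
      qed
      ultimately show "openin K {k \<in> topspace K. u k \<in> O'}" by auto
    qed
    moreover have "z0 \<in> O'" using gz N(5) by (auto simp: O'_def)
    moreover have "V \<times> O' \<subseteq> {x \<in> topspace (prod_topology T (k_topology Z)). (case x of (g, z) \<Rightarrow> a g z) \<in> S}"
      using N(4) NT by (auto simp: O'_def)
    ultimately show "\<exists>U W. openin T U \<and> openin (k_topology Z) W \<and> g0 \<in> U \<and> z0 \<in> W \<and>
        U \<times> W \<subseteq> {x \<in> topspace (prod_topology T (k_topology Z)). (case x of (g, z) \<Rightarrow> a g z) \<in> S}"
      using N by blast
  qed
qed

section \<open>Group actions on coarse spaces\<close>

text \<open>
Frees the action axioms from the restriction to the set acted upon and from the group of bijections.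
\<close>

lemma group_action_iff:
  assumes "group G"
  shows "group_action G E (\<lambda>g. restrict (a g) E) \<longleftrightarrow>
    (\<forall>g\<in>carrier G. \<forall>x\<in>E. a g x \<in> E) \<and> (\<forall>x\<in>E. a \<one>\<^bsub>G\<^esub> x = x) \<and>
    (\<forall>g\<in>carrier G. \<forall>h\<in>carrier G. \<forall>x\<in>E. a (g \<otimes>\<^bsub>G\<^esub> h) x = a g (a h x))" (is "?L \<longleftrightarrow> ?R")
proof
  assume L: ?L
  then interpret group_action G E "\<lambda>g. restrict (a g) E" .
  have cl: "a g x \<in> E" if "g \<in> carrier G" "x \<in> E" for g x
    using element_image[OF that refl] that by simp
  moreover have "a \<one>\<^bsub>G\<^esub> x = x" if "x \<in> E" for x
    using fun_cong[OF id_eq_one, of x] that by simp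
  moreover have "a (g \<otimes>\<^bsub>G\<^esub> h) x = a g (a h x)" if "g \<in> carrier G" "h \<in> carrier G" "x \<in> E" for g h x
    using composition_rule[OF that(3,1,2)] that cl by simp
  ultimately show ?R by blast
next
  assume R: ?R
  interpret group G by fact
  have bij: "restrict (a g) E \<in> Bij E" if g: "g \<in> carrier G" for g
  proof -
    have inv: "a (inv\<^bsub>G\<^esub> g) (a g x) = x" "a g (a (inv\<^bsub>G\<^esub> g) x) = x" if "x \<in> E" for x
      using R g that by (metis inv_closed l_inv, metis inv_closed r_inv)
    have "bij_betw (a g) E E"
      by (rule bij_betw_byWitness[where f'="a (inv\<^bsub>G\<^esub> g)"]) (use R g inv in auto)
    then show ?thesis by (simp add: Bij_def bij_betw_def inj_on_restrict_eq)
  qed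
  have "group_hom G (BijGroup E) (\<lambda>g. restrict (a g) E)"
  proof (rule group_hom.intro[OF _ group_BijGroup])
    show "group_hom_axioms G (BijGroup E) (\<lambda>g. restrict (a g) E)"
    proof (rule group_hom_axioms.intro, rule homI)
      fix g h assume gh: "g \<in> carrier G" "h \<in> carrier G"
      show "restrict (a (g \<otimes>\<^bsub>G\<^esub> h)) E = restrict (a g) E \<otimes>\<^bsub>BijGroup E\<^esub> restrict (a h) E"
        using gh R bij by (auto simp: BijGroup_def compose_def fun_eq_iff)
    qed (use bij in \<open>simp add: BijGroup_def\<close>)
  qed (rule group_axioms)
  then show ?L by (rule group_action.intro)
qed

text \<open>
A \<open>G\<close>-space up to the topology, which is only required to become CGWH after \<^const>\<open>k_topology\<close> is
applied.
\<close>

definition coarse_G_space ::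
  "'x itself \<Rightarrow> ('g, 'm) monoid_scheme \<Rightarrow> 'g topology \<Rightarrow> ('g, 'z) gspace \<Rightarrow> bool" where
  "coarse_G_space x G T Z \<longleftrightarrow>
     separated_by_weak_Hausdorff x (space_of Z) \<and>
     (\<forall>g\<in>carrier G. \<forall>z\<in>points Z. act Z g z \<in> points Z) \<and> (\<forall>z\<in>points Z. act Z \<one>\<^bsub>G\<^esub> z = z) \<and>
     (\<forall>g\<in>carrier G. \<forall>h\<in>carrier G. \<forall>z\<in>points Z. act Z (g \<otimes>\<^bsub>G\<^esub> h) z = act Z g (act Z h z)) \<and>
     continuous_map (prod_topology T (space_of Z)) (space_of Z) (\<lambda>x. act Z (fst x) (snd x))"

lemma separated_weak_Hausdorff:
  assumes "weak_Hausdorff (X :: 'x topology)"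
  shows "separated_by_weak_Hausdorff TYPE('x) X"
  unfolding separated_by_weak_Hausdorff_def
proof (intro ballI impI disjI2)
  fix z z' assume "z \<in> topspace X" "z' \<in> topspace X" "z \<noteq> z'"
  then show "\<exists>V (X' :: 'x topology) h. openin X V \<and> z \<in> V \<and> z' \<in> V \<and> weak_Hausdorff X' \<and>
      continuous_map (subtopology X V) X' h \<and> h z \<noteq> h z'"
    using assms by (intro exI[of _ "topspace X"] exI[of _ X] exI[of _ "\<lambda>x. x"]) auto
qed

lemma G_space_imp_coarse:
  fixes X :: "('g, 'x) gspace"
  assumes "group G" and "G_space G T X"
  shows "coarse_G_space TYPE('x) G T X"
  using assms(2) separated_weak_Hausdorff
  unfolding G_space_def coarse_G_space_def group_action_iff[OF assms(1)] CGWH_def case_prod_unfold by blast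

lemma G_space_k_topology:
  fixes Z :: "('g, 'z) gspace"
  assumes G: "group G" and T: "compact_space T" "Hausdorff_space T" and Z: "coarse_G_space TYPE('x) G T Z"
  shows "G_space G T (Z\<lparr>space_of := k_topology (space_of Z)\<rparr>)"
  using Z CGWH_k_topology[of "space_of Z", where 'x='x]
    continuous_action_k_topology[of "space_of Z" T "act Z", where 'x='x] T
  unfolding G_space_def coarse_G_space_def group_action_iff[OF G] case_prod_unfold
  by simp

text \<open>
How separation is inherited: two points are separated in \<open>Z\<close> if some map \<open>q\<close>, defined on an open set
that contains both, sends them to different points of a separated space.
\<close>

lemma separated_by_pullback:
  assumes F: "separated_by_weak_Hausdorff TYPE('x) F" and V: "openin Z V" "z \<in> V" "z' \<in> V"
    and q: "continuous_map (subtopology Z V) F q" "q z \<noteq> q z'"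
  shows "(\<exists>V V'. openin Z V \<and> openin Z V' \<and> z \<in> V \<and> z' \<in> V' \<and> disjnt V V') \<or>
        (\<exists>V (X :: 'x topology) h. openin Z V \<and> z \<in> V \<and> z' \<in> V \<and> weak_Hausdorff X \<and>
           continuous_map (subtopology Z V) X h \<and> h z \<noteq> h z')"
proof -
  have VZ: "V \<subseteq> topspace Z" using V(1) by (rule openin_subset)
  have qF: "q z \<in> topspace F" "q z' \<in> topspace F" using q V VZ by (auto simp: continuous_map_def Pi_iff)
  have pre: "openin Z {x \<in> V. q x \<in> W}" if "openin F W" for W
  proof -
    have "openin (subtopology Z V) {x \<in> topspace (subtopology Z V). q x \<in> W}"
      by (rule openin_continuous_map_preimage[OF q(1) that])
    then have "openin Z {x \<in> topspace (subtopology Z V). q x \<in> W}" using V(1) by (rule openin_trans_full)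
    moreover have "{x \<in> topspace (subtopology Z V). q x \<in> W} = {x \<in> V. q x \<in> W}" using VZ by auto
    ultimately show ?thesis by simp
  qed
  from F[unfolded separated_by_weak_Hausdorff_def, rule_format, OF qF q(2)]
  show ?thesis
  proof (elim disjE exE conjE)
    fix W W' assume W: "openin F W" "openin F W'" "q z \<in> W" "q z' \<in> W'" "disjnt W W'"
    show ?thesis
      using pre[OF W(1)] pre[OF W(2)] W V
      by (intro disjI1 exI[of _ "{x \<in> V. q x \<in> W}"] exI[of _ "{x \<in> V. q x \<in> W'}"]) (auto simp: disjnt_iff)
  next
    fix W h and X :: "'x topology"
    assume W: "openin F W" "q z \<in> W" "q z' \<in> W" "weak_Hausdorff X" "continuous_map (subtopology F W) X h" "h (q z) \<noteq> h (q z')"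
    have "continuous_map (subtopology Z {x \<in> V. q x \<in> W}) F q"
      using q(1) by (rule continuous_map_from_subtopology_mono) blast
    then have "continuous_map (subtopology Z {x \<in> V. q x \<in> W}) (subtopology F W) q"
      by (auto simp: continuous_map_in_subtopology)
    from continuous_map_compose[OF this W(5)]
    show ?thesis using pre[OF W(1)] W V
      by (intro disjI2 exI[of _ "{x \<in> V. q x \<in> W}"] exI[of _ X] exI[of _ "h \<circ> q"]) auto
  qed
qed

section \<open>Vertical paths\<close>

definition clamp01 :: "real \<Rightarrow> real" where
  "clamp01 r = max 0 (min 1 r)"

lemma clamp01 [simp]: "0 \<le> clamp01 r" "clamp01 r \<le> 1" "clamp01 0 = 0" "clamp01 1 = 1" "clamp01 (clamp01 r) = clamp01 r"
  by (auto simp: clamp01_def)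

lemma continuous_on_clamp01: "continuous_on S clamp01"
  unfolding clamp01_def by (intro continuous_on_max continuous_on_min continuous_on_const continuous_on_id)

text \<open>
Paths in the fibres of \<open>p\<close>. They are parametrised by \<open>\<real>\<close> and constant outside \<open>[0, 1]\<close>, so that equal
paths are equal functions and evaluation is total.
\<close>

definition vertical_paths :: "'x topology \<Rightarrow> ('x \<Rightarrow> 'y) \<Rightarrow> (real \<Rightarrow> 'x) set" where
  "vertical_paths X p = {\<gamma>. continuous_map euclideanreal X \<gamma> \<and> (\<forall>r. \<gamma> r = \<gamma> (clamp01 r)) \<and> (\<forall>r. p (\<gamma> r) = p (\<gamma> 0))}"

lemma vertical_pathsD:
  assumes "\<gamma> \<in> vertical_paths X p"
  shows "continuous_map euclideanreal X \<gamma>" "\<gamma> r \<in> topspace X" "\<gamma> r = \<gamma> (clamp01 r)" "p (\<gamma> r) = p (\<gamma> 0)"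
proof -
  show c: "continuous_map euclideanreal X \<gamma>" using assms by (simp add: vertical_paths_def)
  show "\<gamma> r \<in> topspace X" using c by (simp add: continuous_map_def Pi_iff)
  show "\<gamma> r = \<gamma> (clamp01 r)" using assms unfolding vertical_paths_def by blast
  show "p (\<gamma> r) = p (\<gamma> 0)" using assms unfolding vertical_paths_def by blast
qed

text \<open>
The compact-open topology; compact intervals suffice as test sets.
\<close>

definition path_topology :: "'x topology \<Rightarrow> ('x \<Rightarrow> 'y) \<Rightarrow> (real \<Rightarrow> 'x) topology" where
  "path_topology X p = topology_generated_by
     {{\<gamma> \<in> vertical_paths X p. \<gamma> ` {a..b} \<subseteq> W} |a b W. openin X W}"

lemma topspace_path_topology [simp]: "topspace (path_topology X p) = vertical_paths X p"
proof -
  have "vertical_paths X p = {\<gamma> \<in> vertical_paths X p. \<gamma> ` {0..1} \<subseteq> topspace X}"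
    by (auto simp: vertical_paths_def continuous_map_def)
  moreover have "openin X (topspace X)" by simp
  ultimately have "vertical_paths X p \<in> {{\<gamma> \<in> vertical_paths X p. \<gamma> ` {a..b} \<subseteq> W} |a b W. openin X W}" by blast
  then show ?thesis unfolding path_topology_def topology_generated_by_topspace by blast
qed

text \<open>
The exponential law for paths. It holds for every space \<open>M\<close> since \<open>\<real>\<close> is locally compact: one direction
shrinks to a small interval, the other one is the tube lemma.
\<close>

lemma continuous_map_into_path_topology_iff:
  "continuous_map M (path_topology X p) h \<longleftrightarrow>
     h \<in> topspace M \<rightarrow> vertical_paths X p \<and> continuous_map (prod_topology M euclideanreal) X (\<lambda>x. h (fst x) (snd x))"
  (is "?L \<longleftrightarrow> ?R")
proof
  assume L: ?L
  then have h: "h \<in> topspace M \<rightarrow> vertical_paths X p" by (simp add: continuous_map_def)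
  have hX: "h m r \<in> topspace X" if "m \<in> topspace M" for m r
    using vertical_pathsD(2)[of "h m"] h that by auto
  have "continuous_map (prod_topology M euclideanreal) X (\<lambda>x. h (fst x) (snd x))"
    unfolding continuous_map_def
  proof (intro conjI allI impI)
    show "(\<lambda>x. h (fst x) (snd x)) \<in> topspace (prod_topology M euclideanreal) \<rightarrow> topspace X" using hX by auto
    fix W assume W: "openin X W"
    show "openin (prod_topology M euclideanreal) {x \<in> topspace (prod_topology M euclideanreal). h (fst x) (snd x) \<in> W}"
      unfolding openin_prod_topology_alt
    proof (intro allI impI)
      fix m r assume "(m, r) \<in> {x \<in> topspace (prod_topology M euclideanreal). h (fst x) (snd x) \<in> W}"
      then have m: "m \<in> topspace M" "h m r \<in> W" by auto
      have "continuous_map euclideanreal X (h m)" using vertical_pathsD(1)[of "h m"] h m by auto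
      from openin_continuous_map_preimage[OF this W] have "open {s. h m s \<in> W}"
        by (simp add: open_openin[symmetric])
      then obtain e where e: "e > 0" "cball r e \<subseteq> {s. h m s \<in> W}" using m by (auto simp: open_contains_cball)
      have "openin (path_topology X p) {\<gamma> \<in> vertical_paths X p. \<gamma> ` {r - e..r + e} \<subseteq> W}"
        unfolding path_topology_def using W by (intro topology_generated_by_Basis) blast
      from openin_continuous_map_preimage[OF L this]
      have "openin M {m \<in> topspace M. h m \<in> {\<gamma> \<in> vertical_paths X p. \<gamma> ` {r - e..r + e} \<subseteq> W}}" .
      moreover have "m \<in> {m \<in> topspace M. h m \<in> {\<gamma> \<in> vertical_paths X p. \<gamma> ` {r - e..r + e} \<subseteq> W}}"
        using m h e(2) by (auto simp: cball_eq_atLeastAtMost)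
      moreover have "{m \<in> topspace M. h m \<in> {\<gamma> \<in> vertical_paths X p. \<gamma> ` {r - e..r + e} \<subseteq> W}} \<times> {r - e<..<r + e} \<subseteq>
          {x \<in> topspace (prod_topology M euclideanreal). h (fst x) (snd x) \<in> W}"
        by (auto simp: image_subset_iff)
      moreover have "openin euclideanreal {r - e<..<r + e}" "r \<in> {r - e<..<r + e}" using e(1) by (auto simp: open_openin[symmetric])
      ultimately show "\<exists>U V. openin M U \<and> openin euclideanreal V \<and> m \<in> U \<and> r \<in> V \<and>
          U \<times> V \<subseteq> {x \<in> topspace (prod_topology M euclideanreal). h (fst x) (snd x) \<in> W}" by blast
    qed
  qed
  with h show ?R by blast
next
  assume R: ?R
  then have h: "h \<in> topspace M \<rightarrow> vertical_paths X p" and c: "continuous_map (prod_topology M euclideanreal) X (\<lambda>x. h (fst x) (snd x))" by auto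
  show ?L
    unfolding path_topology_def
  proof (rule continuous_on_generated_topo)
    show "h ` topspace M \<subseteq> \<Union> {{\<gamma> \<in> vertical_paths X p. \<gamma> ` {a..b} \<subseteq> W} |a b W. openin X W}"
      using h topspace_path_topology[of X p] unfolding path_topology_def topology_generated_by_topspace by auto
    fix U assume "U \<in> {{\<gamma> \<in> vertical_paths X p. \<gamma> ` {a..b} \<subseteq> W} |a b W. openin X W}"
    then obtain a b W where U: "U = {\<gamma> \<in> vertical_paths X p. \<gamma> ` {a..b} \<subseteq> W}" and W: "openin X W" by blast
    have preW: "openin (prod_topology M euclideanreal) {x \<in> topspace (prod_topology M euclideanreal). h (fst x) (snd x) \<in> W}"
      by (rule openin_continuous_map_preimage[OF c W])
    show "openin M (h -` U \<inter> topspace M)"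
    proof (subst openin_subopen, intro ballI)
      fix m assume m: "m \<in> h -` U \<inter> topspace M"
      then have "{m} \<times> {a..b} \<subseteq> {x \<in> topspace (prod_topology M euclideanreal). h (fst x) (snd x) \<in> W}" by (auto simp: U)
      moreover have "compactin euclideanreal {a..b}" by (simp add: compactin_euclidean_iff)
      ultimately obtain N V where NV: "openin M N" "m \<in> N" "{a..b} \<subseteq> V"
          "N \<times> V \<subseteq> {x \<in> topspace (prod_topology M euclideanreal). h (fst x) (snd x) \<in> W}"
        using tube_lemma_right[OF preW, of "{a..b}" m] m by blast
      have N: "openin M N" "m \<in> N" "N \<times> {a..b} \<subseteq> {x \<in> topspace (prod_topology M euclideanreal). h (fst x) (snd x) \<in> W}"
        using NV(1,2) order_trans[OF Sigma_mono[OF subset_refl NV(3)] NV(4)] by blast+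
      have "N \<subseteq> h -` U \<inter> topspace M"
      proof
        fix n assume n: "n \<in> N"
        then have "n \<in> topspace M" using openin_subset[OF N(1)] by blast
        moreover have "h n r \<in> W" if "r \<in> {a..b}" for r
          using subsetD[OF N(3), of "(n, r)"] n that by simp
        ultimately show "n \<in> h -` U \<inter> topspace M" using h by (auto simp: U)
      qed
      then show "\<exists>N. openin M N \<and> m \<in> N \<and> N \<subseteq> h -` U \<inter> topspace M" using N by blast
    qed
  qed
qed

lemma continuous_map_path_eval:
  "continuous_map (prod_topology (path_topology X p) euclideanreal) X (\<lambda>x. fst x (snd x))"
  using continuous_map_into_path_topology_iff[of "path_topology X p" X p "\<lambda>x. x"] by simp

lemma continuous_map_path_eval_at: "continuous_map (path_topology X p) X (\<lambda>\<gamma>. \<gamma> r)"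
proof -
  have "continuous_map (path_topology X p) (prod_topology (path_topology X p) euclideanreal) (\<lambda>\<gamma>. (\<gamma>, r))"
    by (intro continuous_map_pairedI) auto
  from continuous_map_compose[OF this continuous_map_path_eval] show ?thesis by (simp add: o_def)
qed

lemma separated_path_topology:
  assumes "separated_by_weak_Hausdorff TYPE('x) X"
  shows "separated_by_weak_Hausdorff TYPE('x) (path_topology X p)"
  unfolding separated_by_weak_Hausdorff_def[of _ "path_topology X p"]
proof (intro ballI impI)
  fix \<gamma> \<gamma>' assume g: "\<gamma> \<in> topspace (path_topology X p)" "\<gamma>' \<in> topspace (path_topology X p)" "\<gamma> \<noteq> \<gamma>'"
  then obtain r where "\<gamma> r \<noteq> \<gamma>' r" by auto
  then show "(\<exists>V V'. openin (path_topology X p) V \<and> openin (path_topology X p) V' \<and> \<gamma> \<in> V \<and> \<gamma>' \<in> V' \<and> disjnt V V') \<or>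
        (\<exists>V (Y :: 'x topology) h. openin (path_topology X p) V \<and> \<gamma> \<in> V \<and> \<gamma>' \<in> V \<and> weak_Hausdorff Y \<and>
           continuous_map (subtopology (path_topology X p) V) Y h \<and> h \<gamma> \<noteq> h \<gamma>')"
    using g continuous_map_path_eval_at openin_topspace[of "path_topology X p"]
    by (intro separated_by_pullback[OF assms, where V="topspace (path_topology X p)" and q="\<lambda>\<gamma>. \<gamma> r"])
       (auto intro: continuous_map_from_subtopology)
qed

definition path_gspace :: "('g, 'x) gspace \<Rightarrow> ('x \<Rightarrow> 'y) \<Rightarrow> ('g, real \<Rightarrow> 'x) gspace" where
  "path_gspace X p = \<lparr>space_of = path_topology (space_of X) p, act = (\<lambda>g \<gamma> r. act X g (\<gamma> r))\<rparr>"

lemma coarse_G_space_path: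
  fixes X :: "('g, 'x) gspace" and Y :: "('g, 'y) gspace"
  assumes X: "coarse_G_space TYPE('x) G T X" and TG: "topspace T = carrier G" and p: "G_map G X Y p"
  shows "coarse_G_space TYPE('x) G T (path_gspace X p)"
proof -
  let ?P = "path_topology (space_of X) p"
  have a: "continuous_map (prod_topology T (space_of X)) (space_of X) (\<lambda>x. act X (fst x) (snd x))"
    using X by (simp add: coarse_G_space_def)
  have \<gamma>: "\<gamma> r \<in> points X" if "\<gamma> \<in> vertical_paths (space_of X) p" for \<gamma> r
    using vertical_pathsD(2)[OF that] .
  have cl: "(\<lambda>r. act X g (\<gamma> r)) \<in> vertical_paths (space_of X) p"
    if g: "g \<in> carrier G" and v: "\<gamma> \<in> vertical_paths (space_of X) p" for g \<gamma>
  proof -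
    have "continuous_map euclideanreal (prod_topology T (space_of X)) (\<lambda>r. (g, \<gamma> r))"
      using g v TG by (simp add: continuous_map_pairwise o_def vertical_paths_def)
    from continuous_map_compose[OF this a]
    have "continuous_map euclideanreal (space_of X) (\<lambda>r. act X g (\<gamma> r))" by (simp add: o_def)
    moreover have "p (act X g (\<gamma> r)) = p (act X g (\<gamma> 0))" for r
    proof -
      have "p (\<gamma> r) = p (\<gamma> 0)" using v by (simp add: vertical_paths_def)
      then show ?thesis using p g \<gamma>[OF v] by (simp add: G_map_def)
    qed
    moreover have "act X g (\<gamma> r) = act X g (\<gamma> (clamp01 r))" for r using v by (simp add: vertical_paths_def)
    ultimately show ?thesis unfolding vertical_paths_def by blast
  qed
  have "continuous_map (prod_topology (prod_topology T ?P) euclideanreal) (prod_topology T (space_of X))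
      (\<lambda>x. (fst (fst x), snd (fst x) (snd x)))"
  proof -
    have 1: "continuous_map (prod_topology (prod_topology T ?P) euclideanreal) T (\<lambda>x. fst (fst x))"
      using continuous_map_compose[OF continuous_map_fst continuous_map_fst] by (simp add: o_def)
    have 2: "continuous_map (prod_topology (prod_topology T ?P) euclideanreal) ?P (\<lambda>x. snd (fst x))"
      using continuous_map_compose[OF continuous_map_fst continuous_map_snd] by (simp add: o_def)
    have "continuous_map (prod_topology (prod_topology T ?P) euclideanreal) (prod_topology ?P euclideanreal) (\<lambda>x. (snd (fst x), snd x))"
      by (rule continuous_map_pairedI[OF 2 continuous_map_snd])
    from continuous_map_compose[OF this continuous_map_path_eval]
    have "continuous_map (prod_topology (prod_topology T ?P) euclideanreal) (space_of X) (\<lambda>x. snd (fst x) (snd x))"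
      by (simp add: o_def)
    with 1 show ?thesis by (rule continuous_map_pairedI)
  qed
  from continuous_map_compose[OF this a]
  have "continuous_map (prod_topology T ?P) ?P (\<lambda>x r. act X (fst x) (snd x r))"
    unfolding continuous_map_into_path_topology_iff using cl TG by (auto simp: o_def)
  moreover have "separated_by_weak_Hausdorff TYPE('x) ?P"
    using X by (intro separated_path_topology) (simp add: coarse_G_space_def)
  ultimately show ?thesis
    using X cl \<gamma> unfolding coarse_G_space_def path_gspace_def by (auto simp: fun_eq_iff)
qed

section \<open>Mapping cylinders\<close>

text \<open>
The mapping cylinder of \<open>f : E \<rightarrow> F\<close>, a copy of \<open>F\<close> at height \<open>0\<close> and one of \<open>E\<close> at each height \<open>t > 0\<close>. A point
also records its projection \<open>b\<close> to \<open>F\<close>; at height \<open>0\<close> there is no point of \<open>E\<close>, and the third component has a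
default value.
\<close>

definition cylinder_points :: "'f topology \<Rightarrow> 'e topology \<Rightarrow> ('e \<Rightarrow> 'f) \<Rightarrow> (real \<times> 'f \<times> 'e) set" where
  "cylinder_points F E f = {(t, b, e). 0 \<le> t \<and> t \<le> 1 \<and> b \<in> topspace F \<and>
     (if 0 < t then e \<in> topspace E \<and> f e = b else e = undefined)}"

text \<open>
The coarsest topology for which the height, the projection to \<open>F\<close>, and the point of \<open>E\<close> on the part of positive
height are continuous. Unlike for the quotient topology, maps into this cylinder have a simple description.
\<close>

definition coarse_cylinder :: "'f topology \<Rightarrow> 'e topology \<Rightarrow> ('e \<Rightarrow> 'f) \<Rightarrow> (real \<times> 'f \<times> 'e) topology" where
  "coarse_cylinder F E f = topology_generated_by
     ({{z \<in> cylinder_points F E f. fst z \<in> V} |V. open V} \<union>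
      {{z \<in> cylinder_points F E f. fst (snd z) \<in> W} |W. openin F W} \<union>
      {{z \<in> cylinder_points F E f. 0 < fst z \<and> snd (snd z) \<in> W} |W. openin E W})"

lemma topspace_coarse_cylinder [simp]: "topspace (coarse_cylinder F E f) = cylinder_points F E f"
proof -
  have "cylinder_points F E f = {z \<in> cylinder_points F E f. fst z \<in> UNIV}" by blast
  then have "cylinder_points F E f \<in> {{z \<in> cylinder_points F E f. fst z \<in> V} |V. open V}" using open_UNIV by blast
  then show ?thesis unfolding coarse_cylinder_def topology_generated_by_topspace by blast
qed

lemma continuous_map_into_cylinder_iff:
  "continuous_map M (coarse_cylinder F E f) h \<longleftrightarrow>
     h \<in> topspace M \<rightarrow> cylinder_points F E f \<and>
     continuous_map M euclideanreal (\<lambda>m. fst (h m)) \<and> continuous_map M F (\<lambda>m. fst (snd (h m))) \<and>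
     continuous_map (subtopology M {m. 0 < fst (h m)}) E (\<lambda>m. snd (snd (h m)))"
  (is "?L \<longleftrightarrow> ?R")
proof
  let ?C = "cylinder_points F E f"
  assume L: ?L
  then have h: "h \<in> topspace M \<rightarrow> ?C" by (simp add: continuous_map_def)
  have pre: "openin M {m \<in> topspace M. P (h m)}" if "openin (coarse_cylinder F E f) {z \<in> ?C. P z}" for P
  proof -
    have "openin M {m \<in> topspace M. h m \<in> {z \<in> ?C. P z}}" by (rule openin_continuous_map_preimage[OF L that])
    moreover have "{m \<in> topspace M. h m \<in> {z \<in> ?C. P z}} = {m \<in> topspace M. P (h m)}" using h by auto
    ultimately show ?thesis by simp
  qed
  have 1: "openin M {m \<in> topspace M. fst (h m) \<in> V}" if "open V" for V
    using that by (intro pre, unfold coarse_cylinder_def) (intro topology_generated_by_Basis, blast)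
  have 2: "openin M {m \<in> topspace M. fst (snd (h m)) \<in> W}" if "openin F W" for W
    using that by (intro pre, unfold coarse_cylinder_def) (intro topology_generated_by_Basis, blast)
  have 3: "openin M {m \<in> topspace M. 0 < fst (h m) \<and> snd (snd (h m)) \<in> W}" if "openin E W" for W
    using that by (intro pre, unfold coarse_cylinder_def) (intro topology_generated_by_Basis, blast)
  have hF: "fst (snd (h m)) \<in> topspace F" if "m \<in> topspace M" for m
    using h that by (force simp: cylinder_points_def Pi_iff)
  have hE: "snd (snd (h m)) \<in> topspace E" if "m \<in> topspace M" "0 < fst (h m)" for m
  proof -
    have "h m \<in> ?C" using h that by auto
    then show ?thesis using that(2) by (auto simp: cylinder_points_def split: if_splits)
  qed
  have "continuous_map (subtopology M {m. 0 < fst (h m)}) E (\<lambda>m. snd (snd (h m)))"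
    unfolding continuous_map_def
  proof (intro conjI allI impI)
    show "(\<lambda>m. snd (snd (h m))) \<in> topspace (subtopology M {m. 0 < fst (h m)}) \<rightarrow> topspace E" using hE by auto
    fix W assume W: "openin E W"
    have eq: "{m \<in> topspace (subtopology M {m. 0 < fst (h m)}). snd (snd (h m)) \<in> W} =
       {m \<in> topspace M. 0 < fst (h m) \<and> snd (snd (h m)) \<in> W} \<inter> {m. 0 < fst (h m)}" by auto
    show "openin (subtopology M {m. 0 < fst (h m)}) {m \<in> topspace (subtopology M {m. 0 < fst (h m)}). snd (snd (h m)) \<in> W}"
      unfolding eq by (rule openin_subtopology_Int[OF 3[OF W]])
  qed
  moreover have "continuous_map M euclideanreal (\<lambda>m. fst (h m))"
    unfolding continuous_map_def using 1 by (simp add: open_openin[symmetric])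
  moreover have "continuous_map M F (\<lambda>m. fst (snd (h m)))"
    unfolding continuous_map_def using 2 hF by (simp add: Pi_iff)
  ultimately show ?R using h by blast
next
  let ?C = "cylinder_points F E f"
  assume ?R
  then have h: "h \<in> topspace M \<rightarrow> ?C" and t: "continuous_map M euclideanreal (\<lambda>m. fst (h m))"
    and b: "continuous_map M F (\<lambda>m. fst (snd (h m)))"
    and e: "continuous_map (subtopology M {m. 0 < fst (h m)}) E (\<lambda>m. snd (snd (h m)))" by auto
  have pos: "openin M {m \<in> topspace M. fst (h m) \<in> V}" if "open V" for V
    using openin_continuous_map_preimage[OF t, of V] that by (simp add: open_openin[symmetric])
  show ?L
    unfolding coarse_cylinder_def
  proof (rule continuous_on_generated_topo)
    show "h ` topspace M \<subseteq> \<Union> ({{z \<in> ?C. fst z \<in> V} |V. open V} \<union> {{z \<in> ?C. fst (snd z) \<in> W} |W. openin F W} \<union>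
      {{z \<in> ?C. 0 < fst z \<and> snd (snd z) \<in> W} |W. openin E W})"
      using h topspace_coarse_cylinder[of F E f] unfolding coarse_cylinder_def topology_generated_by_topspace by auto
    fix U assume "U \<in> {{z \<in> ?C. fst z \<in> V} |V. open V} \<union> {{z \<in> ?C. fst (snd z) \<in> W} |W. openin F W} \<union>
      {{z \<in> ?C. 0 < fst z \<and> snd (snd z) \<in> W} |W. openin E W}"
    then consider V where "U = {z \<in> ?C. fst z \<in> V}" "open V" | W where "U = {z \<in> ?C. fst (snd z) \<in> W}" "openin F W"
      | W where "U = {z \<in> ?C. 0 < fst z \<and> snd (snd z) \<in> W}" "openin E W" by blast
    then show "openin M (h -` U \<inter> topspace M)"
    proof cases
      case 1
      have "h -` U \<inter> topspace M = {m \<in> topspace M. fst (h m) \<in> V}" using h 1(1) by auto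
      then show ?thesis using pos[OF 1(2)] by simp
    next
      case 2
      have "h -` U \<inter> topspace M = {m \<in> topspace M. fst (snd (h m)) \<in> W}" using h 2(1) by auto
      then show ?thesis using openin_continuous_map_preimage[OF b 2(2)] by simp
    next
      case 3
      have p: "openin M {m \<in> topspace M. fst (h m) \<in> {0<..}}" by (rule pos) simp
      have "{m \<in> topspace M. fst (h m) \<in> {0<..}} = topspace M \<inter> {m. 0 < fst (h m)}" by auto
      then have eq: "subtopology M {m. 0 < fst (h m)} = subtopology M {m \<in> topspace M. fst (h m) \<in> {0<..}}"
        using subtopology_restrict[of M "{m. 0 < fst (h m)}"] by simp
      have "openin M {m \<in> topspace (subtopology M {m. 0 < fst (h m)}). snd (snd (h m)) \<in> W}"
        by (rule openin_trans_full[OF openin_continuous_map_preimage[OF e 3(2), unfolded eq] p, folded eq])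
      moreover have "h -` U \<inter> topspace M = {m \<in> topspace (subtopology M {m. 0 < fst (h m)}). snd (snd (h m)) \<in> W}"
        using h 3(1) by auto
      ultimately show ?thesis by simp
    qed
  qed
qed

lemma cylinder_projections:
  shows continuous_map_cylinder_height: "continuous_map (coarse_cylinder F E f) euclideanreal fst"
    and continuous_map_cylinder_base: "continuous_map (coarse_cylinder F E f) F (\<lambda>z. fst (snd z))"
    and continuous_map_cylinder_top: "continuous_map (subtopology (coarse_cylinder F E f) {z. 0 < fst z}) E (\<lambda>z. snd (snd z))"
  using continuous_map_into_cylinder_iff[of "coarse_cylinder F E f" F E f "\<lambda>z. z"] by simp_all

lemma openin_cylinder_top: "openin (coarse_cylinder F E f) {z \<in> cylinder_points F E f. 0 < fst z}"
proof -
  have "openin euclideanreal {0<..}" by (simp add: open_openin[symmetric])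
  from openin_continuous_map_preimage[OF continuous_map_cylinder_height this]
  show ?thesis by simp
qed

text \<open>
Two different points differ in the height, in the projection to \<open>F\<close>, or in the point of \<open>E\<close>. The last
coordinate is defined on the open part of positive height only, which is why separation allows partial maps.
\<close>

lemma separated_coarse_cylinder:
  assumes F: "separated_by_weak_Hausdorff TYPE('x) F" and E: "separated_by_weak_Hausdorff TYPE('x) E"
  shows "separated_by_weak_Hausdorff TYPE('x) (coarse_cylinder F E f)"
  unfolding separated_by_weak_Hausdorff_def[of _ "coarse_cylinder F E f"]
proof (intro ballI impI)
  let ?Z = "coarse_cylinder F E f"
  fix z z' assume z: "z \<in> topspace ?Z" "z' \<in> topspace ?Z" "z \<noteq> z'"
  show "(\<exists>V V'. openin ?Z V \<and> openin ?Z V' \<and> z \<in> V \<and> z' \<in> V' \<and> disjnt V V') \<or>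
        (\<exists>V (X :: 'x topology) h. openin ?Z V \<and> z \<in> V \<and> z' \<in> V \<and> weak_Hausdorff X \<and>
           continuous_map (subtopology ?Z V) X h \<and> h z \<noteq> h z')"
  proof (cases "fst z = fst z'")
    case False
    then obtain U V where UV: "open U" "open V" "fst z \<in> U" "fst z' \<in> V" "U \<inter> V = {}"
      using hausdorff[of "fst z" "fst z'"] by blast
    have "openin ?Z {x \<in> topspace ?Z. fst x \<in> W}" if "open W" for W
      using openin_continuous_map_preimage[OF continuous_map_cylinder_height, of W] that by (simp add: open_openin[symmetric])
    then show ?thesis using UV z
      by (intro disjI1 exI[of _ "{x \<in> topspace ?Z. fst x \<in> U}"] exI[of _ "{x \<in> topspace ?Z. fst x \<in> V}"]) (auto simp: disjnt_iff)
  next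
    case t: True
    show ?thesis
    proof (cases "fst (snd z) = fst (snd z')")
      case False
      then show ?thesis using z continuous_map_cylinder_base openin_topspace[of ?Z]
        by (intro separated_by_pullback[OF F, where V="topspace ?Z" and q="\<lambda>z. fst (snd z)"])
          (auto intro: continuous_map_from_subtopology)
    next
      case True
      then have ne: "snd (snd z) \<noteq> snd (snd z')" using t z(3) by (simp add: prod_eq_iff)
      then have "0 < fst z" using z t by (auto simp: cylinder_points_def split: if_splits)
      then show ?thesis using z t ne
        by (intro separated_by_pullback[OF E openin_cylinder_top, where q="\<lambda>z. snd (snd z)"]
             continuous_map_from_subtopology_mono[OF continuous_map_cylinder_top]) auto
    qed
  qed
qed

text \<open>
The group acts on both coordinates and fixes the height; the default value at height \<open>0\<close> is
preserved explicitly.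
\<close>

definition cylinder_gspace :: "('g, 'f) gspace \<Rightarrow> ('g, 'e) gspace \<Rightarrow> ('e \<Rightarrow> 'f) \<Rightarrow> ('g, real \<times> 'f \<times> 'e) gspace" where
  "cylinder_gspace F E f = \<lparr>space_of = coarse_cylinder (space_of F) (space_of E) f,
     act = (\<lambda>g z. (fst z, act F g (fst (snd z)), if 0 < fst z then act E g (snd (snd z)) else undefined))\<rparr>"

lemma coarse_G_space_cylinder:
  fixes F :: "('g, 'f) gspace" and E :: "('g, 'e) gspace"
  assumes F: "coarse_G_space TYPE('x) G T F" and E: "coarse_G_space TYPE('x) G T E"
    and G: "group G" and TG: "topspace T = carrier G"
    and f: "\<And>g e. g \<in> carrier G \<Longrightarrow> e \<in> points E \<Longrightarrow> f (act E g e) = act F g (f e)"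
  shows "coarse_G_space TYPE('x) G T (cylinder_gspace F E f)"
proof -
  let ?Z = "coarse_cylinder (space_of F) (space_of E) f" and ?C = "cylinder_points (space_of F) (space_of E) f"
  let ?a = "\<lambda>g z. (fst z, act F g (fst (snd z)), if 0 < fst z then act E g (snd (snd z)) else undefined)"
  have aF: "continuous_map (prod_topology T (space_of F)) (space_of F) (\<lambda>x. act F (fst x) (snd x))"
    and aE: "continuous_map (prod_topology T (space_of E)) (space_of E) (\<lambda>x. act E (fst x) (snd x))"
    and clF: "\<And>g z. g \<in> carrier G \<Longrightarrow> z \<in> points F \<Longrightarrow> act F g z \<in> points F"
    and clE: "\<And>g z. g \<in> carrier G \<Longrightarrow> z \<in> points E \<Longrightarrow> act E g z \<in> points E"
    using F E by (auto simp: coarse_G_space_def)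
  have cl: "?a g z \<in> ?C" if "g \<in> carrier G" "z \<in> ?C" for g z
    using that clF clE f by (auto simp: cylinder_points_def split: if_splits)
  have ptE: "snd (snd z) \<in> points E" if "z \<in> ?C" "0 < fst z" for z
    using that by (auto simp: cylinder_points_def split: if_splits)
  have ptF: "fst (snd z) \<in> points F" if "z \<in> ?C" for z
    using that by (auto simp: cylinder_points_def)
  let ?P = "prod_topology T ?Z"
  have "continuous_map ?P ?Z (\<lambda>x. ?a (fst x) (snd x))"
    unfolding continuous_map_into_cylinder_iff
  proof (intro conjI)
    show "(\<lambda>x. ?a (fst x) (snd x)) \<in> topspace ?P \<rightarrow> ?C"
    proof
      fix x assume "x \<in> topspace ?P"
      then have "fst x \<in> carrier G" "snd x \<in> ?C" using TG by (simp_all add: mem_Times_iff)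
      then show "?a (fst x) (snd x) \<in> ?C" by (rule cl)
    qed
    have s: "continuous_map ?P ?Z snd" by (rule continuous_map_snd)
    from continuous_map_compose[OF s continuous_map_cylinder_height]
    show "continuous_map ?P euclideanreal (\<lambda>m. fst (?a (fst m) (snd m)))" by (simp add: o_def)
    have "continuous_map ?P (prod_topology T (space_of F)) (\<lambda>x. (fst x, fst (snd (snd x))))"
      using continuous_map_compose[OF s continuous_map_cylinder_base] by (intro continuous_map_pairedI continuous_map_fst) (simp add: o_def)
    from continuous_map_compose[OF this aF]
    show "continuous_map ?P (space_of F) (\<lambda>m. fst (snd (?a (fst m) (snd m))))" by (simp add: o_def)
    let ?S = "subtopology ?P {m. 0 < fst (snd m)}"
    have "continuous_map ?S (subtopology ?Z {z. 0 < fst z}) snd"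
      using s by (auto simp: continuous_map_in_subtopology continuous_map_from_subtopology)
    from continuous_map_compose[OF this continuous_map_cylinder_top]
    have "continuous_map ?S (prod_topology T (space_of E)) (\<lambda>x. (fst x, snd (snd (snd x))))"
      by (intro continuous_map_pairedI continuous_map_subtopology_fst) (simp add: o_def)
    from continuous_map_compose[OF this aE]
    have "continuous_map ?S (space_of E) (\<lambda>x. act E (fst x) (snd (snd (snd x))))" by (simp add: o_def)
    then have "continuous_map ?S (space_of E) (\<lambda>m. snd (snd (?a (fst m) (snd m))))"
      by (rule continuous_map_eq) auto
    then show "continuous_map (subtopology ?P {m. 0 < fst (?a (fst m) (snd m))}) (space_of E) (\<lambda>m. snd (snd (?a (fst m) (snd m))))"
      by (simp only: fst_conv)
  qed
  moreover have "separated_by_weak_Hausdorff TYPE('x) ?Z"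
    using F E by (intro separated_coarse_cylinder) (simp_all add: coarse_G_space_def)
  moreover have "?a \<one>\<^bsub>G\<^esub> z = z" if "z \<in> ?C" for z
    using that F E by (auto simp: coarse_G_space_def cylinder_points_def split: if_splits)
  moreover have "?a (g \<otimes>\<^bsub>G\<^esub> h) z = ?a g (?a h z)" if "g \<in> carrier G" "h \<in> carrier G" "z \<in> ?C" for g h z
    using F E ptF[OF that(3)] ptE[OF that(3)] that(1,2) by (simp add: coarse_G_space_def)
  ultimately show ?thesis using cl unfolding coarse_G_space_def cylinder_gspace_def by simp
qed

section \<open>The map of cylinders that controls pairs of lifts\<close>

text \<open>
A path is sent to its end point, and its starting point is sent down to \<open>Y\<close>. With \<open>p\<close> an acyclic
fibration this map resolves the choice of a homotopy between two lifts.
\<close>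

definition resolution_map :: "('x \<Rightarrow> 'y) \<Rightarrow> real \<times> 'x \<times> (real \<Rightarrow> 'x) \<Rightarrow> real \<times> 'y \<times> 'x" where
  "resolution_map p z = (fst z, p (fst (snd z)), if 0 < fst z then snd (snd z) 1 else undefined)"

text \<open>
Source and target of this map are the mapping cylinders of the starting point map of vertical paths
and of \<open>p\<close>.
\<close>

definition resolution_total :: "('g, 'x) gspace \<Rightarrow> ('x \<Rightarrow> 'y) \<Rightarrow> ('g, real \<times> 'x \<times> (real \<Rightarrow> 'x)) gspace" where
  "resolution_total X p = cylinder_gspace X (path_gspace X p) (\<lambda>\<gamma>. \<gamma> 0)"

definition resolution_base :: "('g, 'x) gspace \<Rightarrow> ('g, 'y) gspace \<Rightarrow> ('x \<Rightarrow> 'y) \<Rightarrow> ('g, real \<times> 'y \<times> 'x) gspace" where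
  "resolution_base X Y p = cylinder_gspace Y X p"

lemma G_map_resolution:
  assumes p: "G_map G X Y p"
  shows "G_map G (resolution_total X p) (resolution_base X Y p) (resolution_map p)"
  unfolding G_map_def
proof
  let ?P = "path_topology (space_of X) p"
  let ?Z = "coarse_cylinder (space_of X) ?P (\<lambda>\<gamma>. \<gamma> 0)"
  have pc: "continuous_map (space_of X) (space_of Y) p" using p by (simp add: G_map_def)
  have pt: "resolution_map p z \<in> cylinder_points (space_of Y) (space_of X) p" if "z \<in> cylinder_points (space_of X) ?P (\<lambda>\<gamma>. \<gamma> 0)" for z
  proof -
    have "snd (snd z) 1 \<in> points X" "p (snd (snd z) 1) = p (fst (snd z))" if "0 < fst z"
      using \<open>z \<in> _\<close> that vertical_pathsD(2,4)[of "snd (snd z)" "space_of X" p 1]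
      by (auto simp: cylinder_points_def split: if_splits)
    moreover have "p (fst (snd z)) \<in> points Y" using \<open>z \<in> _\<close> pc by (auto simp: cylinder_points_def continuous_map_def Pi_iff)
    ultimately show ?thesis using \<open>z \<in> _\<close> by (auto simp: resolution_map_def cylinder_points_def split: if_splits)
  qed
  have "continuous_map ?Z (coarse_cylinder (space_of Y) (space_of X) p) (resolution_map p)"
    unfolding continuous_map_into_cylinder_iff
  proof (intro conjI)
    show "resolution_map p \<in> topspace ?Z \<rightarrow> cylinder_points (space_of Y) (space_of X) p" using pt by auto
    show "continuous_map ?Z euclideanreal (\<lambda>m. fst (resolution_map p m))"
      using continuous_map_cylinder_height by (simp add: resolution_map_def)
    show "continuous_map ?Z (space_of Y) (\<lambda>m. fst (snd (resolution_map p m)))"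
      using continuous_map_compose[OF continuous_map_cylinder_base pc] by (simp add: resolution_map_def o_def)
    have "continuous_map (subtopology ?Z {z. 0 < fst z}) (space_of X) (\<lambda>z. snd (snd z) 1)"
      using continuous_map_compose[OF continuous_map_cylinder_top continuous_map_path_eval_at[of _ _ 1]] by (simp add: o_def)
    then have "continuous_map (subtopology ?Z {z. 0 < fst z}) (space_of X) (\<lambda>m. snd (snd (resolution_map p m)))"
      by (rule continuous_map_eq) (auto simp: resolution_map_def)
    then show "continuous_map (subtopology ?Z {m. 0 < fst (resolution_map p m)}) (space_of X) (\<lambda>m. snd (snd (resolution_map p m)))"
      by (simp add: resolution_map_def)
  qed
  then show "continuous_map (space_of (resolution_total X p)) (space_of (resolution_base X Y p)) (resolution_map p)"
    by (simp add: resolution_total_def resolution_base_def cylinder_gspace_def path_gspace_def)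
  show "\<forall>g\<in>carrier G. \<forall>x\<in>points (resolution_total X p).
     resolution_map p (act (resolution_total X p) g x) = act (resolution_base X Y p) g (resolution_map p x)"
    using p by (auto simp: resolution_total_def resolution_base_def cylinder_gspace_def path_gspace_def
        resolution_map_def G_map_def cylinder_points_def split: if_splits)
qed

lemma closed_cube_boundary: "closed (cube_boundary n)" and closed_cube: "closed (cube n)"
proof -
  have c: "closed {x :: nat \<Rightarrow> real. x i = 0}" for i
    by (intro closed_Collect_eq continuous_on_coordinate continuous_on_const)
  have "cube n = (\<Inter>i\<in>{n..}. {x. x i = 0}) \<inter> {x. max_norm n x \<le> 1}" by (auto simp: cube_eq_max_norm)
  moreover have "closed {x. max_norm n x \<le> 1}"
    by (intro closed_Collect_le continuous_on_max_norm continuous_on_const)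
  ultimately show "closed (cube n)" using c by (simp add: closed_Int closed_INT)
  have "cube_boundary n = (\<Inter>i\<in>{n..}. {x. x i = 0}) \<inter> {x. max_norm n x = 1}" by (auto simp: cube_boundary_eq_max_norm)
  moreover have "closed {x. max_norm n x = 1}"
    by (intro closed_Collect_eq continuous_on_max_norm continuous_on_const)
  ultimately show "closed (cube_boundary n)" using c by (simp add: closed_Int closed_INT)
qed

lemma pair_homeoD:
  assumes "pair_homeo K S K' S' f g"
  shows "continuous_on K f" "continuous_on K' g" "f ` K \<subseteq> K'" "g ` K' \<subseteq> K" "f ` S \<subseteq> S'" "g ` S' \<subseteq> S"
    and "\<And>x. x \<in> K \<Longrightarrow> g (f x) = x"
  using assms by (simp_all add: pair_homeo_def)

text \<open>
\<open>Q \<times> I\<close> corresponds to an open subset of the next cube under the homeomorphism of the cube with the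
cylinder on a cube.
\<close>

lemma lifts_open_times_interval:
  assumes L: "\<And>d. lifts (cube d) (cube_boundary d) E B p" and Q: "openin (top_of_set (cube n)) Q"
  shows "lifts (Q \<times> {0..1::real}) (Q \<times> {0, 1} \<union> (Q \<inter> cube_boundary n) \<times> {0..1}) E B p"
proof -
  let ?f = "\<lambda>(x, t::real). x(n := 2 * t - 1)" and ?g = "\<lambda>z. (z(n := 0), (z n + 1) / 2 :: real)"
  note h = pair_homeo_cube_Suc[of n]
  note f = pair_homeoD(1,3,5)[OF h] and g = pair_homeoD(2,4,6)[OF h] and gf = pair_homeoD(7)[OF h]
  have Qc: "Q \<subseteq> cube n" by (rule openin_imp_subset[OF Q])
  define R where "R = {x \<in> cube (Suc n). ?g x \<in> Q \<times> {0..1}}"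
  have "continuous_map (top_of_set (cube (Suc n))) (top_of_set (cube n \<times> {0..1})) ?g"
    using g by (auto simp: continuous_map_in_subtopology)
  moreover have "openin (top_of_set (cube n \<times> {0..1::real})) (Q \<times> {0..1})"
    unfolding prod_topology_subtopology_eu[symmetric] openin_prod_Times_iff using Q by auto
  ultimately have "openin (top_of_set (cube (Suc n))) R"
    using openin_continuous_map_preimage[of "top_of_set (cube (Suc n))" "top_of_set (cube n \<times> {0..1})" ?g "Q \<times> {0..1}"]
    by (simp add: R_def)
  from lifts_open_subset_cube[OF L this] have LR: "lifts R (R \<inter> cube_boundary (Suc n)) E B p" .
  have fR: "?f x \<in> R" if "x \<in> Q \<times> {0..1}" for x
  proof -
    have x: "x \<in> cube n \<times> {0..1}" using that Qc by auto
    then have "?f x \<in> cube (Suc n)" using f(2) by blast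
    moreover have "?g (?f x) \<in> Q \<times> {0..1}" unfolding gf[OF x] by (rule that)
    ultimately show ?thesis unfolding R_def by blast
  qed
  show ?thesis
  proof (rule lifts_retract[OF LR])
    show "continuous_on (Q \<times> {0..1}) ?f" using f(1) by (rule continuous_on_subset) (use Qc in auto)
    show "?f ` (Q \<times> {0..1}) \<subseteq> R" using fR by (rule image_subsetI)
    show "?f ` (Q \<times> {0, 1} \<union> (Q \<inter> cube_boundary n) \<times> {0..1}) \<subseteq> R \<inter> cube_boundary (Suc n)"
    proof (rule image_subsetI)
      fix x assume x: "x \<in> Q \<times> {0, 1} \<union> (Q \<inter> cube_boundary n) \<times> {0..1::real}"
      then have "x \<in> Q \<times> {0..1}" by auto
      moreover have "x \<in> cube n \<times> {0, 1} \<union> cube_boundary n \<times> {0..1}" using x Qc by auto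
      ultimately show "?f x \<in> R \<inter> cube_boundary (Suc n)" using fR f(3) by blast
    qed
    show "continuous_on R ?g" using g(1) by (rule continuous_on_subset) (simp add: R_def)
    show "?g ` R \<subseteq> Q \<times> {0..1}" unfolding R_def by blast
    show "?g ` (R \<inter> cube_boundary (Suc n)) \<subseteq> Q \<times> {0, 1} \<union> (Q \<inter> cube_boundary n) \<times> {0..1}"
    proof (rule image_subsetI)
      fix x assume "x \<in> R \<inter> cube_boundary (Suc n)"
      then have "?g x \<in> Q \<times> {0..1}" "?g x \<in> cube n \<times> {0, 1} \<union> cube_boundary n \<times> {0..1}"
        using g(3) unfolding R_def by blast+
      then show "?g x \<in> Q \<times> {0, 1} \<union> (Q \<inter> cube_boundary n) \<times> {0..1}" by blast
    qed
    show "?g (?f x) = x" if "x \<in> Q \<times> {0..1}" for x using gf that Qc by blast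
  qed auto
qed

text \<open>
Two lifts \<open>z\<close> and \<open>s\<close> of the same map over \<open>Q\<close>, and a homotopy \<open>\<gamma>\<close> between them on the boundary, combine to a lifting
problem over \<open>Q \<times> I\<close> whose solution is a homotopy on all of \<open>Q\<close>.
\<close>

lemma lifts_path_extension:
  fixes \<gamma> :: "(nat \<Rightarrow> real) \<Rightarrow> real \<Rightarrow> 'e"
  assumes L: "\<And>d. lifts (cube d) (cube_boundary d) E B p" and Q: "openin (top_of_set (cube n)) Q"
    and v: "continuous_map (top_of_set Q) B v"
    and z: "continuous_map (top_of_set Q) E z" "\<And>m. m \<in> Q \<Longrightarrow> p (z m) = v m"
    and s: "continuous_map (top_of_set Q) E s" "\<And>m. m \<in> Q \<Longrightarrow> p (s m) = v m"
    and \<gamma>: "continuous_map (top_of_set ((Q \<inter> cube_boundary n) \<times> {0..1})) E (\<lambda>x. \<gamma> (fst x) (snd x))"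
      "\<And>m r. m \<in> Q \<inter> cube_boundary n \<Longrightarrow> r \<in> {0..1} \<Longrightarrow> p (\<gamma> m r) = v m"
      "\<And>m. m \<in> Q \<inter> cube_boundary n \<Longrightarrow> \<gamma> m 0 = z m" "\<And>m. m \<in> Q \<inter> cube_boundary n \<Longrightarrow> \<gamma> m 1 = s m"
  obtains k where "continuous_map (top_of_set (Q \<times> {0..1::real})) E k" "\<And>m. m \<in> Q \<Longrightarrow> k (m, 0) = z m"
    "\<And>m. m \<in> Q \<Longrightarrow> k (m, 1) = s m" "\<And>m r. m \<in> Q \<inter> cube_boundary n \<Longrightarrow> r \<in> {0..1} \<Longrightarrow> k (m, r) = \<gamma> m r"
    "\<And>x. x \<in> Q \<times> {0..1} \<Longrightarrow> p (k x) = v (fst x)"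
proof -
  let ?Z = "Q \<times> {0::real}" and ?S = "Q \<times> {1::real}" and ?G = "(Q \<inter> cube_boundary n) \<times> {0..1::real}"
  define u where "u = (\<lambda>x. if x \<in> ?Z \<union> ?G then (if x \<in> ?Z then z (fst x) else \<gamma> (fst x) (snd x)) else s (fst x))"
  have fz: "continuous_map (top_of_set (Q \<times> A)) E (\<lambda>x. z (fst x))" "continuous_map (top_of_set (Q \<times> A)) E (\<lambda>x. s (fst x))"
    "continuous_map (top_of_set (Q \<times> A)) B (\<lambda>x. v (fst x))" for A :: "real set"
    by (rule continuous_map_top_of_set_compose[OF z(1) continuous_on_fst_id]
             continuous_map_top_of_set_compose[OF s(1) continuous_on_fst_id]
             continuous_map_top_of_set_compose[OF v continuous_on_fst_id]; force)+
  have cl: "closedin (top_of_set W) (W \<inter> F)" if "closed F" for W F :: "((nat \<Rightarrow> real) \<times> real) set"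
    using that by (rule closedin_closed_Int)
  have F: "closed (UNIV \<times> {0::real} :: ((nat \<Rightarrow> real) \<times> real) set)" "closed (UNIV \<times> {1::real} :: ((nat \<Rightarrow> real) \<times> real) set)"
    "closed (cube_boundary n \<times> (UNIV :: real set))" "closed ((UNIV \<times> {0::real}) \<union> (cube_boundary n \<times> (UNIV :: real set)))"
    using closed_cube_boundary[of n] by (auto intro!: closed_Times closed_Un)
  have 1: "continuous_map (top_of_set (?Z \<union> ?G)) E (\<lambda>x. if x \<in> ?Z then z (fst x) else \<gamma> (fst x) (snd x))"
  proof (rule continuous_map_top_of_set_union_closed[OF _ _ fz(1) \<gamma>(1)])
    have "(?Z \<union> ?G) \<inter> (UNIV \<times> {0}) = ?Z" "(?Z \<union> ?G) \<inter> (cube_boundary n \<times> UNIV) = ?G" by auto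
    then show "closedin (top_of_set (?Z \<union> ?G)) ?Z" "closedin (top_of_set (?Z \<union> ?G)) ?G"
      using cl[OF F(1), of "?Z \<union> ?G"] cl[OF F(3), of "?Z \<union> ?G"] by simp_all
  qed (use \<gamma>(3) in auto)
  have u: "continuous_map (top_of_set (?Z \<union> ?G \<union> ?S)) E u"
    unfolding u_def
  proof (rule continuous_map_top_of_set_union_closed[OF _ _ 1 fz(2)])
    have "(?Z \<union> ?G \<union> ?S) \<inter> ((UNIV \<times> {0}) \<union> (cube_boundary n \<times> UNIV)) = ?Z \<union> ?G" "(?Z \<union> ?G \<union> ?S) \<inter> (UNIV \<times> {1}) = ?S" by auto
    then show "closedin (top_of_set (?Z \<union> ?G \<union> ?S)) (?Z \<union> ?G)" "closedin (top_of_set (?Z \<union> ?G \<union> ?S)) ?S"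
      using cl[OF F(4), of "?Z \<union> ?G \<union> ?S"] cl[OF F(2), of "?Z \<union> ?G \<union> ?S"] by simp_all
  qed (use \<gamma>(4) in auto)
  have eq: "Q \<times> {0, 1} \<union> (Q \<inter> cube_boundary n) \<times> {0..1::real} = ?Z \<union> ?G \<union> ?S" by auto
  have uv: "p (u x) = v (fst x)" if "x \<in> ?Z \<union> ?G \<union> ?S" for x
    using that z(2) s(2) \<gamma>(2) by (auto simp: u_def)
  have "\<exists>k. continuous_map (top_of_set (Q \<times> {0..1::real})) E k \<and> (\<forall>x\<in>?Z \<union> ?G \<union> ?S. k x = u x) \<and>
      (\<forall>x\<in>Q \<times> {0..1::real}. p (k x) = v (fst x))"
    by (rule lifts_open_times_interval[OF L Q, unfolded eq, unfolded lifts_def, THEN spec, THEN spec, THEN mp])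
       (intro conjI u fz(3) ballI uv)
  then obtain k where k: "continuous_map (top_of_set (Q \<times> {0..1::real})) E k" "\<And>x. x \<in> ?Z \<union> ?G \<union> ?S \<Longrightarrow> k x = u x"
      "\<And>x. x \<in> Q \<times> {0..1::real} \<Longrightarrow> p (k x) = v (fst x)"
    by blast
  show thesis
  proof (rule that[OF k(1)])
    show "k (m, 0) = z m" if "m \<in> Q" for m using k(2)[of "(m, 0)"] that by (simp add: u_def)
    show "k (m, 1) = s m" if "m \<in> Q" for m using k(2)[of "(m, 1)"] \<gamma>(4)[of m] that by (auto simp: u_def)
    show "k (m, r) = \<gamma> m r" if "m \<in> Q \<inter> cube_boundary n" "r \<in> {0..1}" for m r
      using k(2)[of "(m, r)"] \<gamma>(3)[of m] that by (auto simp: u_def)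
  qed (rule k(3))
qed

lemma continuous_map_into_fixed_points:
  "continuous_map M (fixed_points H X) f \<longleftrightarrow>
     continuous_map M (space_of X) f \<and> (\<forall>m\<in>topspace M. \<forall>h\<in>H. act X h (f m) = f m)"
proof -
  have "f m \<in> points X" if "continuous_map M (space_of X) f" "m \<in> topspace M" for m
    using that by (auto simp: continuous_map_def Pi_iff)
  then show ?thesis unfolding fixed_points_def continuous_map_in_subtopology by blast
qed

lemma continuous_map_fixed_points_mem:
  "continuous_map M (fixed_points H X) f \<Longrightarrow> m \<in> topspace M \<Longrightarrow> f m \<in> points X"
  by (auto simp: continuous_map_def Pi_iff fixed_points_def)

text \<open>
A point of the target over the cube consists of \<open>\<tau>\<close>, \<open>v\<close> and, where \<open>\<tau> > 0\<close>, a lift \<open>s\<close> of \<open>v\<close>. The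
lifting property of \<open>p\<close> yields a lift \<open>z\<close> of \<open>v\<close> on the whole cube; on the open set \<open>Q\<close> where \<open>\<tau> > 0\<close>
it is joined to \<open>s\<close> by vertical paths that extend the given ones on the boundary. There is no condition
on the paths as \<open>\<tau>\<close> tends to \<open>0\<close>, because the topology of the cylinder is coarse. Everything takes place in the
spaces of fixed points.
\<close>

lemma lifts_resolution:
  fixes X :: "('g, 'x) gspace" and Y :: "('g, 'y) gspace"
  assumes L: "\<And>d. lifts (cube d) (cube_boundary d) (fixed_points H X) (fixed_points H Y) p"
  shows "lifts (cube n) (cube_boundary n) (fixed_points H (resolution_total X p))
           (fixed_points H (resolution_base X Y p)) (resolution_map p)"
  unfolding lifts_def
proof (intro allI impI, elim conjE)
  fix \<alpha> \<beta> assume "continuous_map (top_of_set (cube_boundary n)) (fixed_points H (resolution_total X p)) \<alpha>"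
    and "continuous_map (top_of_set (cube n)) (fixed_points H (resolution_base X Y p)) \<beta>"
    and ab: "\<forall>m\<in>cube_boundary n. resolution_map p (\<alpha> m) = \<beta> m"
  then have a: "continuous_map (top_of_set (cube_boundary n)) (space_of (resolution_total X p)) \<alpha>"
      "\<And>m h. m \<in> cube_boundary n \<Longrightarrow> h \<in> H \<Longrightarrow> act (resolution_total X p) h (\<alpha> m) = \<alpha> m"
    and b: "continuous_map (top_of_set (cube n)) (space_of (resolution_base X Y p)) \<beta>"
      "\<And>m h. m \<in> cube n \<Longrightarrow> h \<in> H \<Longrightarrow> act (resolution_base X Y p) h (\<beta> m) = \<beta> m"
    unfolding continuous_map_into_fixed_points by auto
  let ?P = "path_topology (space_of X) p"
  let ?CZ = "cylinder_points (space_of X) ?P (\<lambda>\<gamma>. \<gamma> 0)" and ?CY = "cylinder_points (space_of Y) (space_of X) p"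
  have bc: "cube_boundary n \<subseteq> cube n" by (auto simp: cube_boundary_def)
  define \<tau> where "\<tau> = (\<lambda>m. fst (\<beta> m))"
  define v where "v = (\<lambda>m. fst (snd (\<beta> m)))"
  define s where "s = (\<lambda>m. snd (snd (\<beta> m)))"
  define z0 where "z0 = (\<lambda>m. fst (snd (\<alpha> m)))"
  define \<gamma> where "\<gamma> = (\<lambda>m. snd (snd (\<alpha> m)))"
  define Q where "Q = {m \<in> cube n. 0 < \<tau> m}"
  have Qc: "Q \<subseteq> cube n" by (auto simp: Q_def)
  have \<beta>C: "\<beta> m \<in> ?CY" if "m \<in> cube n" for m
    using b(1) that by (auto simp: resolution_base_def cylinder_gspace_def continuous_map_def Pi_iff)
  have \<alpha>C: "\<alpha> m \<in> ?CZ" if "m \<in> cube_boundary n" for m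
    using a(1) that by (auto simp: resolution_total_def cylinder_gspace_def path_gspace_def continuous_map_def Pi_iff)
  have \<beta>eq: "\<beta> m = (\<tau> m, v m, s m)" for m by (simp add: \<tau>_def v_def s_def)
  have \<alpha>\<tau>: "fst (\<alpha> m) = \<tau> m" and \<alpha>v: "p (z0 m) = v m" and \<alpha>s: "0 < \<tau> m \<Longrightarrow> \<gamma> m 1 = s m" if "m \<in> cube_boundary n" for m
    using ab that unfolding resolution_map_def \<tau>_def v_def s_def z0_def \<gamma>_def by (auto simp: prod_eq_iff split: if_splits)
  have \<gamma>P: "\<gamma> m \<in> vertical_paths (space_of X) p" and \<gamma>0: "\<gamma> m 0 = z0 m" if "m \<in> cube_boundary n" "0 < \<tau> m" for m
    using \<alpha>C[OF that(1)] \<alpha>\<tau>[OF that(1)] that(2) by (auto simp: cylinder_points_def z0_def \<gamma>_def split: if_splits)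
  have cont_b: "continuous_map (top_of_set (cube n)) euclideanreal \<tau>" "continuous_map (top_of_set (cube n)) (space_of Y) v"
     "continuous_map (subtopology (top_of_set (cube n)) {m. 0 < \<tau> m}) (space_of X) s"
    using b(1) unfolding resolution_base_def cylinder_gspace_def \<tau>_def v_def s_def
    by (simp_all add: continuous_map_into_cylinder_iff)
  have cont_a: "continuous_map (top_of_set (cube_boundary n)) (space_of X) z0"
     "continuous_map (subtopology (top_of_set (cube_boundary n)) {m. 0 < fst (\<alpha> m)}) ?P \<gamma>"
    using a(1) unfolding resolution_total_def cylinder_gspace_def path_gspace_def z0_def \<gamma>_def
    by (simp_all add: continuous_map_into_cylinder_iff)
  have Qsub: "subtopology (top_of_set (cube n)) {m. 0 < \<tau> m} = top_of_set Q"
    unfolding subtopology_subtopology Q_def by (rule arg_cong[where f="subtopology euclidean"]) auto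
  have Qbsub: "subtopology (top_of_set (cube_boundary n)) {m. 0 < fst (\<alpha> m)} = top_of_set (Q \<inter> cube_boundary n)"
    unfolding subtopology_subtopology by (rule arg_cong[where f="subtopology euclidean"]) (use \<alpha>\<tau> bc in \<open>auto simp: Q_def\<close>)
  have fix_b: "act Y h (v m) = v m" "0 < \<tau> m \<Longrightarrow> act X h (s m) = s m" if "m \<in> cube n" "h \<in> H" for m h
    using b(2)[OF that] by (auto simp: resolution_base_def cylinder_gspace_def \<tau>_def v_def s_def prod_eq_iff split: if_splits)
  have fix_a: "act X h (z0 m) = z0 m" "0 < \<tau> m \<Longrightarrow> act X h (\<gamma> m r) = \<gamma> m r" if m: "m \<in> cube_boundary n" "h \<in> H" for m h r
  proof -
    have "act X h (fst (snd (\<alpha> m))) = fst (snd (\<alpha> m))"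
      and "(if 0 < fst (\<alpha> m) then (\<lambda>r. act X h (snd (snd (\<alpha> m)) r)) else undefined) = snd (snd (\<alpha> m))"
      using a(2)[OF m] by (simp_all add: resolution_total_def cylinder_gspace_def path_gspace_def prod_eq_iff cong: if_cong)
    then show "act X h (z0 m) = z0 m" "0 < \<tau> m \<Longrightarrow> act X h (\<gamma> m r) = \<gamma> m r"
      using \<alpha>\<tau>[OF m(1)] by (auto simp: z0_def \<gamma>_def fun_eq_iff split: if_splits)
  qed
  have z0H: "continuous_map (top_of_set (cube_boundary n)) (fixed_points H X) z0"
    using cont_a(1) fix_a(1) by (simp add: continuous_map_into_fixed_points)
  have vH: "continuous_map (top_of_set (cube n)) (fixed_points H Y) v"
    using cont_b(2) fix_b(1) by (simp add: continuous_map_into_fixed_points)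
  obtain z where z: "continuous_map (top_of_set (cube n)) (fixed_points H X) z"
      "\<And>m. m \<in> cube_boundary n \<Longrightarrow> z m = z0 m" "\<And>m. m \<in> cube n \<Longrightarrow> p (z m) = v m"
    using liftsD[OF L z0H vH \<alpha>v] by metis
  have Q: "openin (top_of_set (cube n)) Q"
  proof -
    have "openin euclideanreal {0<..}" by (simp add: open_openin[symmetric])
    from openin_continuous_map_preimage[OF cont_b(1) this] show ?thesis by (simp add: Q_def)
  qed
  have QH: "continuous_map (top_of_set Q) (fixed_points H Y) v" "continuous_map (top_of_set Q) (fixed_points H X) z"
    by (rule continuous_map_from_subtopology_mono[OF vH Qc] continuous_map_from_subtopology_mono[OF z(1) Qc])+
  have sH: "continuous_map (top_of_set Q) (fixed_points H X) s"
    using cont_b(3) fix_b(2) Qc unfolding Qsub by (auto simp: continuous_map_into_fixed_points Q_def)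
  have pz: "p (z m) = v m" and ps: "p (s m) = v m" if "m \<in> Q" for m
    using z(3) \<beta>C[of m] \<beta>eq[of m] that by (auto simp: Q_def cylinder_points_def split: if_splits)
  have \<gamma>H: "continuous_map (top_of_set ((Q \<inter> cube_boundary n) \<times> {0..1})) (fixed_points H X) (\<lambda>x. \<gamma> (fst x) (snd x))"
  proof -
    have "continuous_map (prod_topology (top_of_set (Q \<inter> cube_boundary n)) euclideanreal) (space_of X) (\<lambda>x. \<gamma> (fst x) (snd x))"
      using cont_a(2) unfolding Qbsub continuous_map_into_path_topology_iff by blast
    then have "continuous_map (subtopology (prod_topology (top_of_set (Q \<inter> cube_boundary n)) euclideanreal) ((Q \<inter> cube_boundary n) \<times> {0..1})) (space_of X) (\<lambda>x. \<gamma> (fst x) (snd x))"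
      by (rule continuous_map_from_subtopology)
    then have "continuous_map (top_of_set ((Q \<inter> cube_boundary n) \<times> {0..1})) (space_of X) (\<lambda>x. \<gamma> (fst x) (snd x))"
      by (simp add: subtopology_Times subtopology_subtopology)
    then show ?thesis using fix_a(2) by (auto simp: continuous_map_into_fixed_points Q_def)
  qed
  have p\<gamma>: "p (\<gamma> m r) = v m" if "m \<in> Q \<inter> cube_boundary n" for m r
    using vertical_pathsD(4)[OF \<gamma>P, of m r] \<gamma>0[of m] \<alpha>v[of m] that by (auto simp: Q_def)
  obtain k where k: "continuous_map (top_of_set (Q \<times> {0..1::real})) (fixed_points H X) k" "\<And>m. m \<in> Q \<Longrightarrow> k (m, 0) = z m"
    "\<And>m. m \<in> Q \<Longrightarrow> k (m, 1) = s m" "\<And>m r. m \<in> Q \<inter> cube_boundary n \<Longrightarrow> r \<in> {0..1} \<Longrightarrow> k (m, r) = \<gamma> m r"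
    "\<And>x. x \<in> Q \<times> {0..1} \<Longrightarrow> p (k x) = v (fst x)"
  proof (rule lifts_path_extension[OF L Q QH(1) QH(2) pz sH ps \<gamma>H])
    show "p (\<gamma> m r) = v m" if "m \<in> Q \<inter> cube_boundary n" "r \<in> {0..1}" for m r using p\<gamma> that by blast
    show "\<gamma> m 0 = z m" "\<gamma> m 1 = s m" if "m \<in> Q \<inter> cube_boundary n" for m
      using \<gamma>0[of m] z(2)[of m] \<alpha>s[of m] that by (auto simp: Q_def)
  next
    fix k assume "continuous_map (top_of_set (Q \<times> {0..1::real})) (fixed_points H X) k" "\<And>m. m \<in> Q \<Longrightarrow> k (m, 0) = z m"
      "\<And>m. m \<in> Q \<Longrightarrow> k (m, 1) = s m" "\<And>m r. m \<in> Q \<inter> cube_boundary n \<Longrightarrow> r \<in> {0..1} \<Longrightarrow> k (m, r) = \<gamma> m r"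
      "\<And>x. x \<in> Q \<times> {0..1} \<Longrightarrow> p (k x) = v (fst x)"
    then show thesis by (rule that)
  qed
  \<comment> \<open>The homotopy \<open>k\<close> on \<open>Q \<times> I\<close> as a family of vertical paths.\<close>
  define \<delta> where "\<delta> = (\<lambda>m r. k (m, clamp01 r))"
  have kX: "continuous_map (top_of_set (Q \<times> {0..1::real})) (space_of X) k"
    using k(1) by (simp add: continuous_map_into_fixed_points)
  have \<delta>c: "continuous_map (top_of_set (Q \<times> UNIV)) (space_of X) (\<lambda>x. \<delta> (fst x) (snd x))"
    unfolding \<delta>_def
    by (rule continuous_map_top_of_set_compose[OF kX continuous_on_Pair[OF continuous_on_fst_id
          continuous_on_compose2[OF continuous_on_clamp01 continuous_on_snd[OF continuous_on_id]]]]) auto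
  have \<delta>P: "\<delta> m \<in> vertical_paths (space_of X) p" if "m \<in> Q" for m
  proof -
    have "continuous_map euclideanreal (space_of X) (\<lambda>r. \<delta> (fst (m, r)) (snd (m, r)))"
    proof -
      have "continuous_on UNIV (\<lambda>r::real. (m, r))" by (rule continuous_on_Pair[OF continuous_on_const continuous_on_id])
      from continuous_map_top_of_set_compose[OF \<delta>c this] that show ?thesis by auto
    qed
    moreover have "p (\<delta> m r) = p (\<delta> m 0)" for r using k(5)[of "(m, clamp01 r)"] k(5)[of "(m, 0)"] that by (simp add: \<delta>_def)
    ultimately show ?thesis by (simp add: vertical_paths_def) (simp add: \<delta>_def)
  qed
  define l where "l = (\<lambda>m. (\<tau> m, z m, if 0 < \<tau> m then \<delta> m else undefined))"
  have zX: "continuous_map (top_of_set (cube n)) (space_of X) z"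
    using z(1) by (simp add: continuous_map_into_fixed_points)
  have \<tau>01: "0 \<le> \<tau> m" "\<tau> m \<le> 1" if "m \<in> cube n" for m
    using \<beta>C[OF that] \<beta>eq[of m] by (auto simp: cylinder_points_def)
  have lC: "l m \<in> ?CZ" if m: "m \<in> cube n" for m
  proof -
    have "z m \<in> points X" using zX m by (auto simp: continuous_map_def Pi_iff)
    moreover have "\<delta> m \<in> vertical_paths (space_of X) p" "\<delta> m 0 = z m" if "0 < \<tau> m"
      using \<delta>P[of m] k(2)[of m] m that by (auto simp: Q_def \<delta>_def)
    ultimately show ?thesis using \<tau>01[OF m] by (auto simp: l_def cylinder_points_def)
  qed
  have "continuous_map (top_of_set (cube n)) (space_of (resolution_total X p)) l"
    unfolding resolution_total_def cylinder_gspace_def path_gspace_def gspace.simps continuous_map_into_cylinder_iff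
  proof (intro conjI)
    show "l \<in> topspace (top_of_set (cube n)) \<rightarrow> ?CZ" using lC by auto
    show "continuous_map (top_of_set (cube n)) euclideanreal (\<lambda>m. fst (l m))"
      "continuous_map (top_of_set (cube n)) (space_of X) (\<lambda>m. fst (snd (l m)))"
      using cont_b(1) zX by (simp_all add: l_def)
    have "continuous_map (top_of_set Q) ?P \<delta>"
      unfolding continuous_map_into_path_topology_iff
    proof (intro conjI)
      show "\<delta> \<in> topspace (top_of_set Q) \<rightarrow> vertical_paths (space_of X) p" using \<delta>P by auto
      have "prod_topology (top_of_set Q) euclideanreal = top_of_set (Q \<times> UNIV)"
        using prod_topology_subtopology_eu[of Q "UNIV :: real set"] by simp
      then show "continuous_map (prod_topology (top_of_set Q) euclideanreal) (space_of X) (\<lambda>x. \<delta> (fst x) (snd x))"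
        using \<delta>c by simp
    qed
    then have "continuous_map (top_of_set Q) ?P (\<lambda>m. snd (snd (l m)))"
      by (rule continuous_map_eq) (auto simp: l_def Q_def)
    then show "continuous_map (subtopology (top_of_set (cube n)) {m. 0 < fst (l m)}) ?P (\<lambda>m. snd (snd (l m)))"
      using Qsub by (simp add: l_def)
  qed
  moreover have "act (resolution_total X p) h (l m) = l m" if m: "m \<in> cube n" "h \<in> H" for m h
  proof -
    have "act X h (z m) = z m" using z(1) m by (simp add: continuous_map_into_fixed_points)
    moreover have "act X h (\<delta> m r) = \<delta> m r" if "0 < \<tau> m" for r
      using k(1) m that by (simp add: continuous_map_into_fixed_points \<delta>_def Q_def)
    ultimately show ?thesis by (auto simp: l_def resolution_total_def cylinder_gspace_def path_gspace_def)
  qed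
  ultimately have "continuous_map (top_of_set (cube n)) (fixed_points H (resolution_total X p)) l"
    by (simp add: continuous_map_into_fixed_points)
  moreover have "l m = \<alpha> m" if m: "m \<in> cube_boundary n" for m
  proof -
    have "\<delta> m r = \<gamma> m r" if "0 < \<tau> m" for r
      using k(4)[of m "clamp01 r"] vertical_pathsD(3)[OF \<gamma>P[OF m that], of r] that m bc by (auto simp: \<delta>_def Q_def)
    moreover have "\<gamma> m = undefined" if "\<not> 0 < \<tau> m"
      using \<alpha>C[OF m] \<alpha>\<tau>[OF m] that by (auto simp: \<gamma>_def cylinder_points_def)
    ultimately have "(if 0 < \<tau> m then \<delta> m else undefined) = \<gamma> m" by auto
    then show ?thesis using \<alpha>\<tau>[OF m] z(2)[OF m] by (simp add: l_def prod_eq_iff z0_def \<gamma>_def)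
  qed
  moreover have "resolution_map p (l m) = \<beta> m" if m: "m \<in> cube n" for m
  proof -
    have "(if 0 < \<tau> m then \<delta> m 1 else undefined) = s m"
      using k(3)[of m] m \<beta>C[OF m] \<beta>eq[of m] by (auto simp: \<delta>_def Q_def cylinder_points_def)
    moreover have "resolution_map p (l m) = (\<tau> m, p (z m), if 0 < \<tau> m then \<delta> m 1 else undefined)"
      by (simp add: resolution_map_def l_def)
    ultimately show ?thesis unfolding z(3)[OF m] \<beta>eq[of m] by (simp only:)
  qed
  ultimately show "\<exists>l. continuous_map (top_of_set (cube n)) (fixed_points H (resolution_total X p)) l \<and>
      (\<forall>m\<in>cube_boundary n. l m = \<alpha> m) \<and> (\<forall>m\<in>cube n. resolution_map p (l m) = \<beta> m)"
    by blast
qed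

section \<open>Lifting against coarse acyclic fibrations\<close>

text \<open>
A path is coded by its graph. The triple \<open>(t, z, \<gamma>)\<close> becomes the set of the pairs \<open>(r, \<gamma> r)\<close>, with the
pair \<open>(z, t)\<close> added; the order of its components distinguishes it from the others. Since the
summand \<open>real\<close> makes the disjoint union infinite, pairs of its elements can be coded by elements.
\<close>

lemma ex_inj_into_test_universe:
  "\<exists>\<phi> :: (real \<times> 'u \<times> (real \<Rightarrow> 'u)) \<Rightarrow> ('g, 'a, 'b, 'u) test_universe. inj \<phi>"
proof -
  have "infinite (UNIV :: ('g + 'a + 'b + 'u + real) set)"
  proof
    assume "finite (UNIV :: ('g + 'a + 'b + 'u + real) set)"
    then have "finite (range (\<lambda>r::real. Inr (Inr (Inr (Inr r))) :: 'g + 'a + 'b + 'u + real))"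
      by (rule finite_subset[rotated]) blast
    moreover have "inj (\<lambda>r::real. Inr (Inr (Inr (Inr r))) :: 'g + 'a + 'b + 'u + real)" by (auto simp: inj_def)
    ultimately show False using finite_imageD infinite_UNIV_char_0 by blast
  qed
  from card_of_Times_same_infinite[OF this]
  obtain pr :: "('g + 'a + 'b + 'u + real) \<times> ('g + 'a + 'b + 'u + real) \<Rightarrow> 'g + 'a + 'b + 'u + real"
    where "bij_betw pr (UNIV \<times> UNIV) UNIV"
    unfolding card_of_ordIso[symmetric] by blast
  then have pr: "inj pr" by (simp add: bij_betw_def)
  define R :: "real \<Rightarrow> 'g + 'a + 'b + 'u + real" where "R = (\<lambda>r. Inr (Inr (Inr (Inr r))))"
  define I :: "'u \<Rightarrow> 'g + 'a + 'b + 'u + real" where "I = (\<lambda>x. Inr (Inr (Inr (Inl x))))"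
  have RI: "R r = R r' \<longleftrightarrow> r = r'" "I x = I x' \<longleftrightarrow> x = x'" "R r \<noteq> I x" "I x \<noteq> R r" for r r' x x'
    by (auto simp: R_def I_def)
  define code where "code = (\<lambda>(t, z, \<gamma>). insert (I z, R t) (range (\<lambda>r. (R r, I (\<gamma> r)))))"
  have "inj code"
  proof (rule injI)
    fix a b assume eq: "code a = code b"
    obtain t z \<gamma> t' z' \<gamma>' where ab: "a = (t, z, \<gamma>)" "b = (t', z', \<gamma>')" by (cases a, cases b) auto
    have "(I z, R t) \<in> code b" using eq[symmetric] by (simp add: ab code_def)
    then have 1: "z = z'" "t = t'" by (auto simp: ab code_def RI)
    have "\<gamma> r = \<gamma>' r" for r
    proof -
      have "(R r, I (\<gamma> r)) \<in> code b" using eq[symmetric] by (simp add: ab code_def)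
      then show ?thesis by (auto simp: ab code_def RI)
    qed
    with 1 show "a = b" by (auto simp: ab)
  qed
  then have "inj (\<lambda>x. pr ` code x)"
    by (intro injI) (simp add: inj_image_eq_iff[OF pr] inj_eq)
  then show ?thesis by blast
qed

lemma continuous_map_into_copy:
  assumes "inj_on \<phi> (topspace Z)" "continuous_map M Z f"
  shows "continuous_map M (copy_topology \<phi> Z) (\<lambda>m. \<phi> (f m))"
  using continuous_map_compose[OF assms(2) continuous_map_copy_topology[OF assms(1)]] by (simp add: o_def)

lemma continuous_map_from_k_copy:
  assumes "inj_on \<phi> (topspace Z)" "continuous_map M (k_topology (copy_topology \<phi> Z)) f"
  shows "continuous_map M Z (\<lambda>m. inv_into (topspace Z) \<phi> (f m))"
  using continuous_map_compose[OF continuous_map_into_k_topologyD[OF assms(2)] continuous_map_copy_topology_inv[OF assms(1)]]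
  by (simp add: o_def)

definition copy_gspace :: "('z \<Rightarrow> 'w) \<Rightarrow> ('g, 'z) gspace \<Rightarrow> ('g, 'w) gspace" where
  "copy_gspace \<phi> Z = \<lparr>space_of = copy_topology \<phi> (space_of Z),
     act = (\<lambda>g w. \<phi> (act Z g (inv_into (points Z) \<phi> w)))\<rparr>"

lemma coarse_G_space_copy:
  fixes Z :: "('g, 'z) gspace"
  assumes Z: "coarse_G_space TYPE('x) G T Z" and \<phi>: "inj \<phi>" and TG: "topspace T = carrier G" and G: "group G"
  shows "coarse_G_space TYPE('x) G T (copy_gspace \<phi> Z)"
proof -
  let ?W = "copy_topology \<phi> (space_of Z)" and ?i = "inv_into (points Z) \<phi>"
  have inj: "inj_on \<phi> (points Z)" using \<phi> by (rule inj_on_subset) simp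
  note c = copy_topology[OF inj]
  have i: "?i (\<phi> z) = z" if "z \<in> points Z" for z using inj that by simp
  have sepZ: "separated_by_weak_Hausdorff TYPE('x) (space_of Z)" using Z by (simp add: coarse_G_space_def)
  have "separated_by_weak_Hausdorff TYPE('x) ?W"
    unfolding separated_by_weak_Hausdorff_def[of _ ?W]
  proof (intro ballI impI)
    fix w w' assume w: "w \<in> topspace ?W" "w' \<in> topspace ?W" "w \<noteq> w'"
    then have "?i w \<noteq> ?i w'" unfolding c by (metis f_inv_into_f)
    then show "(\<exists>V V'. openin ?W V \<and> openin ?W V' \<and> w \<in> V \<and> w' \<in> V' \<and> disjnt V V') \<or>
        (\<exists>V (X :: 'x topology) h. openin ?W V \<and> w \<in> V \<and> w' \<in> V \<and> weak_Hausdorff X \<and>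
           continuous_map (subtopology ?W V) X h \<and> h w \<noteq> h w')"
      using w c(3) by (intro separated_by_pullback[OF sepZ openin_topspace, where q="?i"]) (auto intro: continuous_map_from_subtopology)
  qed
  moreover have "continuous_map (prod_topology T ?W) ?W (\<lambda>x. \<phi> (act Z (fst x) (?i (snd x))))"
  proof -
    have a: "continuous_map (prod_topology T (space_of Z)) (space_of Z) (\<lambda>x. act Z (fst x) (snd x))"
      using Z by (simp add: coarse_G_space_def)
    have "continuous_map (prod_topology T ?W) (prod_topology T (space_of Z)) (\<lambda>x. (fst x, ?i (snd x)))"
      using continuous_map_compose[OF continuous_map_snd c(3)] by (intro continuous_map_pairedI continuous_map_fst) (simp add: o_def)
    from continuous_map_compose[OF continuous_map_compose[OF this a] c(2)] show ?thesis by (simp add: o_def)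
  qed
  moreover have "\<one>\<^bsub>G\<^esub> \<in> carrier G" using G by (simp add: group.is_monoid)
  ultimately show ?thesis
    using Z i unfolding coarse_G_space_def copy_gspace_def by (auto simp: c(1))
qed

text \<open>
Source and target of the coarse map \<open>q\<close> are copied into the test universe and retopologized. Cubes are
compact Hausdorff, so the new map has the same lifting problems of cubes as \<open>q\<close> on fixed points, and
hence is a fibration and weak equivalence. The lift against it is also continuous for the coarse
topology, and the lifting data out of \<open>A\<close> and \<open>B\<close> are continuous for the new one because \<open>A\<close> and \<open>B\<close> are
compactly generated.
\<close>

lemma C_cofibration_lift_coarse:
  fixes Z :: "('g, 'z) gspace" and Y :: "('g, 'y) gspace" and \<phi> :: "'z \<Rightarrow> 'w" and \<psi> :: "'y \<Rightarrow> 'w"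
    and A :: "('g, 'a) gspace" and B :: "('g, 'b) gspace"
  assumes cof: "C_cofibration TYPE('w) G T \<C> A B i"
    and G: "group G" and TG: "topspace T = carrier G" and T: "compact_space T" "Hausdorff_space T"
    and Csub: "\<And>H. H \<in> \<C> \<Longrightarrow> H \<subseteq> carrier G"
    and Z: "coarse_G_space TYPE('x) G T Z" and Y: "coarse_G_space TYPE('x) G T Y" and q: "G_map G Z Y q"
    and \<phi>: "inj \<phi>" and \<psi>: "inj \<psi>"
    and L: "\<And>H n. H \<in> \<C> \<Longrightarrow> lifts (cube n) (cube_boundary n) (fixed_points H Z) (fixed_points H Y) q"
    and u: "G_map G A Z u" and v: "G_map G B Y v" and uv: "\<And>a. a \<in> points A \<Longrightarrow> q (u a) = v (i a)"
  obtains l where "G_map G B Z l" "\<And>a. a \<in> points A \<Longrightarrow> l (i a) = u a" "\<And>b. b \<in> points B \<Longrightarrow> q (l b) = v b"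
proof -
  define ks where "ks = (\<lambda>W :: ('g, 'w) gspace. W\<lparr>space_of := k_topology (space_of W)\<rparr>)"
  let ?Z = "copy_gspace \<phi> Z" and ?Y = "copy_gspace \<psi> Y"
  let ?iZ = "inv_into (points Z) \<phi>" and ?iY = "inv_into (points Y) \<psi>"
  have injZ: "inj_on \<phi> (points Z)" and injY: "inj_on \<psi> (points Y)" using \<phi> \<psi> by (auto intro: inj_on_subset)
  note cZ = copy_topology[OF injZ] and cY = copy_topology[OF injY]
  have iZ: "?iZ (\<phi> z) = z" if "z \<in> points Z" for z using injZ that by simp
  have iY: "?iY (\<psi> y) = y" if "y \<in> points Y" for y using injY that by simp
  have coZ: "coarse_G_space TYPE('x) G T ?Z" and coY: "coarse_G_space TYPE('x) G T ?Y"
    using coarse_G_space_copy Z Y \<phi> \<psi> TG G by blast+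
  have GZ: "G_space G T (ks ?Z)" and GY: "G_space G T (ks ?Y)"
    unfolding ks_def using G_space_k_topology[OF G T coZ] G_space_k_topology[OF G T coY] by auto
  have sepZ: "separated_by_weak_Hausdorff TYPE('x) (copy_topology \<phi> (space_of Z))"
    and sepY: "separated_by_weak_Hausdorff TYPE('x) (copy_topology \<psi> (space_of Y))"
    using coZ coY by (simp_all add: coarse_G_space_def copy_gspace_def)
  have spZ: "space_of (ks ?Z) = k_topology (copy_topology \<phi> (space_of Z))" and spY: "space_of (ks ?Y) = k_topology (copy_topology \<psi> (space_of Y))"
    by (simp_all add: ks_def copy_gspace_def)
  have ptZ: "points (ks ?Z) = \<phi> ` points Z" and ptY: "points (ks ?Y) = \<psi> ` points Y"
    by (simp_all add: spZ spY cZ(1) cY(1))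
  have actZ: "act (ks ?Z) g (\<phi> z) = \<phi> (act Z g z)" if "z \<in> points Z" for g z
    using iZ[OF that] by (simp add: ks_def copy_gspace_def)
  have actY: "act (ks ?Y) g (\<psi> y) = \<psi> (act Y g y)" if "y \<in> points Y" for g y
    using iY[OF that] by (simp add: ks_def copy_gspace_def)
  have clZ: "act Z g z \<in> points Z" if "g \<in> carrier G" "z \<in> points Z" for g z using Z that by (simp add: coarse_G_space_def)
  have clY: "act Y g y \<in> points Y" if "g \<in> carrier G" "y \<in> points Y" for g y using Y that by (simp add: coarse_G_space_def)
  have qY: "q z \<in> points Y" if "z \<in> points Z" for z using q that by (auto simp: G_map_def continuous_map_def Pi_iff)
  have CG: "compactly_generated (space_of A)" "compactly_generated (space_of B)" and GAB: "G_map G A B i"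
    using cof by (auto simp: C_cofibration_def G_space_def CGWH_def)
  note outZ = continuous_map_from_k_copy[OF injZ, folded spZ] and outY = continuous_map_from_k_copy[OF injY, folded spY]
  note intoZ = continuous_map_into_copy[OF injZ] and intoY = continuous_map_into_copy[OF injY]
  define p where "p = (\<lambda>w. \<psi> (q (?iZ w)))"
  have p: "G_map G (ks ?Z) (ks ?Y) p"
    unfolding G_map_def
  proof (intro conjI ballI)
    have "continuous_map (copy_topology \<phi> (space_of Z)) (copy_topology \<psi> (space_of Y)) p"
    proof -
      have "continuous_map (space_of Z) (space_of Y) q" using q by (simp add: G_map_def)
      from continuous_map_compose[OF continuous_map_compose[OF cZ(3) this] cY(2)]
      show ?thesis by (simp add: p_def o_def)
    qed
    moreover have "compactly_generated (space_of (ks ?Z))" using GZ by (simp add: G_space_def CGWH_def)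
    ultimately show "continuous_map (space_of (ks ?Z)) (space_of (ks ?Y)) p"
      unfolding spZ spY by (intro continuous_map_into_k_topology[OF sepY] continuous_map_from_k_topology)
    fix g w assume g: "g \<in> carrier G" and "w \<in> points (ks ?Z)"
    then obtain z where z: "w = \<phi> z" "z \<in> points Z" unfolding ptZ by blast
    show "p (act (ks ?Z) g w) = act (ks ?Y) g (p w)"
      using q g z by (simp add: p_def actZ iZ clZ actY qY G_map_def)
  qed
  have fixZ: "\<phi> z \<in> {x \<in> points (ks ?Z). \<forall>h\<in>H. act (ks ?Z) h x = x} \<longleftrightarrow> (\<forall>h\<in>H. act Z h z = z)" if "z \<in> points Z" "H \<subseteq> carrier G" for z H
    using that clZ \<phi> by (auto simp: ptZ actZ inj_eq)
  have fixY: "\<psi> y \<in> {x \<in> points (ks ?Y). \<forall>h\<in>H. act (ks ?Y) h x = x} \<longleftrightarrow> (\<forall>h\<in>H. act Y h y = y)" if "y \<in> points Y" "H \<subseteq> carrier G" for y H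
    using that clY \<psi> by (auto simp: ptY actY inj_eq)
  have Lk: "lifts (cube n) (cube_boundary n) (fixed_points H (ks ?Z)) (fixed_points H (ks ?Y)) p" if H: "H \<in> \<C>" for H n
    unfolding lifts_def
  proof (intro allI impI, elim conjE)
    fix \<alpha> \<beta> assume a: "continuous_map (top_of_set (cube_boundary n)) (fixed_points H (ks ?Z)) \<alpha>"
      and b: "continuous_map (top_of_set (cube n)) (fixed_points H (ks ?Y)) \<beta>"
      and ab: "\<forall>m\<in>cube_boundary n. p (\<alpha> m) = \<beta> m"
    have Hc: "H \<subseteq> carrier G" by (rule Csub[OF H])
    have bc: "cube_boundary n \<subseteq> cube n" by (auto simp: cube_boundary_def)
    have \<alpha>: "\<alpha> m = \<phi> (?iZ (\<alpha> m))" "?iZ (\<alpha> m) \<in> points Z" if "m \<in> cube_boundary n" for m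
    proof -
      have "\<alpha> m \<in> points (ks ?Z)" using continuous_map_fixed_points_mem[OF a] that by simp
      then show "\<alpha> m = \<phi> (?iZ (\<alpha> m))" "?iZ (\<alpha> m) \<in> points Z" unfolding ptZ by (auto simp: iZ)
    qed
    have \<beta>: "\<beta> m = \<psi> (?iY (\<beta> m))" "?iY (\<beta> m) \<in> points Y" if "m \<in> cube n" for m
    proof -
      have "\<beta> m \<in> points (ks ?Y)" using continuous_map_fixed_points_mem[OF b] that by simp
      then show "\<beta> m = \<psi> (?iY (\<beta> m))" "?iY (\<beta> m) \<in> points Y" unfolding ptY by (auto simp: iY)
    qed
    have fa: "act Z h (?iZ (\<alpha> m)) = ?iZ (\<alpha> m)" if "m \<in> cube_boundary n" "h \<in> H" for m h
    proof -
      have "act (ks ?Z) h (\<phi> (?iZ (\<alpha> m))) = \<phi> (?iZ (\<alpha> m))"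
        using a that \<alpha>(1)[OF that(1)] by (simp add: continuous_map_into_fixed_points)
      then show ?thesis using actZ[OF \<alpha>(2)[OF that(1)], of h] \<phi> by (simp add: inj_eq)
    qed
    have fb: "act Y h (?iY (\<beta> m)) = ?iY (\<beta> m)" if "m \<in> cube n" "h \<in> H" for m h
    proof -
      have "act (ks ?Y) h (\<psi> (?iY (\<beta> m))) = \<psi> (?iY (\<beta> m))"
        using b that \<beta>(1)[OF that(1)] by (simp add: continuous_map_into_fixed_points)
      then show ?thesis using actY[OF \<beta>(2)[OF that(1)], of h] \<psi> by (simp add: inj_eq)
    qed
    have a': "continuous_map (top_of_set (cube_boundary n)) (fixed_points H Z) (\<lambda>m. ?iZ (\<alpha> m))"
      using outZ[OF a[unfolded continuous_map_into_fixed_points, THEN conjunct1]] fa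
      by (simp add: continuous_map_into_fixed_points)
    have b': "continuous_map (top_of_set (cube n)) (fixed_points H Y) (\<lambda>m. ?iY (\<beta> m))"
      using outY[OF b[unfolded continuous_map_into_fixed_points, THEN conjunct1]] fb
      by (simp add: continuous_map_into_fixed_points)
    have ab': "q (?iZ (\<alpha> m)) = ?iY (\<beta> m)" if m: "m \<in> cube_boundary n" for m
    proof -
      have "\<psi> (q (?iZ (\<alpha> m))) = \<psi> (?iY (\<beta> m))"
        using ab m \<beta>(1)[of m] bc by (auto simp: p_def)
      then show ?thesis using \<psi> by (simp add: inj_eq)
    qed
    obtain l where l: "continuous_map (top_of_set (cube n)) (fixed_points H Z) l"
        "\<And>m. m \<in> cube_boundary n \<Longrightarrow> l m = ?iZ (\<alpha> m)" "\<And>m. m \<in> cube n \<Longrightarrow> q (l m) = ?iY (\<beta> m)"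
      using liftsD[OF L[OF H] a' b' ab'] by metis
    have lZ: "l m \<in> points Z" if "m \<in> cube n" for m
      using continuous_map_fixed_points_mem[OF l(1)] that by simp
    have "compact (cube n)"
    proof -
      have "compact (Pi\<^sub>E UNIV (\<lambda>i::nat. if i < n then {-1..1::real} else {0}))"
        using compactin_PiE[of "\<lambda>_. euclidean" UNIV "\<lambda>i::nat. if i < n then {-1..1::real} else {0}"]
        by (auto simp: euclidean_product_topology)
      moreover have "cube n = Pi\<^sub>E UNIV (\<lambda>i::nat. if i < n then {-1..1::real} else {0})"
        by (auto simp: cube_def PiE_iff abs_le_iff split: if_splits)
      ultimately show ?thesis by simp
    qed
    then have "compact_space (top_of_set (cube n))" "Hausdorff_space (top_of_set (cube n))"
      by (simp_all add: compact_space_subtopology Hausdorff_space_subtopology)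
    then have "continuous_map (top_of_set (cube n)) (space_of (ks ?Z)) (\<lambda>m. \<phi> (l m))"
      unfolding spZ using l(1) by (intro continuous_map_compact_into_k_topology[OF sepZ] intoZ) (simp_all add: continuous_map_into_fixed_points)
    then have "continuous_map (top_of_set (cube n)) (fixed_points H (ks ?Z)) (\<lambda>m. \<phi> (l m))"
      using l(1) lZ by (simp add: continuous_map_into_fixed_points actZ)
    moreover have "p (\<phi> (l m)) = \<beta> m" if "m \<in> cube n" for m
      using l(3)[OF that] \<beta>(1)[OF that] by (simp add: p_def iZ lZ that)
    ultimately show "\<exists>l. continuous_map (top_of_set (cube n)) (fixed_points H (ks ?Z)) l \<and>
        (\<forall>m\<in>cube_boundary n. l m = \<alpha> m) \<and> (\<forall>m\<in>cube n. p (l m) = \<beta> m)"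
      using l(2) \<alpha>(1) by (intro exI[of _ "\<lambda>m. \<phi> (l m)"]) simp
  qed
  have pH: "continuous_map (fixed_points H (ks ?Z)) (fixed_points H (ks ?Y)) p" if "H \<in> \<C>" for H
    unfolding continuous_map_into_fixed_points
  proof
    show "continuous_map (fixed_points H (ks ?Z)) (space_of (ks ?Y)) p"
      using p unfolding fixed_points_def G_map_def by (blast intro: continuous_map_from_subtopology)
    show "\<forall>m\<in>topspace (fixed_points H (ks ?Z)). \<forall>h\<in>H. act (ks ?Y) h (p m) = p m"
      using p Csub[OF that] unfolding fixed_points_def G_map_def by (auto simp: subset_iff) metis
  qed
  have "C_fibration G \<C> (ks ?Z) (ks ?Y) p" "C_weak_equivalence G \<C> (ks ?Z) (ks ?Y) p"
    unfolding C_fibration_def C_weak_equivalence_def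
    using p lifts_cube_imp_Serre_fibration[OF Lk pH] lifts_cube_imp_weak_homotopy_equivalence[OF Lk pH] by blast+
  then have LP: "has_lifting_property G A B i (ks ?Z) (ks ?Y) p"
    using cof GZ GY unfolding C_cofibration_def by blast
  have uZ: "u a \<in> points Z" if "a \<in> points A" for a using u that by (auto simp: G_map_def continuous_map_def Pi_iff)
  have vY: "v b \<in> points Y" if "b \<in> points B" for b using v that by (auto simp: G_map_def continuous_map_def Pi_iff)
  have u': "G_map G A (ks ?Z) (\<lambda>a. \<phi> (u a))"
    using u uZ continuous_map_into_k_topology[OF sepZ CG(1) intoZ[OF u[unfolded G_map_def, THEN conjunct1]]]
    unfolding G_map_def spZ by (simp add: actZ)
  have v': "G_map G B (ks ?Y) (\<lambda>b. \<psi> (v b))"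
    using v vY continuous_map_into_k_topology[OF sepY CG(2) intoY[OF v[unfolded G_map_def, THEN conjunct1]]]
    unfolding G_map_def spY by (simp add: actY)
  have "\<forall>a\<in>points A. p (\<phi> (u a)) = \<psi> (v (i a))" using uv by (simp add: p_def iZ uZ)
  with LP u' v' obtain l where l: "G_map G B (ks ?Z) l" "\<forall>a\<in>points A. l (i a) = \<phi> (u a)" "\<forall>b\<in>points B. p (l b) = \<psi> (v b)"
    unfolding has_lifting_property_def by blast
  have lp: "l b = \<phi> (?iZ (l b))" "?iZ (l b) \<in> points Z" if "b \<in> points B" for b
  proof -
    have "l b \<in> points (ks ?Z)" using l(1) that by (auto simp: G_map_def continuous_map_def Pi_iff)
    then show "l b = \<phi> (?iZ (l b))" "?iZ (l b) \<in> points Z" unfolding ptZ by (auto simp: iZ)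
  qed
  show thesis
  proof (rule that)
    show "G_map G B Z (\<lambda>b. ?iZ (l b))"
      unfolding G_map_def
    proof (intro conjI ballI)
      show "continuous_map (space_of B) (space_of Z) (\<lambda>b. ?iZ (l b))" by (rule outZ[OF l(1)[unfolded G_map_def, THEN conjunct1]])
      fix g b assume g: "g \<in> carrier G" and b: "b \<in> points B"
      have "l (act B g b) = act (ks ?Z) g (\<phi> (?iZ (l b)))" using l(1) g b lp(1)[OF b] by (simp add: G_map_def)
      then show "?iZ (l (act B g b)) = act Z g (?iZ (l b))"
        using actZ[OF lp(2)[OF b], of g] clZ[OF g lp(2)[OF b]] by (simp add: iZ)
    qed
    show "?iZ (l (i a)) = u a" if "a \<in> points A" for a using l(2) that by (simp add: iZ uZ)
    show "q (?iZ (l b)) = v b" if "b \<in> points B" for b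
      using l(3) that \<psi> by (auto simp: p_def inj_eq)
  qed
qed

section \<open>Altering a partial lift so that it extends\<close>

text \<open>
The partial lift \<open>s\<close>, together with \<open>\<tau>\<close> and \<open>v\<close>, is a map \<open>\<beta>\<close> into the cylinder on \<open>p\<close>, and \<open>u\<close> with
constant paths is a map \<open>\<alpha>\<close> into the cylinder on the starting point map. A lift consists of a total lift
\<open>z\<close> and of paths \<open>\<gamma> b\<close> from \<open>z b\<close> to \<open>s b\<close>. Following \<open>\<gamma> b\<close> for a time \<open>\<rho> b\<close> that increases from \<open>0\<close> to
\<open>1\<close> while \<open>\<tau> b\<close> runs from \<open>1/3\<close> to \<open>2/3\<close> interpolates between \<open>z\<close> and \<open>s\<close>, and it does not move the
image of \<open>A\<close>, where the paths are constant.
\<close>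

lemma extend_partial_lift:
  fixes X :: "('g, 'u) gspace" and Y :: "('g, 'u) gspace" and A :: "('g, 'a) gspace" and B :: "('g, 'b) gspace"
  assumes cof: "C_cofibration TYPE(('g, 'a1, 'b1, 'u) test_universe) G T \<C> A B i"
    and G: "group G" and TG: "topspace T = carrier G" and T: "compact_space T" "Hausdorff_space T"
    and Csub: "\<And>H. H \<in> \<C> \<Longrightarrow> H \<subseteq> carrier G"
    and X: "G_space G T X" and Y: "G_space G T Y" and fib: "C_fibration G \<C> X Y p" and we: "C_weak_equivalence G \<C> X Y p"
    and u: "G_map G A X u" and v: "G_map G B Y v" and uv: "\<And>a. a \<in> points A \<Longrightarrow> p (u a) = v (i a)"
    and \<tau>: "continuous_map (space_of B) euclideanreal \<tau>" "\<And>b. b \<in> points B \<Longrightarrow> 0 \<le> \<tau> b \<and> \<tau> b \<le> 1"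
      "\<And>g b. g \<in> carrier G \<Longrightarrow> b \<in> points B \<Longrightarrow> \<tau> (act B g b) = \<tau> b"
    and s: "continuous_map (subtopology (space_of B) {b. 0 < \<tau> b}) (space_of X) s"
      "\<And>g b. g \<in> carrier G \<Longrightarrow> b \<in> points B \<Longrightarrow> 0 < \<tau> b \<Longrightarrow> s (act B g b) = act X g (s b)"
      "\<And>b. b \<in> points B \<Longrightarrow> 0 < \<tau> b \<Longrightarrow> p (s b) = v b"
      "\<And>a. a \<in> points A \<Longrightarrow> 0 < \<tau> (i a) \<Longrightarrow> s (i a) = u a"
  obtains l where "G_map G B X l" "\<And>a. a \<in> points A \<Longrightarrow> l (i a) = u a" "\<And>b. b \<in> points B \<Longrightarrow> p (l b) = v b"
    "\<And>b. b \<in> points B \<Longrightarrow> 2 / 3 \<le> \<tau> b \<Longrightarrow> l b = s b"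
proof -
  let ?Z = "resolution_total X p" and ?W = "resolution_base X Y p"
  let ?P = "path_topology (space_of X) p"
  have p: "G_map G X Y p" using fib by (simp add: C_fibration_def)
  have GAB: "G_map G A B i" using cof by (simp add: C_cofibration_def)
  have coX: "coarse_G_space TYPE('u) G T X" and coY: "coarse_G_space TYPE('u) G T Y"
    using G_space_imp_coarse[OF G] X Y by blast+
  have coP: "coarse_G_space TYPE('u) G T (path_gspace X p)" by (rule coarse_G_space_path[OF coX TG p])
  have coZ: "coarse_G_space TYPE('u) G T ?Z"
    unfolding resolution_total_def by (rule coarse_G_space_cylinder[OF coX coP G TG]) (simp add: path_gspace_def)
  have coW: "coarse_G_space TYPE('u) G T ?W"
    unfolding resolution_base_def using p by (intro coarse_G_space_cylinder[OF coY coX G TG]) (simp add: G_map_def)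
  have L: "lifts (cube n) (cube_boundary n) (fixed_points H ?Z) (fixed_points H ?W) (resolution_map p)" if "H \<in> \<C>" for H n
  proof (rule lifts_resolution)
    show "lifts (cube d) (cube_boundary d) (fixed_points H X) (fixed_points H Y) p" for d
      using fib we that by (intro acyclic_fibration_lifts_cube) (simp_all add: C_fibration_def C_weak_equivalence_def)
  qed
  \<comment> \<open>The points of the target cylinder are embedded as those of the source cylinder with a constant path.\<close>
  obtain \<phi> :: "(real \<times> 'u \<times> (real \<Rightarrow> 'u)) \<Rightarrow> ('g, 'a1, 'b1, 'u) test_universe" where \<phi>: "inj \<phi>"
    using ex_inj_into_test_universe by blast
  have \<psi>: "inj (\<lambda>x. \<phi> (fst x, fst (snd x), \<lambda>r::real. snd (snd x)))"
    by (intro injI) (simp add: inj_eq[OF \<phi>] prod_eq_iff fun_eq_iff)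
  have ptX: "u a \<in> points X" if "a \<in> points A" for a using u that by (auto simp: G_map_def continuous_map_def Pi_iff)
  have iB: "i a \<in> points B" if "a \<in> points A" for a using GAB that by (auto simp: G_map_def continuous_map_def Pi_iff)
  have sX: "s b \<in> points X" if "b \<in> points B" "0 < \<tau> b" for b
    using s(1) that by (auto simp: continuous_map_def Pi_iff)
  have uc: "continuous_map (space_of A) (space_of X) u" and vc: "continuous_map (space_of B) (space_of Y) v"
    and ic: "continuous_map (space_of A) (space_of B) i" using u v GAB by (auto simp: G_map_def)
  have vY: "v b \<in> points Y" if "b \<in> points B" for b using vc that by (auto simp: continuous_map_def Pi_iff)
  have ti: "\<tau> (i (act A g a)) = \<tau> (i a)" if "g \<in> carrier G" "a \<in> points A" for g a
    using GAB \<tau>(3) iB that by (simp add: G_map_def)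
  define \<alpha> where "\<alpha> = (\<lambda>a. (\<tau> (i a), u a, if 0 < \<tau> (i a) then (\<lambda>r::real. u a) else undefined))"
  define \<beta> where "\<beta> = (\<lambda>b. (\<tau> b, v b, if 0 < \<tau> b then s b else undefined))"
  have const: "(\<lambda>r. x) \<in> vertical_paths (space_of X) p" if "x \<in> points X" for x
    using that by (simp add: vertical_paths_def)
  have \<alpha>C: "\<alpha> a \<in> cylinder_points (space_of X) ?P (\<lambda>\<gamma>. \<gamma> 0)" if "a \<in> points A" for a
    using \<tau>(2)[OF iB[OF that]] ptX[OF that] const by (auto simp: \<alpha>_def cylinder_points_def)
  have \<beta>C: "\<beta> b \<in> cylinder_points (space_of Y) (space_of X) p" if "b \<in> points B" for b
    using \<tau>(2)[OF that] vY[OF that] sX[OF that] s(3)[OF that] by (auto simp: \<beta>_def cylinder_points_def)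
  have \<alpha>: "G_map G A ?Z \<alpha>"
    unfolding G_map_def
  proof (intro conjI ballI)
    have "continuous_map (space_of A) (coarse_cylinder (space_of X) ?P (\<lambda>\<gamma>. \<gamma> 0)) \<alpha>"
      unfolding continuous_map_into_cylinder_iff
    proof (intro conjI)
      show "\<alpha> \<in> points A \<rightarrow> cylinder_points (space_of X) ?P (\<lambda>\<gamma>. \<gamma> 0)" using \<alpha>C by blast
      show "continuous_map (space_of A) euclideanreal (\<lambda>a. fst (\<alpha> a))"
        using continuous_map_compose[OF ic \<tau>(1)] by (simp add: \<alpha>_def o_def)
      show "continuous_map (space_of A) (space_of X) (\<lambda>a. fst (snd (\<alpha> a)))" using uc by (simp add: \<alpha>_def)
      let ?S = "subtopology (space_of A) {a. 0 < \<tau> (i a)}"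
      have "continuous_map ?S ?P (\<lambda>a r. u a)"
        unfolding continuous_map_into_path_topology_iff
      proof
        show "(\<lambda>a r. u a) \<in> topspace ?S \<rightarrow> vertical_paths (space_of X) p" using const ptX by auto
        show "continuous_map (prod_topology ?S euclideanreal) (space_of X) (\<lambda>x. u (fst x))"
          using continuous_map_compose[OF continuous_map_fst continuous_map_from_subtopology[OF uc]] by (simp add: o_def)
      qed
      then have "continuous_map ?S ?P (\<lambda>a. snd (snd (\<alpha> a)))"
        by (rule continuous_map_eq) (auto simp: \<alpha>_def)
      then show "continuous_map (subtopology (space_of A) {a. 0 < fst (\<alpha> a)}) ?P (\<lambda>a. snd (snd (\<alpha> a)))"
        by (simp add: \<alpha>_def)
    qed
    then show "continuous_map (space_of A) (space_of ?Z) \<alpha>"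
      by (simp add: resolution_total_def cylinder_gspace_def path_gspace_def)
    fix g a assume "g \<in> carrier G" "a \<in> points A"
    then show "\<alpha> (act A g a) = act ?Z g (\<alpha> a)"
      using u ti by (simp add: \<alpha>_def resolution_total_def cylinder_gspace_def path_gspace_def G_map_def)
  qed
  have \<beta>: "G_map G B ?W \<beta>"
    unfolding G_map_def
  proof (intro conjI ballI)
    have "continuous_map (space_of B) (coarse_cylinder (space_of Y) (space_of X) p) \<beta>"
      unfolding continuous_map_into_cylinder_iff
    proof (intro conjI)
      show "\<beta> \<in> points B \<rightarrow> cylinder_points (space_of Y) (space_of X) p" using \<beta>C by blast
      show "continuous_map (space_of B) euclideanreal (\<lambda>b. fst (\<beta> b))" using \<tau>(1) by (simp add: \<beta>_def)
      show "continuous_map (space_of B) (space_of Y) (\<lambda>b. fst (snd (\<beta> b)))" using vc by (simp add: \<beta>_def)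
      have "continuous_map (subtopology (space_of B) {b. 0 < \<tau> b}) (space_of X) (\<lambda>b. snd (snd (\<beta> b)))"
        using s(1) by (rule continuous_map_eq) (auto simp: \<beta>_def)
      then show "continuous_map (subtopology (space_of B) {b. 0 < fst (\<beta> b)}) (space_of X) (\<lambda>b. snd (snd (\<beta> b)))"
        by (simp add: \<beta>_def)
    qed
    then show "continuous_map (space_of B) (space_of ?W) \<beta>"
      by (simp add: resolution_base_def cylinder_gspace_def)
    fix g b assume gb: "g \<in> carrier G" "b \<in> points B"
    then show "\<beta> (act B g b) = act ?W g (\<beta> b)"
      using v \<tau>(3)[OF gb] s(2)[OF gb] by (simp add: \<beta>_def resolution_base_def cylinder_gspace_def G_map_def)
  qed
  have \<alpha>\<beta>: "resolution_map p (\<alpha> a) = \<beta> (i a)" if "a \<in> points A" for a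
    using uv[OF that] s(4)[OF that] by (simp add: resolution_map_def \<alpha>_def \<beta>_def)
  obtain l where l: "G_map G B ?Z l" "\<And>a. a \<in> points A \<Longrightarrow> l (i a) = \<alpha> a" "\<And>b. b \<in> points B \<Longrightarrow> resolution_map p (l b) = \<beta> b"
    using C_cofibration_lift_coarse[OF cof G TG T Csub coZ coW G_map_resolution[OF p] \<phi> \<psi> L \<alpha> \<beta> \<alpha>\<beta>] by blast
  define z where "z = (\<lambda>b. fst (snd (l b)))"
  define \<gamma> where "\<gamma> = (\<lambda>b. snd (snd (l b)))"
  have lc: "continuous_map (space_of B) (coarse_cylinder (space_of X) ?P (\<lambda>\<gamma>. \<gamma> 0)) l"
    using l(1) by (simp add: G_map_def resolution_total_def cylinder_gspace_def path_gspace_def)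
  have l\<tau>: "fst (l b) = \<tau> b" and pz: "p (z b) = v b" and \<gamma>1: "0 < \<tau> b \<Longrightarrow> \<gamma> b 1 = s b" if "b \<in> points B" for b
    using l(3)[OF that] by (auto simp: resolution_map_def \<beta>_def z_def \<gamma>_def split: if_splits)
  have lC: "l b \<in> cylinder_points (space_of X) ?P (\<lambda>\<gamma>. \<gamma> 0)" if "b \<in> points B" for b
    using lc that by (auto simp: continuous_map_def Pi_iff)
  have \<gamma>P: "\<gamma> b \<in> vertical_paths (space_of X) p" and \<gamma>0: "\<gamma> b 0 = z b" if "b \<in> points B" "0 < \<tau> b" for b
    using lC[OF that(1)] l\<tau>[OF that(1)] that(2) by (auto simp: cylinder_points_def z_def \<gamma>_def split: if_splits)
  \<comment> \<open>\<open>\<rho>\<close> vanishes for \<open>\<tau> \<le> 1/3\<close>, where \<open>\<gamma>\<close> may have no limit, and is \<open>1\<close> for \<open>\<tau> \<ge> 2/3\<close>.\<close>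
  define \<rho> where "\<rho> = (\<lambda>b. clamp01 (3 * \<tau> b - 1))"
  define f where "f = (\<lambda>b. if b \<in> {b. 0 < \<tau> b} then \<gamma> b (\<rho> b) else z b)"
  have opn: "openin (space_of B) {b \<in> points B. 0 < \<tau> b}" "openin (space_of B) {b \<in> points B. \<tau> b < 1/3}"
    using openin_continuous_map_preimage[OF \<tau>(1), of "{0<..}"] openin_continuous_map_preimage[OF \<tau>(1), of "{..<1/3}"]
    by (simp_all add: open_openin[symmetric])
  have zc: "continuous_map (space_of B) (space_of X) z"
    using lc unfolding continuous_map_into_cylinder_iff z_def by blast
  have fz: "f b = z b" if "b \<in> points B" "\<tau> b < 1/3" for b
    using that \<gamma>0[of b] by (auto simp: f_def \<rho>_def clamp01_def)
  have fc: "continuous_map (space_of B) (space_of X) f"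
  proof -
    let ?S = "subtopology (space_of B) {b \<in> points B. 0 < \<tau> b}"
    have Seq: "?S = subtopology (space_of B) {b. 0 < fst (l b)}"
    proof -
      have "{b \<in> points B. 0 < \<tau> b} = points B \<inter> {b. 0 < fst (l b)}" using l\<tau> by auto
      then show ?thesis using subtopology_restrict[of "space_of B" "{b. 0 < fst (l b)}"] by simp
    qed
    have "continuous_map ?S ?P \<gamma>"
      using lc unfolding Seq continuous_map_into_cylinder_iff \<gamma>_def by blast
    then have \<gamma>c: "continuous_map (prod_topology ?S euclideanreal) (space_of X) (\<lambda>x. \<gamma> (fst x) (snd x))"
      unfolding continuous_map_into_path_topology_iff by blast
    have "continuous_map (space_of B) euclideanreal \<rho>"
    proof -
      have "continuous_map euclideanreal euclideanreal (\<lambda>t. clamp01 (3 * t - 1))"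
        unfolding continuous_map_iff_continuous2
        by (rule continuous_on_compose2[OF continuous_on_clamp01[of UNIV]])
           (auto intro!: continuous_on_diff continuous_on_mult continuous_on_const continuous_on_id)
      from continuous_map_compose[OF \<tau>(1) this] show ?thesis by (simp add: \<rho>_def o_def)
    qed
    then have "continuous_map ?S (prod_topology ?S euclideanreal) (\<lambda>b. (b, \<rho> b))"
      by (intro continuous_map_pairedI continuous_map_id[unfolded id_def] continuous_map_from_subtopology)
    from continuous_map_compose[OF this \<gamma>c]
    have c1: "continuous_map ?S (space_of X) (\<lambda>b. \<gamma> b (\<rho> b))" by (simp add: o_def)
    have "continuous_map (space_of B) (space_of X) (\<lambda>b. if b \<in> {b \<in> points B. 0 < \<tau> b} then \<gamma> b (\<rho> b) else z b)"
    proof (rule continuous_map_glue_open[OF opn(1) opn(2) _ c1 continuous_map_from_subtopology[OF zc]])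
      show "points B \<subseteq> {b \<in> points B. 0 < \<tau> b} \<union> {b \<in> points B. \<tau> b < 1/3}" by force
      show "\<gamma> b (\<rho> b) = z b" if "b \<in> {b \<in> points B. 0 < \<tau> b}" "b \<in> {b \<in> points B. \<tau> b < 1/3}" for b
        using that fz[of b] by (simp add: f_def)
    qed
    then show ?thesis by (rule continuous_map_eq) (auto simp: f_def)
  qed
  show thesis
  proof (rule that)
    show "G_map G B X f"
      unfolding G_map_def
    proof (intro conjI ballI fc)
      fix g b assume gb: "g \<in> carrier G" "b \<in> points B"
      have "l (act B g b) = act ?Z g (l b)" using l(1) gb by (simp add: G_map_def)
      then have "z (act B g b) = act X g (z b)" "0 < \<tau> b \<Longrightarrow> \<gamma> (act B g b) = (\<lambda>r. act X g (\<gamma> b r))"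
        using l\<tau>[OF gb(2)] by (simp_all add: z_def \<gamma>_def resolution_total_def cylinder_gspace_def path_gspace_def)
      then show "f (act B g b) = act X g (f b)" using \<tau>(3)[OF gb] by (simp add: f_def \<rho>_def)
    qed
    show "f (i a) = u a" if "a \<in> points A" for a
      using l(2)[OF that] by (simp add: f_def z_def \<gamma>_def \<alpha>_def)
    show "p (f b) = v b" if "b \<in> points B" for b
      using pz[OF that] \<gamma>0[OF that] vertical_pathsD(4)[OF \<gamma>P[OF that], of "\<rho> b"] by (simp add: f_def)
    show "f b = s b" if "b \<in> points B" "2 / 3 \<le> \<tau> b" for b
      using \<gamma>1[OF that(1)] that by (simp add: f_def \<rho>_def clamp01_def)
  qed
qed

section \<open>Gluing the lifts over the cover\<close>

lemma continuous_map_locally: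
  assumes "\<And>x. x \<in> topspace X \<Longrightarrow> \<exists>N. openin X N \<and> x \<in> N \<and> continuous_map (subtopology X N) Y f"
  shows "continuous_map X Y f"
proof (rule pasting_lemma[where I="{N. openin X N \<and> continuous_map (subtopology X N) Y f}" and T="\<lambda>N. N" and f="\<lambda>_. f"])
  show "\<exists>N. N \<in> {N. openin X N \<and> continuous_map (subtopology X N) Y f} \<and> x \<in> N \<and> f x = f x" if "x \<in> topspace X" for x
    using assms[OF that] by blast
qed auto

text \<open>
Zorn's lemma is applied to pairs of a set \<open>K\<close> of indices and a lift \<open>s\<close> over the union \<open>W K\<close> of the corresponding
members of the cover. A larger pair may change \<open>s\<close>, but only on members that are new: a point that lies
in none of these keeps its value. As a point has a neighbourhood that meets finitely many members, the values
along a chain become constant near it. To add an index \<open>j\<close> to \<open>K\<close>, put \<open>\<tau> = \<sigma> / (\<sigma> + \<mu> j)\<close> on \<open>U j\<close>, with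
\<open>\<sigma>\<close> the sum of the functions \<open>\<mu> k\<close>, \<open>k \<in> K\<close>, which is positive exactly on \<open>W K\<close>. Then \<open>s\<close> is altered in \<open>U j\<close>
and remains unchanged where \<open>\<tau> \<ge> 2/3\<close>, in particular on the open set \<open>V\<close> where \<open>\<sigma> > 2 \<mu> j\<close>; and \<open>V\<close>
together with \<open>U j\<close> covers \<open>W K \<union> U j\<close>.
\<close>

theorem theorem1p4:
  fixes G :: "('g, 'm) monoid_scheme" and T :: "'g topology" and \<C> :: "'g set set"
    and A :: "('g, 'a) gspace" and B :: "('g, 'b) gspace" and i :: "'a \<Rightarrow> 'b"
    and J :: "'j set" and U :: "'j \<Rightarrow> 'b set"
  assumes "compact_Lie_group G T"
    and "conjugation_closed_subgroups G T \<C>"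
    and "G_space G T A" and "G_space G T B" and "G_map G A B i"
    and "G_numerable_open_cover G B J U"
    and "\<And>j. j \<in> J \<Longrightarrow>
           C_cofibration TYPE(('g, 'a, 'b, 'u) test_universe) G T \<C>
             (restrict_gspace A {a \<in> points A. i a \<in> U j}) (restrict_gspace B (U j)) i"
  shows "C_cofibration TYPE('u) G T \<C> A B i"
  unfolding C_cofibration_def has_lifting_property_def
proof (intro conjI allI impI assms(3-5), elim conjE)
  fix X Y :: "('g, 'u) gspace" and p u v
  assume X: "G_space G T X" and Y: "G_space G T Y" and fib: "C_fibration G \<C> X Y p" and we: "C_weak_equivalence G \<C> X Y p"
    and u: "G_map G A X u" and v: "G_map G B Y v" and uv: "\<forall>a\<in>points A. p (u a) = v (i a)"
  have G: "group G" and TG: "topspace T = carrier G" and T: "compact_space T" "Hausdorff_space T"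
    using assms(1) by (auto simp: compact_Lie_group_def Lie_group_def topological_group_def)
  have Csub: "H \<subseteq> carrier G" if "H \<in> \<C>" for H
    using assms(2) that subgroup.subset unfolding conjugation_closed_subgroups_def by blast
  note cov = assms(6)[unfolded G_numerable_open_cover_def]
  have Uopen: "openin (space_of B) (U j)" if "j \<in> J" for j using cov that by blast
  have Ucov: "(\<Union>j\<in>J. U j) = points B" using cov by blast
  have Ufin: "\<exists>N. openin (space_of B) N \<and> b \<in> N \<and> finite {j \<in> J. U j \<inter> N \<noteq> {}}" if "b \<in> points B" for b
    using cov that by blast
  have "\<forall>j\<in>J. \<exists>l. G_map G B trivial_interval l \<and> U j = {b \<in> points B. l b \<in> {0<..1}}" using cov by blast
  from bchoice[OF this] obtain \<mu> where \<mu>: "\<And>j. j \<in> J \<Longrightarrow> G_map G B trivial_interval (\<mu> j)"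
    "\<And>j. j \<in> J \<Longrightarrow> U j = {b \<in> points B. \<mu> j b \<in> {0<..1}}" by blast
  have \<mu>c: "continuous_map (space_of B) euclideanreal (\<mu> j)" if "j \<in> J" for j
    using \<mu>(1)[OF that] by (simp add: G_map_def trivial_interval_def unit_interval_def continuous_map_in_subtopology)
  have \<mu>01: "0 \<le> \<mu> j b \<and> \<mu> j b \<le> 1" if "j \<in> J" "b \<in> points B" for j b
    using \<mu>(1)[OF that(1)] that(2) by (auto simp: G_map_def trivial_interval_def unit_interval_def continuous_map_in_subtopology)
  have \<mu>inv: "\<mu> j (act B g b) = \<mu> j b" if "j \<in> J" "g \<in> carrier G" "b \<in> points B" for j g b
    using \<mu>(1)[OF that(1)] that(2,3) by (simp add: G_map_def trivial_interval_def)
  have U\<mu>: "b \<in> U j \<longleftrightarrow> 0 < \<mu> j b" if "j \<in> J" "b \<in> points B" for j b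
    using \<mu>(2)[OF that(1)] \<mu>01[OF that] that(2) by auto
  have UB: "U j \<subseteq> points B" if "j \<in> J" for j using \<mu>(2)[OF that] by auto
  have actB: "act B g b \<in> points B" if "g \<in> carrier G" "b \<in> points B" for g b
    using G_space_imp_coarse[OF G assms(4)] that by (simp add: coarse_G_space_def)
  have Uinv: "act B g b \<in> U j \<longleftrightarrow> b \<in> U j" if "j \<in> J" "g \<in> carrier G" "b \<in> points B" for j g b
    using U\<mu> \<mu>inv actB that by simp
  have iB: "i a \<in> points B" if "a \<in> points A" for a using assms(5) that by (auto simp: G_map_def continuous_map_def Pi_iff)
  define W where "W = (\<lambda>K. {b \<in> points B. \<exists>k\<in>K. b \<in> U k})"
  have Wopen: "openin (space_of B) (W K)" if "K \<subseteq> J" for K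
  proof -
    have "W K = (\<Union>k\<in>K. U k)" using UB that by (auto simp: W_def)
    moreover have "openin (space_of B) (\<Union>k\<in>K. U k)" using Uopen that by (intro openin_Union) auto
    ultimately show ?thesis by simp
  qed
  have WB: "W K \<subseteq> points B" for K by (auto simp: W_def)
  have Winv: "act B g b \<in> W K" if "K \<subseteq> J" "g \<in> carrier G" "b \<in> W K" for K g b
    using Uinv actB that unfolding W_def by blast
  \<comment> \<open>The sum is restricted to the finitely many nonzero terms.\<close>
  define \<sigma> where "\<sigma> = (\<lambda>K b. \<Sum>j\<in>{j \<in> K. b \<in> U j}. \<mu> j b)"
  have finU: "finite {j \<in> K. b \<in> U j}" if K: "K \<subseteq> J" and b: "b \<in> points B" for K b
  proof -
    obtain N where N: "b \<in> N" "finite {j \<in> J. U j \<inter> N \<noteq> {}}" using Ufin[OF b] by blast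
    show ?thesis using N(2) by (rule finite_subset[rotated]) (use K N(1) in blast)
  qed
  have \<sigma>pos: "0 < \<sigma> K b" if "K \<subseteq> J" "b \<in> W K" for K b
    unfolding \<sigma>_def
  proof (rule sum_pos)
    show "finite {j \<in> K. b \<in> U j}" using finU[OF that(1)] that(2) WB by blast
    show "{j \<in> K. b \<in> U j} \<noteq> {}" using that by (auto simp: W_def)
    show "0 < \<mu> j b" if "j \<in> {j \<in> K. b \<in> U j}" for j using that \<open>K \<subseteq> J\<close> \<open>b \<in> W K\<close> U\<mu> WB by blast
  qed
  have \<sigma>0: "\<sigma> K b = 0" if "b \<in> points B" "b \<notin> W K" for K b
    unfolding \<sigma>_def using that by (intro sum.neutral) (auto simp: W_def)
  have \<sigma>ge: "0 \<le> \<sigma> K b" if "K \<subseteq> J" "b \<in> points B" for K b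
    using \<sigma>pos[OF that(1)] \<sigma>0[OF that(2)] by (metis less_imp_le order_refl)
  have \<sigma>inv: "\<sigma> K (act B g b) = \<sigma> K b" if "K \<subseteq> J" "g \<in> carrier G" "b \<in> points B" for K g b
    unfolding \<sigma>_def using that Uinv[OF _ that(2,3)] \<mu>inv[OF _ that(2,3)] by (intro sum.cong) auto
  have \<sigma>c: "continuous_map (space_of B) euclideanreal (\<sigma> K)" if K: "K \<subseteq> J" for K
  proof (rule continuous_map_locally)
    fix b assume "b \<in> points B"
    then obtain N where N: "openin (space_of B) N" "b \<in> N" "finite {j \<in> J. U j \<inter> N \<noteq> {}}" using Ufin by blast
    let ?F = "{j \<in> K. U j \<inter> N \<noteq> {}}"
    have F: "finite ?F" using N(3) by (rule finite_subset[rotated]) (use K in blast)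
    have "continuous_map (space_of B) euclideanreal (\<lambda>b. \<Sum>j\<in>?F. \<mu> j b)"
      using F \<mu>c K by (intro continuous_map_sum) auto
    then have "continuous_map (subtopology (space_of B) N) euclideanreal (\<lambda>b. \<Sum>j\<in>?F. \<mu> j b)"
      by (rule continuous_map_from_subtopology)
    then have "continuous_map (subtopology (space_of B) N) euclideanreal (\<sigma> K)"
    proof (rule continuous_map_eq)
      fix x assume "x \<in> topspace (subtopology (space_of B) N)"
      then have x: "x \<in> N" "x \<in> points B" by auto
      have "\<mu> j x = 0" if "j \<in> ?F - {j \<in> K. x \<in> U j}" for j
        using U\<mu>[of j x] \<mu>01[of j x] that x K by force
      then show "(\<Sum>j\<in>?F. \<mu> j x) = \<sigma> K x"
        unfolding \<sigma>_def using F x by (intro sum.mono_neutral_right) auto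
    qed
    then show "\<exists>N. openin (space_of B) N \<and> b \<in> N \<and> continuous_map (subtopology (space_of B) N) euclideanreal (\<sigma> K)"
      using N by blast
  qed
  \<comment> \<open>Lifts have a default value outside \<open>W K\<close>, which makes \<open>le\<close> antisymmetric.\<close>
  define valid where "valid = (\<lambda>(K, s). K \<subseteq> J \<and> continuous_map (subtopology (space_of B) (W K)) (space_of X) s \<and>
     (\<forall>g\<in>carrier G. \<forall>b\<in>W K. s (act B g b) = act X g (s b)) \<and> (\<forall>b\<in>W K. p (s b) = v b) \<and>
     (\<forall>a\<in>points A. i a \<in> W K \<longrightarrow> s (i a) = u a) \<and> (\<forall>b. b \<notin> W K \<longrightarrow> s b = undefined))"
  define le where "le = (\<lambda>(K, s :: 'b \<Rightarrow> 'u) (K', s'). K \<subseteq> K' \<and> (\<forall>b\<in>W K. (\<forall>k\<in>K' - K. b \<notin> U k) \<longrightarrow> s' b = s b))"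
  have validD: "K \<subseteq> J" "continuous_map (subtopology (space_of B) (W K)) (space_of X) s"
     "\<And>g b. g \<in> carrier G \<Longrightarrow> b \<in> W K \<Longrightarrow> s (act B g b) = act X g (s b)" "\<And>b. b \<in> W K \<Longrightarrow> p (s b) = v b"
     "\<And>a. a \<in> points A \<Longrightarrow> i a \<in> W K \<Longrightarrow> s (i a) = u a" "\<And>b. b \<notin> W K \<Longrightarrow> s b = undefined"
    if "valid (K, s)" for K s
    using that by (auto simp: valid_def)
  have "\<exists>m\<in>Collect valid. \<forall>a\<in>Collect valid. le m a \<longrightarrow> a = m"
  proof (rule predicate_Zorn)
    show "partial_order_on (Collect valid) (relation_of le (Collect valid))"
    proof (rule partial_order_on_relation_ofI)
      show "le a a" if "a \<in> Collect valid" for a by (auto simp: le_def)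
      show "le a c" if "a \<in> Collect valid" "b \<in> Collect valid" "c \<in> Collect valid" "le a b" "le b c" for a b c
      proof -
        obtain K s K' s' K'' s'' where abc: "a = (K, s)" "b = (K', s')" "c = (K'', s'')" by (cases a, cases b, cases c) auto
        have sub: "K \<subseteq> K'" "K' \<subseteq> K''" and eq1: "\<And>b. b \<in> W K \<Longrightarrow> (\<forall>k\<in>K' - K. b \<notin> U k) \<Longrightarrow> s' b = s b"
          and eq2: "\<And>b. b \<in> W K' \<Longrightarrow> (\<forall>k\<in>K'' - K'. b \<notin> U k) \<Longrightarrow> s'' b = s' b"
          using that(4,5) by (auto simp: le_def abc)
        have "s'' b = s b" if "b \<in> W K" "\<forall>k\<in>K'' - K. b \<notin> U k" for b
        proof -
          have "b \<in> W K'" using that(1) sub by (auto simp: W_def)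
          then have "s'' b = s' b" using eq2 that(2) sub by blast
          also have "s' b = s b" using eq1 that sub by blast
          finally show ?thesis .
        qed
        then show ?thesis using sub by (auto simp: le_def abc)
      qed
      show "a = b" if "a \<in> Collect valid" "b \<in> Collect valid" "le a b" "le b a" for a b
      proof -
        obtain K s K' s' where ab: "a = (K, s)" "b = (K', s')" by (cases a, cases b) auto
        have K: "K' = K" using that(3,4) by (auto simp: le_def ab)
        have "s' b = s b" for b
        proof (cases "b \<in> W K")
          case True then show ?thesis using that(3) K by (auto simp: le_def ab)
        next
          case False then show ?thesis using validD(6)[of K s b] validD(6)[of K' s' b] that(1,2) K by (simp add: ab)
        qed
        then show ?thesis using K by (auto simp: ab)
      qed
    qed
  next
    fix C assume "C \<in> Chains (relation_of le (Collect valid))"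
    then have Cv: "\<And>a. a \<in> C \<Longrightarrow> valid a" and Cle: "\<And>a b. a \<in> C \<Longrightarrow> b \<in> C \<Longrightarrow> le a b \<or> le b a"
      unfolding Chains_def relation_of_def by blast+
    show "\<exists>m\<in>Collect valid. \<forall>a\<in>C. le a m"
    proof (cases "C = {}")
      case True
      have "W {} = {}" by (auto simp: W_def)
      then have "valid ({}, \<lambda>_. undefined)" by (auto simp: valid_def continuous_map_def)
      then show ?thesis using True by blast
    next
      case False
      define K where "K = \<Union> (fst ` C)"
      have KJ: "K \<subseteq> J" using Cv validD(1) unfolding K_def by fastforce
      have catch: "\<exists>a\<in>C. F \<subseteq> fst a" if "finite F" "F \<subseteq> K" for F
        using that
      proof (induction F rule: finite_induct)
        case empty then show ?case using False by blast
      next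
        case (insert k F)
        then obtain a a' where a: "a \<in> C" "F \<subseteq> fst a" "a' \<in> C" "k \<in> fst a'" unfolding K_def by auto
        from Cle[OF a(1,3)] show ?case
        proof
          assume "le a a'"
          then have "fst a \<subseteq> fst a'" by (auto simp: le_def)
          then show ?thesis using a by blast
        next
          assume "le a' a"
          then have "fst a' \<subseteq> fst a" by (auto simp: le_def)
          then show ?thesis using a by blast
        qed
      qed
      have agree: "snd a b = snd a' b"
        if "a \<in> C" "a' \<in> C" "b \<in> W K" "{k \<in> K. b \<in> U k} \<subseteq> fst a" "{k \<in> K. b \<in> U k} \<subseteq> fst a'" for a a' b
      proof -
        have 1: "snd c' b = snd c b" if "c \<in> C" "c' \<in> C" "le c c'" "{k \<in> K. b \<in> U k} \<subseteq> fst c" for c c'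
        proof -
          have "b \<in> W (fst c)" using \<open>b \<in> W K\<close> that(4) by (auto simp: W_def)
          moreover have "\<forall>k\<in>fst c' - fst c. b \<notin> U k" using that(2,4) unfolding K_def by blast
          ultimately show ?thesis using that(3) by (auto simp: le_def split: prod.splits)
        qed
        from Cle[OF that(1,2)] show ?thesis
        proof
          assume "le a a'"
          from 1[OF that(1,2) this that(4)] show ?thesis by simp
        next
          assume "le a' a"
          from 1[OF that(2,1) this that(5)] show ?thesis by simp
        qed
      qed
      \<comment> \<open>The value at \<open>b\<close> is taken from a member that contains all indices \<open>k \<in> K\<close> with \<open>b \<in> U k\<close>.\<close>
      define pick where "pick = (\<lambda>b. SOME a. a \<in> C \<and> {k \<in> K. b \<in> U k} \<subseteq> fst a)"
      have pick: "pick b \<in> C" "{k \<in> K. b \<in> U k} \<subseteq> fst (pick b)" if "b \<in> W K" for b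
      proof -
        have "\<exists>a. a \<in> C \<and> {k \<in> K. b \<in> U k} \<subseteq> fst a"
          using catch[OF finU[OF KJ]] that WB by blast
        from someI_ex[OF this] show "pick b \<in> C" "{k \<in> K. b \<in> U k} \<subseteq> fst (pick b)" unfolding pick_def by blast+
      qed
      define s where "s = (\<lambda>b. if b \<in> W K then snd (pick b) b else undefined)"
      have s: "s b = snd a b" if "b \<in> W K" "a \<in> C" "{k \<in> K. b \<in> U k} \<subseteq> fst a" for a b
        using agree[OF pick(1)[OF that(1)] that(2,1) pick(2)[OF that(1)] that(3)] that(1) by (simp add: s_def)
      have inW: "b \<in> W (fst a)" if "b \<in> W K" "{k \<in> K. b \<in> U k} \<subseteq> fst a" for a b
        using that by (auto simp: W_def)
      have val: "valid (fst (pick b), snd (pick b))" if "b \<in> W K" for b using Cv pick(1)[OF that] by simp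
      have "valid (K, s)"
        unfolding valid_def prod.case
      proof (intro conjI KJ ballI allI impI)
        show "continuous_map (subtopology (space_of B) (W K)) (space_of X) s"
        proof (rule continuous_map_locally)
          fix b assume "b \<in> topspace (subtopology (space_of B) (W K))"
          then have b: "b \<in> W K" "b \<in> points B" by auto
          obtain N where N: "openin (space_of B) N" "b \<in> N" "finite {j \<in> J. U j \<inter> N \<noteq> {}}" using Ufin[OF b(2)] by blast
          have "finite {k \<in> K. U k \<inter> N \<noteq> {}}" using N(3) by (rule finite_subset[rotated]) (use KJ in blast)
          then obtain a where a: "a \<in> C" "{k \<in> K. U k \<inter> N \<noteq> {}} \<subseteq> fst a" using catch by blast
          have sub: "{k \<in> K. x \<in> U k} \<subseteq> fst a" if "x \<in> N" for x using a(2) that by blast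
          have "valid (fst a, snd a)" using Cv[OF a(1)] by simp
          from validD(2)[OF this] have "continuous_map (subtopology (space_of B) (W K \<inter> N)) (space_of X) (snd a)"
            by (rule continuous_map_from_subtopology_mono) (use inW sub in blast)
          then have "continuous_map (subtopology (space_of B) (W K \<inter> N)) (space_of X) s"
            by (rule continuous_map_eq) (use s a(1) sub in auto)
          then show "\<exists>N. openin (subtopology (space_of B) (W K)) N \<and> b \<in> N \<and> continuous_map (subtopology (subtopology (space_of B) (W K)) N) (space_of X) s"
            using N b by (intro exI[of _ "W K \<inter> N"]) (auto simp: subtopology_subtopology openin_subtopology_Int2)
        qed
      next
        fix g b assume g: "g \<in> carrier G" and b: "b \<in> W K"
        have "{k \<in> K. act B g b \<in> U k} \<subseteq> fst (pick b)" using pick(2)[OF b] Uinv g b KJ WB by blast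
        then have "s (act B g b) = snd (pick b) (act B g b)" using s[OF Winv[OF KJ g b] pick(1)[OF b]] by blast
        also have "\<dots> = act X g (snd (pick b) b)" by (rule validD(3)[OF val[OF b] g inW[OF b pick(2)[OF b]]])
        finally show "s (act B g b) = act X g (s b)" using b by (simp add: s_def)
      next
        fix b assume b: "b \<in> W K"
        then show "p (s b) = v b" using validD(4)[OF val[OF b] inW[OF b pick(2)[OF b]]] by (simp add: s_def)
      next
        fix a assume a: "a \<in> points A" "i a \<in> W K"
        then show "s (i a) = u a" using validD(5)[OF val[OF a(2)] a(1) inW[OF a(2) pick(2)[OF a(2)]]] by (simp add: s_def)
      qed (simp add: s_def)
      moreover have "le a (K, s)" if "a \<in> C" for a
      proof -
        have "fst a \<subseteq> K" using that by (auto simp: K_def)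
        moreover have "s b = snd a b" if "b \<in> W (fst a)" "\<forall>k\<in>K - fst a. b \<notin> U k" for b
          using \<open>fst a \<subseteq> K\<close> that by (intro s \<open>a \<in> C\<close>) (auto simp: W_def)
        ultimately show ?thesis by (auto simp: le_def split: prod.splits)
      qed
      ultimately show ?thesis by blast
    qed
  qed
  then obtain K s where val: "valid (K, s)" and max: "\<And>a. valid a \<Longrightarrow> le (K, s) a \<Longrightarrow> a = (K, s)" by auto
  note sK = validD[OF val]
  have "K = J"
  proof (rule ccontr)
    assume "K \<noteq> J"
    then obtain j where j: "j \<in> J" "j \<notin> K" using sK(1) by blast
    let ?B = "restrict_gspace B (U j)" and ?A = "restrict_gspace A {a \<in> points A. i a \<in> U j}"
    define \<tau> where "\<tau> = (\<lambda>b. \<sigma> K b / (\<sigma> K b + \<mu> j b))"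
    have ptB: "points ?B = U j" and ptA: "points ?A = {a \<in> points A. i a \<in> U j}"
      using UB[OF j(1)] by (auto simp: restrict_gspace_def)
    have \<mu>j: "0 < \<mu> j b" if "b \<in> U j" for b using U\<mu>[OF j(1)] UB[OF j(1)] that by blast
    have \<sigma>j: "0 \<le> \<sigma> K b" if "b \<in> U j" for b using \<sigma>ge[OF sK(1)] UB[OF j(1)] that by blast
    have \<tau>pos: "b \<in> W K" if "b \<in> U j" "0 < \<tau> b" for b
      using \<sigma>0[of b K] UB[OF j(1)] that by (cases "b \<in> W K") (auto simp: \<tau>_def)
    obtain l where l: "G_map G ?B X l" "\<And>a. a \<in> points ?A \<Longrightarrow> l (i a) = u a" "\<And>b. b \<in> points ?B \<Longrightarrow> p (l b) = v b"
        "\<And>b. b \<in> points ?B \<Longrightarrow> 2 / 3 \<le> \<tau> b \<Longrightarrow> l b = s b"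
    proof (rule extend_partial_lift[OF assms(7)[OF j(1)] G TG T Csub X Y fib we, where u=u and v=v and \<tau>=\<tau> and s=s])
      show "G_map G ?A X u" using u by (auto simp: G_map_def restrict_gspace_def continuous_map_from_subtopology)
      show "G_map G ?B Y v" using v by (auto simp: G_map_def restrict_gspace_def continuous_map_from_subtopology)
      show "p (u a) = v (i a)" if "a \<in> points ?A" for a using uv that by (simp add: ptA)
      show "continuous_map (space_of ?B) euclideanreal \<tau>"
      proof -
        have c: "continuous_map (subtopology (space_of B) (U j)) euclideanreal (\<sigma> K)"
          "continuous_map (subtopology (space_of B) (U j)) euclideanreal (\<mu> j)"
          using \<sigma>c[OF sK(1)] \<mu>c[OF j(1)] by (auto intro: continuous_map_from_subtopology)
        have "\<sigma> K b + \<mu> j b \<noteq> 0" if "b \<in> U j" for b using \<mu>j[OF that] \<sigma>j[OF that] by linarith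
        then show ?thesis
          unfolding \<tau>_def restrict_gspace_def using c
          by (simp, intro continuous_map_real_divide continuous_map_add) auto
      qed
      show "0 \<le> \<tau> b \<and> \<tau> b \<le> 1" if "b \<in> points ?B" for b
        using \<mu>j \<sigma>j that by (auto simp: ptB \<tau>_def divide_le_eq_1 add_nonneg_pos less_imp_le)
      show "\<tau> (act ?B g b) = \<tau> b" if "g \<in> carrier G" "b \<in> points ?B" for g b
        using \<sigma>inv[OF sK(1) that(1)] \<mu>inv[OF j(1) that(1)] that(2) UB[OF j(1)] by (auto simp: \<tau>_def restrict_gspace_def)
      have "continuous_map (subtopology (space_of B) (U j \<inter> {b. 0 < \<tau> b})) (space_of X) s"
        using sK(2) by (rule continuous_map_from_subtopology_mono) (use \<tau>pos in blast)
      then show "continuous_map (subtopology (space_of ?B) {b. 0 < \<tau> b}) (space_of X) s"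
        by (simp add: restrict_gspace_def subtopology_subtopology)
      show "s (act ?B g b) = act X g (s b)" if "g \<in> carrier G" "b \<in> points ?B" "0 < \<tau> b" for g b
        using sK(3)[OF that(1)] \<tau>pos that by (simp add: ptB) (simp add: restrict_gspace_def)
      show "p (s b) = v b" if "b \<in> points ?B" "0 < \<tau> b" for b using sK(4) \<tau>pos that by (simp add: ptB)
      show "s (i a) = u a" if "a \<in> points ?A" "0 < \<tau> (i a)" for a using sK(5) \<tau>pos that by (simp add: ptA)
    next
      fix l assume "G_map G ?B X l" "\<And>a. a \<in> points ?A \<Longrightarrow> l (i a) = u a" "\<And>b. b \<in> points ?B \<Longrightarrow> p (l b) = v b"
        "\<And>b. b \<in> points ?B \<Longrightarrow> 2 / 3 \<le> \<tau> b \<Longrightarrow> l b = s b"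
      then show thesis by (rule that)
    qed
    \<comment> \<open>On \<open>U j\<close> the inequality \<open>\<tau> \<ge> 2/3\<close> means \<open>\<sigma> \<ge> 2 \<mu> j\<close>.\<close>
    define V where "V = {b \<in> points B. 2 * \<mu> j b < \<sigma> K b}"
    have VW: "V \<subseteq> W K"
    proof
      fix b assume "b \<in> V"
      then have "b \<in> points B" "0 < \<sigma> K b" using \<mu>01[OF j(1), of b] by (auto simp: V_def)
      then show "b \<in> W K" using \<sigma>0[of b K] by force
    qed
    have Wj: "W (insert j K) = V \<union> U j"
    proof (intro equalityI subsetI)
      fix b assume b: "b \<in> W (insert j K)"
      show "b \<in> V \<union> U j"
      proof (cases "b \<in> U j")
        case False
        then have "b \<in> W K" "b \<in> points B" using b by (auto simp: W_def)
        then show ?thesis using False U\<mu>[OF j(1), of b] \<mu>01[OF j(1), of b] \<sigma>pos[OF sK(1), of b] by (auto simp: V_def)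
      qed simp
    qed (use VW UB[OF j(1)] in \<open>auto simp: W_def\<close>)
    have sl: "s b = l b" if "b \<in> V" "b \<in> U j" for b
    proof -
      have "0 < \<mu> j b" "2 * \<mu> j b < \<sigma> K b" using \<mu>j that by (auto simp: V_def)
      then have "2 / 3 \<le> \<tau> b" by (simp add: \<tau>_def field_simps)
      then show ?thesis using l(4)[of b] that by (simp add: ptB)
    qed
    have Vopen: "openin (space_of B) V"
    proof -
      have "continuous_map (space_of B) euclideanreal (\<lambda>b. \<sigma> K b - 2 * \<mu> j b)"
        using \<sigma>c[OF sK(1)] \<mu>c[OF j(1)] by (intro continuous_map_diff continuous_map_real_mult_left)
      from openin_continuous_map_preimage[OF this, of "{0<..}"] show ?thesis
        by (simp add: V_def open_openin[symmetric])
    qed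
    define s' where "s' = (\<lambda>b. if b \<in> W (insert j K) then (if b \<in> V then s b else l b) else undefined)"
    have s'V: "s' b = s b" if "b \<in> V" for b using that by (simp add: s'_def Wj)
    have s'U: "s' b = l b" if "b \<in> U j" for b using that sl by (simp add: s'_def Wj)
    have Vinv: "act B g b \<in> V" if "g \<in> carrier G" "b \<in> V" for g b
      using that \<sigma>inv[OF sK(1)] \<mu>inv[OF j(1)] actB by (auto simp: V_def)
    have "valid (insert j K, s')"
      unfolding valid_def prod.case
    proof (intro conjI ballI allI impI)
      show "insert j K \<subseteq> J" using j sK(1) by blast
      let ?S = "subtopology (space_of B) (W (insert j K))"
      have "continuous_map ?S (space_of X) (\<lambda>b. if b \<in> V then s b else l b)"
      proof (rule continuous_map_glue_open[where T="U j"])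
        show "openin ?S V" "openin ?S (U j)"
          using Vopen Uopen[OF j(1)] Wj by (auto simp: openin_subtopology_alt intro!: exI)
        show "topspace ?S \<subseteq> V \<union> U j" by (auto simp: Wj)
        show "continuous_map (subtopology ?S V) (space_of X) s"
          unfolding subtopology_subtopology using sK(2) by (rule continuous_map_from_subtopology_mono) (use VW in blast)
        have "continuous_map (subtopology (space_of B) (U j)) (space_of X) l"
          using l(1) by (simp add: G_map_def restrict_gspace_def)
        then show "continuous_map (subtopology ?S (U j)) (space_of X) l"
          unfolding subtopology_subtopology by (rule continuous_map_from_subtopology_mono) blast
      qed (rule sl)
      then show "continuous_map ?S (space_of X) s'"
        by (rule continuous_map_eq) (simp add: s'_def)
    next
      fix g b assume g: "g \<in> carrier G" and b: "b \<in> W (insert j K)"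
      show "s' (act B g b) = act X g (s' b)"
      proof (cases "b \<in> V")
        case True
        then show ?thesis using s'V Vinv[OF g True] sK(3)[OF g] VW by auto
      next
        case False
        then have bU: "b \<in> U j" using b Wj by blast
        then have "act B g b \<in> U j" using Uinv[OF j(1) g] UB[OF j(1)] by blast
        moreover have "l (act B g b) = act X g (l b)"
          using l(1) g bU UB[OF j(1)] by (auto simp: G_map_def restrict_gspace_def)
        ultimately show ?thesis using s'U bU by simp
      qed
    next
      fix b assume b: "b \<in> W (insert j K)"
      show "p (s' b) = v b"
      proof (cases "b \<in> V")
        case True then show ?thesis using s'V sK(4) VW by auto
      next
        case False then show ?thesis using b Wj s'U l(3) ptB by auto
      qed
    next
      fix a assume a: "a \<in> points A" "i a \<in> W (insert j K)"
      show "s' (i a) = u a"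
      proof (cases "i a \<in> V")
        case True then show ?thesis using s'V sK(5) VW a by auto
      next
        case False then show ?thesis using a Wj s'U l(2) ptA by auto
      qed
    qed (simp add: s'_def)
    moreover have "le (K, s) (insert j K, s')"
    proof -
      have "s' b = s b" if "b \<in> W K" "b \<notin> U j" for b
      proof -
        have "b \<in> W (insert j K)" using that(1) by (auto simp: W_def)
        then show ?thesis using that(2) Wj s'V by blast
      qed
      then show ?thesis using j by (auto simp: le_def)
    qed
    ultimately have "(insert j K, s') = (K, s)" by (rule max)
    then show False using j by blast
  qed
  then have WK: "W K = points B" using Ucov by (auto simp: W_def)
  show "\<exists>l. G_map G B X l \<and> (\<forall>a\<in>points A. l (i a) = u a) \<and> (\<forall>b\<in>points B. p (l b) = v b)"
  proof (intro exI[of _ s] conjI ballI)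
    show "G_map G B X s" using sK(2,3) unfolding WK G_map_def by simp
    show "s (i a) = u a" if "a \<in> points A" for a using sK(5) that iB WK by blast
    show "p (s b) = v b" if "b \<in> points B" for b using sK(4) that WK by blast
  qed
qed

end
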